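(* Let $(Y,Z)$ follow the jump regression model with parameter $\beta\in\mathbb{R}$ and finite activity jumps described in the context (including assumptions (a) and (b) there), observed at times $i\Delta_n$, $0\le i\le n$, with $\Delta_n\to0$, $n\Delta_n\to\infty$ and $n\Delta_n^2\to0$. Let $K_n=\Delta_n^{\varpi}$ with $\frac13<\varpi<\frac12$, let $N_n=n\Delta_n\overline\lambda$, and let $\hat\beta_n$ be the estimator defined in the context. Then $$\sqrt{N_n}\,(\hat\beta_n-\beta)\longrightarrow\mathcal{N}\left(0,\sigma_\eta^2\right)$$ in law as $n\to\infty$.
   Context: Model. On a filtered probability space $(\Omega,\mathscr{F},(\mathscr{F}_t)_{t\ge0},\mathbb{P})$ satisfying the usual conditions, let $(Y,Z)$ be the bivariate It\^o semimartingale $$Y_t=Y_0+\int_0^ta_s\,ds+\int_0^t\sigma_s\,dW_s+\sum_{s\le t}(\beta+\eta_s)\Delta Z_s,$$ $$Z_t=Z_0+\int_0^ta'_s\,ds+\int_0^t\sigma'_s\,dW'_s+J_t,\qquad J_t=\sum_{i=1}^{R_t}\xi_i,\qquad t\ge0,$$ where $\Delta Z_s=Z_s-Z_{s-}$, $W,W'$ are two independent standard Brownian motions, $(Y_0,Z_0)$ is $\mathscr{F}_0$-measurable, $a,a',\sigma,\sigma'$ are bounded and c\`adl\`ag, $\beta\in\mathbb{R}$ is an unknown parameter, and $\eta=(\eta_t)_{t\ge0}$ is a family of i.i.d. bounded random variables with mean zero and variance $\sigma_\eta^2$, adapted to $(\mathscr{F}_t)_{t\ge0}$ and independent of all other processes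 in the model (i.e. of the ingredients $Y_0,Z,W,W',a,a',\sigma,\sigma',J$). Assume: (a) $R=(R_t)_{t\ge0}$ is an inhomogeneous Poisson process with a non-negative deterministic intensity $\lambda=(\lambda_t)_{t\ge0}$ such that $$\limsup_{n\to\infty}\sup_{1\le i\le n}\frac1{\Delta_n}\int_{(i-1)\Delta_n}^{i\Delta_n}\lambda_s\,ds\le\lambda^*$$ for some $\lambda^*>0$, and such that for some $\overline\lambda>0$, $\frac1x\int_0^x\lambda_s\,ds\to\overline\lambda$ as $x\to\infty$. (b) The $\xi_i$ are i.i.d., independent of all other processes involved, with a three times differentiable, even density $f$ satisfying $f(0)=0$; $\xi_i$ has a finite $(2+\delta)$th moment for some $\delta>0$; and the derivatives $f^{(j)}$ are bounded and integrable for all $0\le j\le3$. Estimator. With $\Delta_i^nX=X_{i\Delta_n}-X_{(i-1)\Delta_n}$ and $P_n=\sum_{i=1}^n\mathbf{1}_{\{|\Delta_i^nZ|>K_n\}}$, set $$\hat\beta_n=\frac{1}{P_n}\sum_{i=1}^n\frac{\Delta_i^nY}{\Delta_i^nZ}\mathbf{1}_{\{|\Delta_i^nZ|>K_n\}}\ \text{ if }P_n>0,\qquad \hat\beta_n=0\ \text{ if }P_n=0.$$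
   Formalization: Added: the values of η at the successive jump times of R are i.i.d. with the law of η_0 and independent of the other ingredients. Literal i.i.d./independence of (η_t) does not imply this: setting η to 0 at the jump times keeps all conditions but makes the limit 0. *)

theory Defs
  imports "HOL-Probability.Probability"
begin

text \<open>
  Processes are functions \<open>X t \<omega>\<close> of a real time \<open>t\<close>; only their values at
  \<open>t \<ge> 0\<close> are ever constrained or used.
\<close>

definition cadlag :: "(real \<Rightarrow> real) \<Rightarrow> bool" where
  "cadlag x \<longleftrightarrow> (\<forall>t\<ge>0. continuous (at_right t) x) \<and> (\<forall>t>0. \<exists>l. (x \<longlongrightarrow> l) (at_left t))"

definition jump :: "(real \<Rightarrow> real) \<Rightarrow> real \<Rightarrow> real" where
  "jump x s = x s - Lim (at_left s) x"

text \<open>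
  The normal law in terms of its variance. Variance 0 is the point mass; the library density
  degenerates to the zero function there.
\<close>

definition normal_law :: "real \<Rightarrow> real \<Rightarrow> real measure" where
  "normal_law m v = (if v = 0 then return borel m else density lborel (normal_density m (sqrt v)))"

definition incr :: "(real \<Rightarrow> 'a \<Rightarrow> real) \<Rightarrow> real \<Rightarrow> nat \<Rightarrow> 'a \<Rightarrow> real" where
  "incr X d i \<omega> = X (real i * d) \<omega> - X ((real i - 1) * d) \<omega>"

definition num_exceed ::
    "(real \<Rightarrow> 'a \<Rightarrow> real) \<Rightarrow> (nat \<Rightarrow> real) \<Rightarrow> (nat \<Rightarrow> real) \<Rightarrow> nat \<Rightarrow> 'a \<Rightarrow> real" where
  "num_exceed Z \<Delta> K n \<omega> = (\<Sum>i=1..n. of_bool (\<bar>incr Z (\<Delta> n) i \<omega>\<bar> > K n))"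

definition beta_hat ::
    "(real \<Rightarrow> 'a \<Rightarrow> real) \<Rightarrow> (real \<Rightarrow> 'a \<Rightarrow> real) \<Rightarrow> (nat \<Rightarrow> real) \<Rightarrow> (nat \<Rightarrow> real) \<Rightarrow> nat \<Rightarrow> 'a \<Rightarrow> real"
where
  "beta_hat Y Z \<Delta> K n \<omega> =
    (if num_exceed Z \<Delta> K n \<omega> > 0
     then 1 / num_exceed Z \<Delta> K n \<omega> *
       (\<Sum>i=1..n. incr Y (\<Delta> n) i \<omega> / incr Z (\<Delta> n) i \<omega> *
          of_bool (\<bar>incr Z (\<Delta> n) i \<omega>\<bar> > K n))
     else 0)"

definition arrival :: "(real \<Rightarrow> 'a \<Rightarrow> nat) \<Rightarrow> nat \<Rightarrow> 'a \<Rightarrow> real" where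
  "arrival R k \<omega> = Inf {t. 0 \<le> t \<and> k \<le> R t \<omega>}"

definition compound :: "(real \<Rightarrow> 'a \<Rightarrow> nat) \<Rightarrow> (nat \<Rightarrow> 'a \<Rightarrow> real) \<Rightarrow> real \<Rightarrow> 'a \<Rightarrow> real" where
  "compound R \<xi> t \<omega> = (\<Sum>i=1..R t \<omega>. \<xi> i \<omega>)"

definition step_process :: "nat \<Rightarrow> (nat \<Rightarrow> real) \<Rightarrow> (nat \<Rightarrow> 'a \<Rightarrow> real) \<Rightarrow> real \<Rightarrow> 'a \<Rightarrow> real" where
  "step_process m \<tau> h t \<omega> = (\<Sum>j<m. h j \<omega> * indicator {\<tau> j<..\<tau> (Suc j)} t)"

definition step_integral ::
    "nat \<Rightarrow> (nat \<Rightarrow> real) \<Rightarrow> (nat \<Rightarrow> 'a \<Rightarrow> real) \<Rightarrow> (real \<Rightarrow> 'a \<Rightarrow> real) \<Rightarrow> real \<Rightarrow> 'a \<Rightarrow> real" where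
  "step_integral m \<tau> h W t \<omega> =
     (\<Sum>j<m. h j \<omega> * (W (min t (\<tau> (Suc j))) \<omega> - W (min t (\<tau> j)) \<omega>))"

context prob_space
begin

definition cylinders :: "'i set \<Rightarrow> ('i \<Rightarrow> 'a \<Rightarrow> real) \<Rightarrow> 'a set set" where
  "cylinders I X = (\<Union>i\<in>I. {X i -` B \<inter> space M | B. B \<in> sets borel})"

definition indep_gen :: "'a set set \<Rightarrow> 'a set set \<Rightarrow> bool" where
  "indep_gen G H \<longleftrightarrow> indep_set (sigma_sets (space M) G) (sigma_sets (space M) H)"

text \<open>
  The Poisson probabilities are written out because \<open>poisson_pmf\<close> requires a positive rate,
  while the mean of an increment may be 0 here.
\<close>

definition inhom_poisson :: "(real \<Rightarrow> 'a \<Rightarrow> nat) \<Rightarrow> (real \<Rightarrow> real) \<Rightarrow> bool" where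
  "inhom_poisson R lam \<longleftrightarrow>
    (\<forall>t\<ge>0. 0 \<le> lam t) \<and> (\<forall>t\<ge>0. set_integrable lborel {0..t} lam) \<and>
    (\<forall>t\<ge>0. R t \<in> measurable M (count_space UNIV)) \<and>
    (\<forall>\<omega>\<in>space M. R 0 \<omega> = 0 \<and> mono_on {0..} (\<lambda>t. R t \<omega>) \<and> cadlag (\<lambda>t. real (R t \<omega>))) \<and>
    (\<forall>s t. 0 \<le> s \<and> s \<le> t \<longrightarrow>
      (let \<mu> = (LINT u:{s..t}|lborel. lam u)
       in \<forall>k. prob {\<omega>\<in>space M. R t \<omega> - R s \<omega> = k} = \<mu> ^ k / fact k * exp (- \<mu>)) \<and>
      indep_gen (cylinders {0..s} (\<lambda>u \<omega>. real (R u \<omega>)))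
                (cylinders {()} (\<lambda>_ \<omega>. real (R t \<omega>) - real (R s \<omega>))))"

end

text \<open>
  A filtered probability space with the usual conditions: \<open>F 0\<close> contains every subset of a
  null set (so \<open>M\<close> is complete too), and the filtration is right-continuous.
\<close>

locale filtered_prob_space = prob_space M for M :: "'a measure" +
  fixes F :: "real \<Rightarrow> 'a measure"
  assumes subalg: "0 \<le> t \<Longrightarrow> subalgebra M (F t)"
    and filtration_mono: "0 \<le> s \<Longrightarrow> s \<le> t \<Longrightarrow> sets (F s) \<subseteq> sets (F t)"
    and filtration_complete: "N \<in> null_sets M \<Longrightarrow> A \<subseteq> N \<Longrightarrow> A \<in> sets (F 0)"
    and filtration_right_cont: "0 \<le> t \<Longrightarrow> sets (F t) = (\<Inter>u\<in>{t<..}. sets (F u))"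
begin

definition adapted :: "(real \<Rightarrow> 'a \<Rightarrow> real) \<Rightarrow> bool" where
  "adapted X \<longleftrightarrow> (\<forall>t\<ge>0. X t \<in> borel_measurable (F t))"

definition bounded_cadlag :: "(real \<Rightarrow> 'a \<Rightarrow> real) \<Rightarrow> bool" where
  "bounded_cadlag X \<longleftrightarrow> adapted X \<and> (\<forall>\<omega>\<in>space M. cadlag (\<lambda>t. X t \<omega>)) \<and>
    (\<exists>C. \<forall>\<omega>\<in>space M. \<forall>t\<ge>0. \<bar>X t \<omega>\<bar> \<le> C)"

definition brownian :: "(real \<Rightarrow> 'a \<Rightarrow> real) \<Rightarrow> bool" where
  "brownian W \<longleftrightarrow> adapted W \<and>
    (\<forall>\<omega>\<in>space M. W 0 \<omega> = 0 \<and> continuous_on {0..} (\<lambda>t. W t \<omega>)) \<and>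
    (\<forall>s t. 0 \<le> s \<and> s < t \<longrightarrow>
      distributed M lborel (\<lambda>\<omega>. W t \<omega> - W s \<omega>) (normal_density 0 (sqrt (t - s))) \<and>
      indep_gen (sets (F s)) (cylinders {()} (\<lambda>_ \<omega>. W t \<omega> - W s \<omega>)))"

definition simple_integrand :: "nat \<Rightarrow> (nat \<Rightarrow> real) \<Rightarrow> (nat \<Rightarrow> 'a \<Rightarrow> real) \<Rightarrow> bool" where
  "simple_integrand m \<tau> h \<longleftrightarrow> 0 \<le> \<tau> 0 \<and> (\<forall>j<m. \<tau> j \<le> \<tau> (Suc j)) \<and>
    (\<forall>j<m. h j \<in> borel_measurable (F (\<tau> j)) \<and> (\<exists>C. \<forall>\<omega>\<in>space M. \<bar>h j \<omega>\<bar> \<le> C))"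

text \<open>
  \<open>ito_integral W H I\<close>: the process \<open>I\<close> is (a continuous version of) the Ito integral of
  \<open>H\<close> against the Brownian motion \<open>W\<close>, by the usual \<open>L\<^sup>2\<close> construction: on every
  horizon \<open>T\<close> it is the \<open>L\<^sup>2\<close> limit of elementary integrals of simple predictable
  integrands approximating \<open>H\<close> in \<open>L\<^sup>2([0,T] \<times> M)\<close>. This determines \<open>I\<close> up to
  indistinguishability.
\<close>

definition ito_integral ::
    "(real \<Rightarrow> 'a \<Rightarrow> real) \<Rightarrow> (real \<Rightarrow> 'a \<Rightarrow> real) \<Rightarrow> (real \<Rightarrow> 'a \<Rightarrow> real) \<Rightarrow> bool" where
  "ito_integral W H I \<longleftrightarrow> adapted I \<and> (\<forall>\<omega>\<in>space M. continuous_on {0..} (\<lambda>t. I t \<omega>)) \<and>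
    (\<forall>T\<ge>0. \<exists>m \<tau> h. (\<forall>k::nat. simple_integrand (m k) (\<tau> k) (h k)) \<and>
      (\<lambda>k. \<integral>\<^sup>+\<omega>. (\<integral>\<^sup>+s. ennreal ((step_process (m k) (\<tau> k) (h k) s \<omega> - H s \<omega>)\<^sup>2) *
            indicator {0..T} s \<partial>lborel) \<partial>M) \<longlonglongrightarrow> 0 \<and>
      (\<lambda>k. \<integral>\<^sup>+\<omega>. ennreal ((step_integral (m k) (\<tau> k) (h k) W T \<omega> - I T \<omega>)\<^sup>2) \<partial>M) \<longlonglongrightarrow> 0)"

definition iid_noise :: "(real \<Rightarrow> 'a \<Rightarrow> real) \<Rightarrow> real \<Rightarrow> bool" where
  "iid_noise \<eta> v \<longleftrightarrow> adapted \<eta> \<and> indep_vars (\<lambda>_. borel) \<eta> {0..} \<and>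
    (\<forall>t\<ge>0. distr M borel (\<eta> t) = distr M borel (\<eta> 0)) \<and>
    (\<exists>C. \<forall>t\<ge>0. AE \<omega> in M. \<bar>\<eta> t \<omega>\<bar> \<le> C) \<and>
    (\<forall>t\<ge>0. expectation (\<eta> t) = 0 \<and> variance (\<eta> t) = v)"

end

text \<open>
  The sum over \<open>s \<le> t\<close> of \<open>(\<beta> + \<eta> s) * jump Z s\<close> has almost surely finitely many non-zero
  terms; there is no jump at time 0.

  The condition \<open>noise_at_jumps\<close> makes precise in what sense the i.i.d. family
  \<open>\<eta>\<close> is independent of the rest of the model. A non-degenerate i.i.d. family indexed by a continuum has no
  jointly measurable version, so \<open>noise_iid\<close> and \<open>noise_indep\<close>, which only concern countably many
  deterministic times at once, say nothing about \<open>\<eta>\<close> at the random jump times: replacing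
  \<open>\<eta>\<close> by 0 at all jump times of \<open>Z\<close> changes each \<open>\<eta> t\<close> on a null set only, but removes
  the noise from \<open>Y\<close>. The condition asks that the values of \<open>\<eta>\<close> at the successive jump
  times
  (\<open>arrival R k\<close>, since the \<open>\<xi> k\<close> are almost surely non-zero), which are the only ones that
  enter \<open>Y\<close>, are still i.i.d. with the law of \<open>\<eta> 0\<close>
  and independent of the other ingredients.
\<close>

locale jump_regression = filtered_prob_space M F for M :: "'a measure" and F +
  fixes W W' a a' \<sigma> \<sigma>' :: "real \<Rightarrow> 'a \<Rightarrow> real"
    and R :: "real \<Rightarrow> 'a \<Rightarrow> nat" and lam :: "real \<Rightarrow> real"
    and \<xi> :: "nat \<Rightarrow> 'a \<Rightarrow> real" and f :: "real \<Rightarrow> real"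
    and \<eta> :: "real \<Rightarrow> 'a \<Rightarrow> real" and \<sigma>\<^sub>\<eta> \<beta> :: real
    and Y Z :: "real \<Rightarrow> 'a \<Rightarrow> real"
  assumes brownian_W: "brownian W" and brownian_W': "brownian W'"
    and indep_W: "indep_gen (cylinders {0..} W) (cylinders {0..} W')"
    and coefficients:
      "bounded_cadlag a" "bounded_cadlag a'" "bounded_cadlag \<sigma>" "bounded_cadlag \<sigma>'"
    and adapted_YZ: "adapted Y" "adapted Z"
    and poisson_R: "inhom_poisson R lam"
    and density_nonneg: "0 \<le> f x"
    and marks_density: "1 \<le> i \<Longrightarrow> distributed M lborel (\<xi> i) (\<lambda>x. ennreal (f x))"
    and marks_iid: "indep_vars (\<lambda>_. borel) \<xi> {1..}"
    and marks_indep: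
      "indep_gen (cylinders {1..} \<xi>)
        (cylinders {0} Y \<union> cylinders {0} Z \<union> cylinders {0..} W \<union> cylinders {0..} W' \<union>
         cylinders {0..} a \<union> cylinders {0..} a' \<union> cylinders {0..} \<sigma> \<union> cylinders {0..} \<sigma>' \<union>
         cylinders {0..} (\<lambda>t \<omega>. real (R t \<omega>)) \<union> cylinders {0..} \<eta>)"
    and noise_iid: "iid_noise \<eta> (\<sigma>\<^sub>\<eta>\<^sup>2)"
    and noise_indep:
      "indep_gen (cylinders {0..} \<eta>)
        (cylinders {0} Y \<union> cylinders {0..} Z \<union> cylinders {0..} W \<union> cylinders {0..} W' \<union>
         cylinders {0..} a \<union> cylinders {0..} a' \<union> cylinders {0..} \<sigma> \<union> cylinders {0..} \<sigma>' \<union>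
         cylinders {0..} (compound R \<xi>))"
    and noise_at_jumps:
      "indep_vars (\<lambda>_. borel) (\<lambda>k \<omega>. \<eta> (arrival R k \<omega>) \<omega>) {1..}"
      "1 \<le> k \<Longrightarrow> distr M borel (\<lambda>\<omega>. \<eta> (arrival R k \<omega>) \<omega>) = distr M borel (\<eta> 0)"
      "indep_gen (cylinders {1..} (\<lambda>k \<omega>. \<eta> (arrival R k \<omega>) \<omega>))
        (cylinders {0} Y \<union> cylinders {0..} Z \<union> cylinders {0..} W \<union> cylinders {0..} W' \<union>
         cylinders {0..} a \<union> cylinders {0..} a' \<union> cylinders {0..} \<sigma> \<union> cylinders {0..} \<sigma>' \<union>
         cylinders {0..} (compound R \<xi>))"
    and Z_eq: "\<exists>I'. ito_integral W' \<sigma>' I' \<and>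
      (AE \<omega> in M. \<forall>t\<ge>0. Z t \<omega> = Z 0 \<omega> + (LINT s:{0..t}|lborel. a' s \<omega>) + I' t \<omega> + compound R \<xi> t \<omega>)"
    and Y_eq: "\<exists>I. ito_integral W \<sigma> I \<and>
      (AE \<omega> in M. \<forall>t\<ge>0. Y t \<omega> = Y 0 \<omega> + (LINT s:{0..t}|lborel. a s \<omega>) + I t \<omega> +
        (\<Sum>\<^sub>\<infinity>s\<in>{0<..t}. (\<beta> + \<eta> s \<omega>) * jump (\<lambda>u. Z u \<omega>) s))"

end

theory Submission
  imports Defs
begin

text \<open>
  With probability tending to 1, every sampling interval contains at most one jump, the continuous
  parts \<open>D\<close> and \<open>D'\<close> of the increments of \<open>Y\<close> and \<open>Z\<close> are at most
  \<open>h = \<Delta> powr \<alpha>\<close> for some \<open>\<alpha>\<close> between \<open>expo\<close> and 1/2, and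
  all marks exceed \<open>2 * K\<close> in absolute value. The last point uses that an even density with
  \<open>f 0 = 0\<close> is \<open>O(x\<^sup>2)\<close> at 0, so that it fails with probability of order
  \<open>N * K ^ 3\<close>, which is at most of order \<open>n * \<Delta>\<^sup>2\<close> because \<open>expo > 1/3\<close>.
  On this event the exceedances are exactly the jumps, and the ratio at the jump with noise \<open>\<zeta>\<close> and mark
  \<open>\<xi>\<close> differs from \<open>\<beta>\<close> by \<open>\<zeta> - \<zeta> * D' / \<Delta>Z + (D - \<beta> * D') / \<Delta>Z\<close>.

  The \<open>\<zeta>\<close> are i.i.d. and independent of \<open>Z\<close>, hence of the number of exceedances: replacing this
  random number by \<open>\<lfloor>N\<rfloor>\<close>, and dropping the weights \<open>D' / \<Delta>Z\<close>, changes the normalized sum by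
  a quantity that vanishes in \<open>L\<^sup>2\<close>, and the central limit theorem applies to what remains.

  The jump times need not be independent of \<open>W\<close>, so \<open>D\<close> may be biased on the
  intervals with a jump. But up to an error of order \<open>h\<^sup>2 / \<xi>\<^sup>2\<close> the last term is
  \<open>(D - \<beta> * D') / \<xi>\<close>, and by evenness of \<open>f\<close> the variable \<open>1 / \<xi>\<close>, restricted to
  \<open>\<bar>\<xi>\<bar> > 2 * K\<close>, is centred, has a second moment bounded in \<open>K\<close>, and is independent of
  \<open>D\<close>, \<open>D'\<close> and the jump times; these terms are therefore orthogonal.
\<close>

section \<open>Independence and characteristic functions\<close>

text \<open>The good event involves the marks, the Brownian motions and the arrivals together, so
  multiplying by its indicator would destroy the independence behind both orthogonality arguments.
  Each sum is therefore replaced by a version truncated term by term inside one sigma-algebra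
  (\<open>observed\<close> for the weights of the noise, \<open>others\<close> for those of the
  reciprocal marks), with which it agrees on the good event; the complement enters only through its
  probability, via \<open>char_distr_diff_le\<close>. This is also why versions of the continuous
  parts inside generated sigma-algebras are needed (\<open>ito_version\<close>).

  Since n intervals are controlled at once and n * \<Delta> tends to infinity, Chebyshev's
  inequality for the continuous parts is too weak. Exponential moments of Riemann sums, carried to
  the Ito integral by the isometry, give a tail that beats every power of the mesh.

  Orthogonality needs a deterministic range of summation although the number of jumps is random: the
  sums run over \<open>k = 1..m\<close> with \<open>m\<close> about \<open>2 * N\<close>, and the
  randomness is moved into the weights by \<open>pick\<close>.\<close>

context prob_space
begin

lemma cylinders_subset_Pow: "cylinders I X \<subseteq> Pow (space M)"
  by (auto simp: cylinders_def)

lemma measurable_cylinders: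
  assumes "cylinders I X \<subseteq> G" "G \<subseteq> Pow (space M)" "i \<in> I"
  shows "X i \<in> borel_measurable (sigma (space M) G)"
proof (rule measurableI)
  fix A :: "real set" assume "A \<in> sets borel"
  then have "X i -` A \<inter> space M \<in> G"
    using assms by (auto simp: cylinders_def)
  then show "X i -` A \<inter> space (sigma (space M) G) \<in> sets (sigma (space M) G)"
    using assms(2) by (auto simp: sets_measure_of)
qed auto

lemma measurable_sigma_mono:
  assumes "X \<in> measurable (sigma (space M) G) N" "G \<subseteq> H" "H \<subseteq> Pow (space M)"
  shows "X \<in> measurable (sigma (space M) H) N"
proof -
  have "sets (sigma (space M) G) \<subseteq> sets (sigma (space M) H)"
    using sigma_sets_mono'[OF assms(2), of "space M"] assms(2,3) by (auto simp: sets_measure_of)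
  then show ?thesis
    using assms(1) by (auto simp: measurable_def space_measure_of_conv)
qed

text \<open>Independence makes all generators events, hence subsets of the space. This has to be
  recorded because \<open>sigma (space M) G\<close> is the generated sigma-algebra only for
  \<open>G\<close> below \<open>Pow (space M)\<close>.\<close>

lemma indep_gen_Pow:
  assumes "indep_gen G H"
  shows "G \<subseteq> Pow (space M)" "H \<subseteq> Pow (space M)"
  using indep_setD_ev1[of "sigma_sets (space M) G"] indep_setD_ev2[of _ "sigma_sets (space M) H"]
    assms sets.sets_into_space unfolding indep_gen_def
  by (blast intro: sigma_sets.Basic)+

lemma indep_gen_measurable:
  assumes "indep_gen G H"
  shows "X \<in> measurable (sigma (space M) G) N \<Longrightarrow> X \<in> measurable M N"
    and "Y \<in> measurable (sigma (space M) H) N \<Longrightarrow> Y \<in> measurable M N"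
  using indep_gen_Pow[OF assms] indep_setD_ev1[OF assms[unfolded indep_gen_def]]
    indep_setD_ev2[OF assms[unfolded indep_gen_def]]
  unfolding measurable_def by (auto simp: sets_measure_of)

text \<open>The preimages under a variable measurable with respect to
  \<open>sigma (space M) G\<close> form a subfamily of the sigma-algebra generated by
  \<open>G\<close>. All later uses of independence in the model pass through this form: exhibit two
  variables as functions of two independent families.\<close>

lemma indep_gen_imp_indep_var:
  assumes ind: "indep_gen G H"
    and X: "X \<in> measurable (sigma (space M) G) N" and Y: "Y \<in> measurable (sigma (space M) H) L"
  shows "indep_var N X L Y"
  unfolding indep_var_eq
proof (intro conjI)
  note P = indep_gen_Pow[OF ind]
  show "random_variable N X" "random_variable L Y"
    using indep_gen_measurable[OF ind] X Y by auto
  have "sigma_sets (space M) {X -` A \<inter> space M |A. A \<in> sets N} \<subseteq> sigma_sets (space M) G"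
    using measurable_sets[OF X] P(1) by (intro sigma_sets_mono) (auto simp: sets_measure_of)
  moreover have "sigma_sets (space M) {Y -` A \<inter> space M |A. A \<in> sets L} \<subseteq> sigma_sets (space M) H"
    using measurable_sets[OF Y] P(2) by (intro sigma_sets_mono) (auto simp: sets_measure_of)
  ultimately show "indep_set (sigma_sets (space M) {X -` A \<inter> space M |A. A \<in> sets N})
      (sigma_sets (space M) {Y -` A \<inter> space M |A. A \<in> sets L})"
    using ind unfolding indep_gen_def indep_sets2_eq by blast
qed

lemma indep_gen_expectation_mult:
  fixes X Y :: "'a \<Rightarrow> real"
  assumes "indep_gen G H"
    and "X \<in> borel_measurable (sigma (space M) G)" "Y \<in> borel_measurable (sigma (space M) H)"
    and "integrable M X" "integrable M Y"
  shows "integrable M (\<lambda>\<omega>. X \<omega> * Y \<omega>)"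
    and "expectation (\<lambda>\<omega>. X \<omega> * Y \<omega>) = expectation X * expectation Y"
  using indep_gen_imp_indep_var[OF assms(1-3)] assms(4,5)
  by (auto intro: indep_var_integrable indep_var_lebesgue_integral)

lemma integrable_mult_of_squares:
  fixes X Y :: "'a \<Rightarrow> real"
  assumes [measurable]: "random_variable borel X" "random_variable borel Y"
    and "integrable M (\<lambda>\<omega>. (X \<omega>)\<^sup>2)" "integrable M (\<lambda>\<omega>. (Y \<omega>)\<^sup>2)"
  shows "integrable M (\<lambda>\<omega>. X \<omega> * Y \<omega>)"
proof (rule Bochner_Integration.integrable_bound)
  show "integrable M (\<lambda>\<omega>. (X \<omega>)\<^sup>2 + (Y \<omega>)\<^sup>2)" using assms by simp
  have "\<bar>x * y\<bar> \<le> x\<^sup>2 + y\<^sup>2" for x y :: real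
  proof -
    have "0 \<le> (\<bar>x\<bar> - \<bar>y\<bar>)\<^sup>2" by simp
    then have "2 * (\<bar>x\<bar> * \<bar>y\<bar>) \<le> x\<^sup>2 + y\<^sup>2" by (simp add: power2_diff)
    moreover have "0 \<le> \<bar>x\<bar> * \<bar>y\<bar>" by simp
    ultimately show ?thesis unfolding abs_mult by linarith
  qed
  then show "AE \<omega> in M. norm (X \<omega> * Y \<omega>) \<le> norm ((X \<omega>)\<^sup>2 + (Y \<omega>)\<^sup>2)"
    by (simp add: abs_mult)
qed simp

text \<open>In the expanded square each mixed term factorizes into the expectation of two \<zeta>
  times that of two \<open>H\<close>, and the first factor vanishes off the diagonal; the weights
  \<open>H k\<close> may thus depend on each other in any way. Applied with the noise as \<zeta> and
  weights from \<open>observed\<close>, and with the truncated reciprocal marks as \<zeta> and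
  weights from \<open>others\<close>.\<close>

lemma indep_gen_orthogonal_sum:
  fixes \<zeta> H :: "'i \<Rightarrow> 'a \<Rightarrow> real"
  assumes ind: "indep_gen G G'" and fin: "finite A"
    and \<zeta>: "\<And>k. k \<in> A \<Longrightarrow> \<zeta> k \<in> borel_measurable (sigma (space M) G)"
    and H: "\<And>k. k \<in> A \<Longrightarrow> H k \<in> borel_measurable (sigma (space M) G')"
    and sq: "\<And>k. k \<in> A \<Longrightarrow> integrable M (\<lambda>\<omega>. (\<zeta> k \<omega>)\<^sup>2)"
    and bnd: "\<And>k \<omega>. k \<in> A \<Longrightarrow> \<omega> \<in> space M \<Longrightarrow> \<bar>H k \<omega>\<bar> \<le> B"
    and orth: "\<And>k l. k \<in> A \<Longrightarrow> l \<in> A \<Longrightarrow> k \<noteq> l \<Longrightarrow> expectation (\<lambda>\<omega>. \<zeta> k \<omega> * \<zeta> l \<omega>) = 0"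
    and var: "\<And>k. k \<in> A \<Longrightarrow> expectation (\<lambda>\<omega>. (\<zeta> k \<omega>)\<^sup>2) \<le> c"
  shows "integrable M (\<lambda>\<omega>. (\<Sum>k\<in>A. \<zeta> k \<omega> * H k \<omega>)\<^sup>2)"
    and "expectation (\<lambda>\<omega>. (\<Sum>k\<in>A. \<zeta> k \<omega> * H k \<omega>)\<^sup>2) \<le> c * expectation (\<lambda>\<omega>. \<Sum>k\<in>A. (H k \<omega>)\<^sup>2)"
proof -
  note mz = indep_gen_measurable(1)[OF ind \<zeta>] and mH = indep_gen_measurable(2)[OF ind H]
  have zz: "integrable M (\<lambda>\<omega>. \<zeta> k \<omega> * \<zeta> l \<omega>)" if "k \<in> A" "l \<in> A" for k l
    using that by (intro integrable_mult_of_squares mz sq)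
  have HH: "integrable M (\<lambda>\<omega>. H k \<omega> * H l \<omega>)" if "k \<in> A" "l \<in> A" for k l
  proof (rule integrable_const_bound[where B="B*B"])
    show "AE \<omega> in M. norm (H k \<omega> * H l \<omega>) \<le> B * B"
    proof (rule AE_I2)
      fix \<omega> assume "\<omega> \<in> space M"
      then have "\<bar>H k \<omega>\<bar> \<le> B" "\<bar>H l \<omega>\<bar> \<le> B" using bnd that by auto
      then show "norm (H k \<omega> * H l \<omega>) \<le> B * B"
        using mult_mono[of "\<bar>H k \<omega>\<bar>" B "\<bar>H l \<omega>\<bar>" B] by (simp add: abs_mult)
    qed
  qed (use that mH in \<open>auto intro!: borel_measurable_times\<close>)
  have prod: "integrable M (\<lambda>\<omega>. (\<zeta> k \<omega> * \<zeta> l \<omega>) * (H k \<omega> * H l \<omega>))"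
    "expectation (\<lambda>\<omega>. (\<zeta> k \<omega> * \<zeta> l \<omega>) * (H k \<omega> * H l \<omega>)) =
      expectation (\<lambda>\<omega>. \<zeta> k \<omega> * \<zeta> l \<omega>) * expectation (\<lambda>\<omega>. H k \<omega> * H l \<omega>)"
    if "k \<in> A" "l \<in> A" for k l
    using that by (auto intro!: indep_gen_expectation_mult[OF ind] zz HH \<zeta> H borel_measurable_times)
  have expand: "(\<Sum>k\<in>A. \<zeta> k \<omega> * H k \<omega>)\<^sup>2 =
      (\<Sum>k\<in>A. \<Sum>l\<in>A. (\<zeta> k \<omega> * \<zeta> l \<omega>) * (H k \<omega> * H l \<omega>))" for \<omega>
    unfolding power2_eq_square sum_product by (intro sum.cong refl) (simp add: mult_ac)
  show "integrable M (\<lambda>\<omega>. (\<Sum>k\<in>A. \<zeta> k \<omega> * H k \<omega>)\<^sup>2)"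
    unfolding expand using prod(1) by (intro Bochner_Integration.integrable_sum)
  have "expectation (\<lambda>\<omega>. (\<Sum>k\<in>A. \<zeta> k \<omega> * H k \<omega>)\<^sup>2) =
      (\<Sum>k\<in>A. \<Sum>l\<in>A. expectation (\<lambda>\<omega>. \<zeta> k \<omega> * \<zeta> l \<omega>) * expectation (\<lambda>\<omega>. H k \<omega> * H l \<omega>))"
    unfolding expand using prod
    by (subst Bochner_Integration.integral_sum, intro Bochner_Integration.integrable_sum, simp,
        intro sum.cong refl, subst Bochner_Integration.integral_sum, auto)
  also have "\<dots> = (\<Sum>k\<in>A. expectation (\<lambda>\<omega>. (\<zeta> k \<omega>)\<^sup>2) * expectation (\<lambda>\<omega>. (H k \<omega>)\<^sup>2))"
  proof (intro sum.cong refl)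
    fix k assume k: "k \<in> A"
    have "(\<Sum>l\<in>A. expectation (\<lambda>\<omega>. \<zeta> k \<omega> * \<zeta> l \<omega>) * expectation (\<lambda>\<omega>. H k \<omega> * H l \<omega>)) =
        (\<Sum>l\<in>A. if l = k then expectation (\<lambda>\<omega>. (\<zeta> k \<omega>)\<^sup>2) * expectation (\<lambda>\<omega>. (H k \<omega>)\<^sup>2) else 0)"
      using orth k by (intro sum.cong) (auto simp: power2_eq_square)
    then show "(\<Sum>l\<in>A. expectation (\<lambda>\<omega>. \<zeta> k \<omega> * \<zeta> l \<omega>) * expectation (\<lambda>\<omega>. H k \<omega> * H l \<omega>)) =
        expectation (\<lambda>\<omega>. (\<zeta> k \<omega>)\<^sup>2) * expectation (\<lambda>\<omega>. (H k \<omega>)\<^sup>2)"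
      using fin k by simp
  qed
  also have "\<dots> \<le> (\<Sum>k\<in>A. c * expectation (\<lambda>\<omega>. (H k \<omega>)\<^sup>2))"
    using var by (intro sum_mono mult_right_mono) auto
  also have "\<dots> = c * expectation (\<lambda>\<omega>. \<Sum>k\<in>A. (H k \<omega>)\<^sup>2)"
    using HH by (subst Bochner_Integration.integral_sum) (auto simp: power2_eq_square sum_distrib_left)
  finally show "expectation (\<lambda>\<omega>. (\<Sum>k\<in>A. \<zeta> k \<omega> * H k \<omega>)\<^sup>2) \<le> c * expectation (\<lambda>\<omega>. \<Sum>k\<in>A. (H k \<omega>)\<^sup>2)" .
qed

text \<open>The variance of the absolute value of \<open>X\<close> is non-negative.\<close>

lemma expectation_abs_le_sqrt:
  fixes X :: "'a \<Rightarrow> real"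
  assumes [measurable]: "random_variable borel X" and sq: "integrable M (\<lambda>\<omega>. (X \<omega>)\<^sup>2)"
    and le: "expectation (\<lambda>\<omega>. (X \<omega>)\<^sup>2) \<le> c"
  shows "integrable M X" "expectation (\<lambda>\<omega>. \<bar>X \<omega>\<bar>) \<le> sqrt c"
proof -
  show i: "integrable M X" by (rule square_integrable_imp_integrable[OF _ sq]) simp
  have "(expectation (\<lambda>\<omega>. \<bar>X \<omega>\<bar>))\<^sup>2 \<le> expectation (\<lambda>\<omega>. (X \<omega>)\<^sup>2)"
    using variance_positive[of "\<lambda>\<omega>. \<bar>X \<omega>\<bar>"] variance_eq[of "\<lambda>\<omega>. \<bar>X \<omega>\<bar>"] i sq by simp
  then show "expectation (\<lambda>\<omega>. \<bar>X \<omega>\<bar>) \<le> sqrt c"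
    using le by (intro real_le_rsqrt) simp
qed

text \<open>On \<open>G\<close> the map \<open>iexp\<close> is 1-Lipschitz, off \<open>G\<close> two
  points of the unit circle differ by at most 2. No control of \<open>V - S\<close> outside
  \<open>G\<close> is asked for, and on \<open>G\<close> an integrable majorant suffices.\<close>

lemma char_distr_diff_le:
  fixes V S X :: "'a \<Rightarrow> real"
  assumes [measurable]: "random_variable borel V" "random_variable borel S" and G: "G \<in> events"
    and X: "integrable M X" and le: "AE \<omega> in M. \<omega> \<in> G \<longrightarrow> \<bar>V \<omega> - S \<omega>\<bar> \<le> X \<omega>"
    and X0: "AE \<omega> in M. 0 \<le> X \<omega>"
  shows "norm (char (distr M borel V) t - char (distr M borel S) t) \<le>
    2 * prob (space M - G) + \<bar>t\<bar> * expectation X"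
proof -
  have iexp: "norm (iexp x - iexp y) \<le> \<bar>x - y\<bar>" for x y :: real
  proof -
    have "iexp x - iexp y = iexp y * (iexp (x - y) - 1)"
      by (simp add: algebra_simps exp_add[symmetric])
    then have "norm (iexp x - iexp y) = norm (iexp (x - y) - 1)"
      by (simp add: norm_mult)
    also have "\<dots> \<le> \<bar>x - y\<bar>" using iexp_approx1[of "x - y" 0] by simp
    finally show ?thesis .
  qed
  have int: "integrable M (\<lambda>\<omega>. iexp (t * V \<omega>))" "integrable M (\<lambda>\<omega>. iexp (t * S \<omega>))"
    by (auto intro!: integrable_iexp)
  have "char (distr M borel V) t - char (distr M borel S) t = (CLINT \<omega>|M. iexp (t * V \<omega>) - iexp (t * S \<omega>))"
    unfolding char_def using int by (simp add: integral_distr)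
  also have "norm \<dots> \<le> expectation (\<lambda>\<omega>. norm (iexp (t * V \<omega>) - iexp (t * S \<omega>)))"
    by (rule integral_norm_bound)
  also have "\<dots> \<le> expectation (\<lambda>\<omega>. 2 * indicator (space M - G) \<omega> + \<bar>t\<bar> * X \<omega>)"
  proof (rule integral_mono_AE)
    show "integrable M (\<lambda>\<omega>. 2 * indicator (space M - G) \<omega> + \<bar>t\<bar> * X \<omega>)"
      using X G by (intro Bochner_Integration.integrable_add integrable_mult_right integrable_real_indicator)
        (auto simp: emeasure_eq_measure)
    show "AE \<omega> in M. norm (iexp (t * V \<omega>) - iexp (t * S \<omega>)) \<le> 2 * indicator (space M - G) \<omega> + \<bar>t\<bar> * X \<omega>"
      using le X0 AE_space
    proof eventually_elim
      case (elim \<omega>)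
      show ?case
      proof (cases "\<omega> \<in> G")
        case True
        have "norm (iexp (t * V \<omega>) - iexp (t * S \<omega>)) \<le> \<bar>t * V \<omega> - t * S \<omega>\<bar>" by (rule iexp)
        also have "\<dots> = \<bar>t\<bar> * \<bar>V \<omega> - S \<omega>\<bar>" by (simp add: abs_mult[symmetric] algebra_simps)
        also have "\<dots> \<le> \<bar>t\<bar> * X \<omega>" using elim True by (intro mult_left_mono) auto
        finally show ?thesis using True by simp
      next
        case False
        have "norm (iexp (t * V \<omega>) - iexp (t * S \<omega>)) \<le> 2"
          by (rule order_trans[OF norm_triangle_ineq4]) simp
        then show ?thesis using False elim by (simp add: add_increasing2)
      qed
    qed
  qed (use int in auto)
  also have "\<dots> = 2 * prob (space M - G) + \<bar>t\<bar> * expectation X"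
    using X G by (subst Bochner_Integration.integral_add) (auto intro!: integrable_mult_right integrable_real_indicator simp: Int_absorb1 emeasure_eq_measure)
  finally show ?thesis .
qed

lemma bounded_integrable:
  fixes X :: "'a \<Rightarrow> real"
  assumes "random_variable borel X" "\<And>\<omega>. \<omega> \<in> space M \<Longrightarrow> \<bar>X \<omega>\<bar> \<le> C"
  shows "integrable M X"
  using assms by (intro integrable_const_bound[where B=C]) (auto intro: AE_I2)

lemma bounded_mult_integrable:
  fixes X Y :: "'a \<Rightarrow> real"
  assumes X: "random_variable borel X" "\<And>\<omega>. \<omega> \<in> space M \<Longrightarrow> \<bar>X \<omega>\<bar> \<le> C" and Y: "integrable M Y"
  shows "integrable M (\<lambda>\<omega>. X \<omega> * Y \<omega>)"
proof (rule Bochner_Integration.integrable_bound[where f="\<lambda>\<omega>. C * Y \<omega>"])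
  show "AE \<omega> in M. norm (X \<omega> * Y \<omega>) \<le> norm (C * Y \<omega>)"
  proof (rule AE_I2)
    fix \<omega> assume "\<omega> \<in> space M"
    then have "\<bar>X \<omega>\<bar> \<le> \<bar>C\<bar>" using X(2)[of \<omega>] by linarith
    then show "norm (X \<omega> * Y \<omega>) \<le> norm (C * Y \<omega>)" by (simp add: abs_mult mult_right_mono)
  qed
qed (use X(1) Y in auto)

text \<open>Chebyshev's inequality in \<open>ennreal\<close>, so that it applies to the distance
  between an Ito integral and its Riemann sums, which is known only as a non-negative integral and
  may be infinite for the first few sums.\<close>

lemma nn_square_markov:
  fixes X :: "'a \<Rightarrow> real"
  assumes [measurable]: "random_variable borel X" and e: "0 < e"
  shows "ennreal (prob {\<omega>\<in>space M. e \<le> \<bar>X \<omega>\<bar>}) \<le> ennreal (1 / e\<^sup>2) * (\<integral>\<^sup>+\<omega>. ennreal ((X \<omega>)\<^sup>2) \<partial>M)"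
proof -
  have "{\<omega>\<in>space M. e \<le> \<bar>X \<omega>\<bar>} = {\<omega>\<in>space M. 1 \<le> ennreal (1 / e\<^sup>2) * ennreal ((X \<omega>)\<^sup>2)}"
    using e abs_le_square_iff[of e] by (auto simp: ennreal_mult''[symmetric] ennreal_1[symmetric] simp del: ennreal_1)
  then have "ennreal (prob {\<omega>\<in>space M. e \<le> \<bar>X \<omega>\<bar>}) \<le> ennreal (1 / e\<^sup>2) * (\<integral>\<^sup>+\<omega>. ennreal ((X \<omega>)\<^sup>2) * indicator (space M) \<omega> \<partial>M)"
    using nn_integral_Markov_inequality[of "\<lambda>\<omega>. ennreal ((X \<omega>)\<^sup>2)" "space M" M "ennreal (1 / e\<^sup>2)"]
    by (simp add: emeasure_eq_measure)
  also have "(\<integral>\<^sup>+\<omega>. ennreal ((X \<omega>)\<^sup>2) * indicator (space M) \<omega> \<partial>M) = (\<integral>\<^sup>+\<omega>. ennreal ((X \<omega>)\<^sup>2) \<partial>M)"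
    by (intro nn_integral_cong) simp
  finally show ?thesis .
qed

lemma prob_UN_le:
  assumes "finite A" "\<And>i. i \<in> A \<Longrightarrow> E i \<in> events" "\<And>i. i \<in> A \<Longrightarrow> prob (E i) \<le> c"
  shows "prob (\<Union>i\<in>A. E i) \<le> real (card A) * c"
proof -
  have "prob (\<Union>i\<in>A. E i) \<le> (\<Sum>i\<in>A. prob (E i))" using assms by (intro finite_measure_subadditive_finite) auto
  also have "\<dots> \<le> (\<Sum>i\<in>A. c)" using assms by (intro sum_mono)
  finally show ?thesis by simp
qed

end

section \<open>Marks, Poisson counts and the central limit theorem\<close>

text \<open>Evenness gives \<open>deriv f 0 = - deriv f 0\<close>, so both lower Taylor coefficients
  vanish and only the second-order remainder is left. Boundedness of the second derivative makes the
  bound global rather than local.\<close>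

lemma even_density_quadratic_bound:
  fixes f :: "real \<Rightarrow> real"
  assumes diff: "\<And>j x. j < 2 \<Longrightarrow> (deriv ^^ j) f differentiable (at x)"
    and even: "\<And>x. f (- x) = f x" and zero: "f 0 = 0"
    and bnd: "bounded (range ((deriv ^^ 2) f))"
  obtains C where "0 \<le> C" "\<And>x. \<bar>f x\<bar> \<le> C * x\<^sup>2"
proof -
  have D: "((deriv ^^ j) f has_real_derivative (deriv ^^ Suc j) f x) (at x)" if "j < 2" for j x
    using diff[OF that, of x] by (simp add: DERIV_deriv_iff_real_differentiable)
  have D0: "(f has_real_derivative deriv f 0) (at 0)" using D[of 0 0] by simp
  then have "((\<lambda>x. f (- x)) has_real_derivative - deriv f 0) (at 0)"
    using DERIV_chain2[of f "deriv f 0" "\<lambda>x. - x" 0 "-1" UNIV] DERIV_minus[OF DERIV_ident, of 0 UNIV] by simp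
  then have "(f has_real_derivative - deriv f 0) (at 0)" unfolding even .
  from DERIV_unique[OF D0 this] have d0: "deriv f 0 = 0" by simp
  obtain C where C: "\<And>x. \<bar>(deriv ^^ 2) f x\<bar> \<le> C" using bnd by (auto simp: bounded_iff)
  have C0: "0 \<le> C" using C[of 0] by linarith
  have "\<bar>f x\<bar> \<le> C * x\<^sup>2" for x
  proof -
    obtain t where "f x = (\<Sum>m<2. (deriv ^^ m) f 0 / fact m * x ^ m) + (deriv ^^ 2) f t / fact 2 * x ^ 2"
      using Maclaurin_bi_le[of "\<lambda>m. (deriv ^^ m) f" f 2 x] D by auto
    then have "f x = (deriv ^^ 2) f t / 2 * x\<^sup>2" using d0 zero by (simp add: numeral_2_eq_2)
    then have "\<bar>f x\<bar> = \<bar>(deriv ^^ 2) f t\<bar> / 2 * x\<^sup>2"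
      by (simp only: abs_mult abs_divide abs_power2 abs_numeral)
    also have "\<dots> \<le> C * x\<^sup>2" using C[of t] by (intro mult_right_mono) auto
    finally show ?thesis .
  qed
  with C0 show ?thesis by (rule that)
qed

text \<open>The variance of the Poisson law. The square is written as
  \<open>k * (k - 1) + (1 - 2 * \<mu>) * k\<close> plus the square of \<mu>, because the factorial
  moments are shifted exponential series.\<close>

lemma poisson_sums:
  fixes \<mu> :: real
  shows "(\<lambda>k. (real k - \<mu>)\<^sup>2 * (\<mu> ^ k / fact k * exp (- \<mu>))) sums \<mu>"
proof -
  have e: "(\<lambda>k. \<mu> ^ k / fact k) sums exp \<mu>"
    using exp_converges[of \<mu>] by (simp add: divide_inverse mult.commute)
  have "(\<lambda>k. real (Suc k) * (\<mu> ^ Suc k / fact (Suc k))) = (\<lambda>k. \<mu> * (\<mu> ^ k / fact k))"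
    by (auto simp: fun_eq_iff divide_simps)
  then have "(\<lambda>k. real (Suc k) * (\<mu> ^ Suc k / fact (Suc k))) sums (\<mu> * exp \<mu>)"
    using sums_mult[OF e, of \<mu>] by simp
  then have e1: "(\<lambda>k. real k * (\<mu> ^ k / fact k)) sums (\<mu> * exp \<mu>)"
    by (subst (asm) sums_Suc_iff) simp
  have "(\<lambda>k. real (Suc k) * real k * (\<mu> ^ Suc k / fact (Suc k))) = (\<lambda>k. \<mu> * (real k * (\<mu> ^ k / fact k)))"
    by (auto simp: fun_eq_iff divide_simps)
  then have "(\<lambda>k. real (Suc k) * (real (Suc k) - 1) * (\<mu> ^ Suc k / fact (Suc k))) sums (\<mu> * (\<mu> * exp \<mu>))"
    using sums_mult[OF e1, of \<mu>] by simp
  then have e2: "(\<lambda>k. real k * (real k - 1) * (\<mu> ^ k / fact k)) sums (\<mu> * (\<mu> * exp \<mu>))"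
    by (subst (asm) sums_Suc_iff) simp
  have "(\<lambda>k. (real k * (real k - 1) * (\<mu> ^ k / fact k) + (1 - 2 * \<mu>) * (real k * (\<mu> ^ k / fact k))
      + \<mu>\<^sup>2 * (\<mu> ^ k / fact k)) * exp (- \<mu>)) sums
      ((\<mu> * (\<mu> * exp \<mu>) + (1 - 2 * \<mu>) * (\<mu> * exp \<mu>) + \<mu>\<^sup>2 * exp \<mu>) * exp (- \<mu>))"
    by (intro sums_mult2 sums_add sums_mult e e1 e2)
  moreover have "(\<mu> * (\<mu> * exp \<mu>) + (1 - 2 * \<mu>) * (\<mu> * exp \<mu>) + \<mu>\<^sup>2 * exp \<mu>) * exp (- \<mu>) =
      \<mu> * (exp \<mu> * exp (- \<mu>))"
    by (simp add: algebra_simps power2_eq_square)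
  ultimately show ?thesis
    by (simp add: exp_minus_inverse del: mult_cancel_left1) (simp add: algebra_simps power2_eq_square add_divide_distrib diff_divide_distrib)
qed

section \<open>Moments of the marks, Poisson counts and orthogonal sums\<close>

context prob_space
begin

context
  fixes X :: "'a \<Rightarrow> real" and f :: "real \<Rightarrow> real" and C :: real
  assumes X: "distributed M lborel X (\<lambda>x. ennreal (f x))"
    and f0: "\<And>x. 0 \<le> f x" and quad: "\<And>x. \<bar>f x\<bar> \<le> C * x\<^sup>2"
begin

lemma mark_density_measurable: "f \<in> borel_measurable borel"
  using distributed_real_measurable[OF _ X] f0 by simp

lemma mark_density_integral: "integrable lborel f" "integral\<^sup>L lborel f = 1"
  using distributed_integrable[OF X, of "\<lambda>_. 1"] distributed_integral[OF X, of "\<lambda>_. 1"] f0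
  by (simp_all add: prob_space)

text \<open>The density is at most \<open>C\<close> times the square of \<open>r\<close> on an
  interval of length \<open>2 * r\<close>.\<close>

lemma prob_small_mark:
  assumes "0 \<le> r"
  shows "prob {\<omega>\<in>space M. \<bar>X \<omega>\<bar> \<le> r} \<le> 2 * C * r ^ 3"
proof -
  note [measurable] = distributed_measurable[OF X] mark_density_measurable
  have C: "0 \<le> C" using quad[of 1] f0[of 1] by simp
  have "prob {\<omega>\<in>space M. \<bar>X \<omega>\<bar> \<le> r} = (\<integral>\<omega>. indicator {-r..r} (X \<omega>) \<partial>M)"
  proof -
    have "(\<integral>\<omega>. indicat_real {-r..r} (X \<omega>) \<partial>M) = (\<integral>\<omega>. indicat_real {\<omega>\<in>space M. \<bar>X \<omega>\<bar> \<le> r} \<omega> \<partial>M)"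
      by (intro Bochner_Integration.integral_cong) (auto simp: indicator_def)
    also have "\<dots> = prob ({\<omega>\<in>space M. \<bar>X \<omega>\<bar> \<le> r} \<inter> space M)" by (rule Bochner_Integration.integral_indicator)
    also have "{\<omega>\<in>space M. \<bar>X \<omega>\<bar> \<le> r} \<inter> space M = {\<omega>\<in>space M. \<bar>X \<omega>\<bar> \<le> r}" by auto
    finally show ?thesis by simp
  qed
  also have "\<dots> = (\<integral>x. f x * indicator {-r..r} x \<partial>lborel)"
    using f0 by (intro distributed_integral[OF X, symmetric]) auto
  also have "\<dots> \<le> (\<integral>x. C * r\<^sup>2 * indicator {-r..r} x \<partial>lborel)"
  proof (rule integral_mono')
    show "integrable lborel (\<lambda>x. C * r\<^sup>2 * indicator {-r..r} x :: real)"
      by (intro integrable_mult_right integrable_real_indicator) (auto simp: emeasure_lborel_Icc_eq)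
    show "f x * indicator {-r..r} x \<le> C * r\<^sup>2 * indicator {-r..r} x" for x
    proof (cases "x \<in> {-r..r}")
      case True
      then have "\<bar>x\<bar> \<le> \<bar>r\<bar>" using assms by auto
      then have "x\<^sup>2 \<le> r\<^sup>2" by (simp add: abs_le_square_iff)
      then show ?thesis using True quad[of x] C mult_left_mono[of "x\<^sup>2" "r\<^sup>2" C] by simp
    qed simp
  qed (use C in auto)
  also have "\<dots> = 2 * C * r ^ 3"
    using assms by (simp add: power2_eq_square power3_eq_cube)
  finally show ?thesis .
qed

text \<open>The quadratic bound on the density cancels the singularity on \<open>{-1..1}\<close> and
  contributes \<open>2 * C\<close>; elsewhere the reciprocal square is at most 1 and the total mass
  contributes 1. The bound does not depend on \<open>r\<close>, so the truncation level may tend to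
  0.\<close>

lemma reciprocal_mark_square:
  assumes r: "0 < r"
  shows "expectation (\<lambda>\<omega>. (of_bool (r < \<bar>X \<omega>\<bar>) / X \<omega>)\<^sup>2) \<le> 2 * C + 1"
proof -
  note [measurable] = distributed_measurable[OF X] mark_density_measurable
  have C: "0 \<le> C" using quad[of 1] f0[of 1] by simp
  have "expectation (\<lambda>\<omega>. (of_bool (r < \<bar>X \<omega>\<bar>) / X \<omega>)\<^sup>2) = (\<integral>x. f x * (of_bool (r < \<bar>x\<bar>) / x)\<^sup>2 \<partial>lborel)"
    using f0 by (intro distributed_integral[OF X, symmetric]) auto
  also have "\<dots> \<le> (\<integral>x. C * indicator {-1..1} x + f x \<partial>lborel)"
  proof (rule integral_mono')
    show "integrable lborel (\<lambda>x. C * indicator {-1..1} x + f x :: real)"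
      using mark_density_integral(1) by (intro Bochner_Integration.integrable_add integrable_mult_right integrable_real_indicator) auto
    show "f x * (of_bool (r < \<bar>x\<bar>) / x)\<^sup>2 \<le> C * indicator {-1..1} x + f x" for x
    proof (cases "x \<in> {-1..1}")
      case True
      show ?thesis
      proof (cases "x = 0")
        case False
        have "f x * (of_bool (r < \<bar>x\<bar>) / x)\<^sup>2 \<le> C * x\<^sup>2 * (1 / x\<^sup>2)"
          using quad[of x] C f0[of x] by (intro mult_mono) (auto simp: power_divide field_simps)
        then show ?thesis using True False f0[of x] by simp
      qed (use f0 C in \<open>simp add: add_nonneg_nonneg\<close>)
    next
      case False
      then have "1 \<le> x\<^sup>2" using abs_le_square_iff[of 1 x] by auto
      then have "(of_bool (r < \<bar>x\<bar>) / x)\<^sup>2 \<le> 1" by (simp add: power_divide divide_le_eq_1)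
      then have "f x * (of_bool (r < \<bar>x\<bar>) / x)\<^sup>2 \<le> f x * 1" using f0 by (intro mult_left_mono)
      then show ?thesis using False by simp
    qed
    show "0 \<le> C * indicator {-1..1} x + f x" for x using C f0 by (simp add: add_nonneg_nonneg)
  qed
  also have "\<dots> = 2 * C + 1"
    using mark_density_integral by (subst Bochner_Integration.integral_add) (auto intro!: integrable_mult_right)
  finally show ?thesis .
qed

text \<open>The integrand is odd, so reflection shows that its integral equals its own
  negative.\<close>

lemma reciprocal_mark_mean:
  assumes even: "\<And>x. f (- x) = f x"
  shows "expectation (\<lambda>\<omega>. of_bool (r < \<bar>X \<omega>\<bar>) / X \<omega>) = 0"
proof -
  note [measurable] = distributed_measurable[OF X] mark_density_measurable
  let ?g = "\<lambda>x. f x * (of_bool (r < \<bar>x\<bar>) / x)"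
  have "expectation (\<lambda>\<omega>. of_bool (r < \<bar>X \<omega>\<bar>) / X \<omega>) = (\<integral>x. ?g x \<partial>lborel)"
    using f0 by (intro distributed_integral[OF X, symmetric]) auto
  moreover have "(\<integral>x. ?g x \<partial>lborel) = (\<integral>x. ?g (- x) \<partial>lborel)"
    using lborel_integral_real_affine[of "-1" ?g 0] by simp
  moreover have "(\<integral>x. ?g (- x) \<partial>lborel) = - (\<integral>x. ?g x \<partial>lborel)"
    unfolding even by simp
  ultimately show ?thesis by simp
qed

end

text \<open>The second moment is computed as a non-negative series, which yields integrability and
  the value at the same time.\<close>

lemma poisson_centered_square:
  fixes X :: "'a \<Rightarrow> nat"
  assumes X: "X \<in> measurable M (count_space UNIV)" and \<mu>: "0 \<le> \<mu>"
    and P: "\<And>k. prob {\<omega>\<in>space M. X \<omega> = k} = \<mu> ^ k / fact k * exp (- \<mu>)"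
  shows "integrable M (\<lambda>\<omega>. (real (X \<omega>) - \<mu>)\<^sup>2)" "expectation (\<lambda>\<omega>. (real (X \<omega>) - \<mu>)\<^sup>2) = \<mu>"
proof -
  have d: "distr M (count_space UNIV) X = density (count_space UNIV) (\<lambda>k. ennreal (\<mu> ^ k / fact k * exp (- \<mu>)))"
  proof (rule measure_eqI_countable)
    fix k assume "k \<in> (UNIV :: nat set)"
    have "X -` {k} \<inter> space M = {\<omega>\<in>space M. X \<omega> = k}" by auto
    then show "emeasure (distr M (count_space UNIV) X) {k} =
      emeasure (density (count_space UNIV) (\<lambda>k. ennreal (\<mu> ^ k / fact k * exp (- \<mu>)))) {k}"
      using X P by (simp add: emeasure_distr emeasure_eq_measure emeasure_density
        one_ennreal_def[symmetric])
  qed auto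
  have "(\<integral>\<^sup>+\<omega>. ennreal ((real (X \<omega>) - \<mu>)\<^sup>2) \<partial>M) = (\<integral>\<^sup>+k. ennreal ((real k - \<mu>)\<^sup>2) \<partial>distr M (count_space UNIV) X)"
    using X by (subst nn_integral_distr) auto
  also have "\<dots> = (\<integral>\<^sup>+k. ennreal ((real k - \<mu>)\<^sup>2 * (\<mu> ^ k / fact k * exp (- \<mu>))) \<partial>count_space UNIV)"
    unfolding d using \<mu>
    by (subst nn_integral_density) (simp_all add: ennreal_mult''[symmetric] mult.commute[of _ "(real _ - \<mu>)\<^sup>2"])
  also have "\<dots> = (\<Sum>k. ennreal ((real k - \<mu>)\<^sup>2 * (\<mu> ^ k / fact k * exp (- \<mu>))))"
    by (rule nn_integral_count_space_nat)
  also have "\<dots> = ennreal \<mu>"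
    using poisson_sums[of \<mu>] \<mu> by (subst suminf_ennreal2) (auto simp: sums_iff)
  finally have nn: "(\<integral>\<^sup>+\<omega>. ennreal ((real (X \<omega>) - \<mu>)\<^sup>2) \<partial>M) = ennreal \<mu>" .
  have m: "(\<lambda>\<omega>. (real (X \<omega>) - \<mu>)\<^sup>2) \<in> borel_measurable M"
    using X by measurable
  have "has_bochner_integral M (\<lambda>\<omega>. (real (X \<omega>) - \<mu>)\<^sup>2) \<mu>"
    using m nn \<mu> by (intro has_bochner_integral_nn_integral) auto
  then show "integrable M (\<lambda>\<omega>. (real (X \<omega>) - \<mu>)\<^sup>2)" "expectation (\<lambda>\<omega>. (real (X \<omega>) - \<mu>)\<^sup>2) = \<mu>"
    by (auto simp: has_bochner_integral_iff)
qed

text \<open>Meant for a mean of order \<Delta>: summed over n intervals the bound is of order n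
  times the square of \<Delta>, which the mesh condition sends to 0.\<close>

lemma poisson_prob_ge_2:
  fixes X :: "'a \<Rightarrow> nat"
  assumes X: "X \<in> measurable M (count_space UNIV)" and \<mu>: "0 \<le> \<mu>"
    and P: "\<And>k. prob {\<omega>\<in>space M. X \<omega> = k} = \<mu> ^ k / fact k * exp (- \<mu>)"
  shows "prob {\<omega>\<in>space M. 2 \<le> X \<omega>} \<le> \<mu>\<^sup>2"
proof -
  note [measurable] = X
  have "{\<omega>\<in>space M. 2 \<le> X \<omega>} = space M - ({\<omega>\<in>space M. X \<omega> = 0} \<union> {\<omega>\<in>space M. X \<omega> = 1})"
    by auto
  then have "prob {\<omega>\<in>space M. 2 \<le> X \<omega>} = 1 - prob ({\<omega>\<in>space M. X \<omega> = 0} \<union> {\<omega>\<in>space M. X \<omega> = 1})"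
    by (simp only:) (rule prob_compl, measurable)
  also have "prob ({\<omega>\<in>space M. X \<omega> = 0} \<union> {\<omega>\<in>space M. X \<omega> = 1}) =
      prob {\<omega>\<in>space M. X \<omega> = 0} + prob {\<omega>\<in>space M. X \<omega> = 1}"
    by (rule finite_measure_Union) (measurable, auto)
  also have "1 - \<dots> = 1 - (1 + \<mu>) * exp (- \<mu>)" using P[of 0] P[of 1] by (simp add: algebra_simps)
  also have "\<dots> \<le> 1 - (1 + \<mu>) * (1 - \<mu>)"
    using exp_ge_add_one_self[of "-\<mu>"] \<mu> by (intro diff_left_mono mult_left_mono) auto
  finally show ?thesis by (simp add: algebra_simps power2_eq_square)
qed

lemma indep_vars_orthogonal:
  fixes X :: "'i \<Rightarrow> 'a \<Rightarrow> real"
  assumes ind: "indep_vars (\<lambda>_. borel) X I" and "k \<in> I" "l \<in> I" "k \<noteq> l"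
    and "integrable M (X k)" "integrable M (X l)" "expectation (X k) = 0"
  shows "expectation (\<lambda>\<omega>. X k \<omega> * X l \<omega>) = 0"
proof -
  have "indep_vars (\<lambda>_. borel) X {k, l}" using ind by (rule indep_vars_subset) (use assms in auto)
  then have "expectation (\<lambda>\<omega>. \<Prod>i\<in>{k, l}. X i \<omega>) = (\<Prod>i\<in>{k, l}. expectation (X i))"
    using assms by (intro indep_vars_lebesgue_integral) auto
  then show ?thesis using assms by simp
qed

text \<open>Allows constant weights in \<open>indep_gen_orthogonal_sum\<close>, which then becomes
  the plain statement \<open>orthogonal_sum\<close>.\<close>

lemma indep_gen_trivial: "G \<subseteq> events \<Longrightarrow> indep_gen G {}"
  unfolding indep_gen_def indep_sets2_eq sigma_sets_empty_eq
  using sets.sigma_sets_subset[of G M] by (auto simp: Int_absorb2 sets.sets_into_space prob_space)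

lemma orthogonal_sum:
  fixes \<zeta> :: "'i \<Rightarrow> 'a \<Rightarrow> real"
  assumes fin: "finite A" and \<zeta>: "\<And>k. k \<in> A \<Longrightarrow> random_variable borel (\<zeta> k)"
    and sq: "\<And>k. k \<in> A \<Longrightarrow> integrable M (\<lambda>\<omega>. (\<zeta> k \<omega>)\<^sup>2)"
    and orth: "\<And>k l. k \<in> A \<Longrightarrow> l \<in> A \<Longrightarrow> k \<noteq> l \<Longrightarrow> expectation (\<lambda>\<omega>. \<zeta> k \<omega> * \<zeta> l \<omega>) = 0"
    and var: "\<And>k. k \<in> A \<Longrightarrow> expectation (\<lambda>\<omega>. (\<zeta> k \<omega>)\<^sup>2) \<le> c"
  shows "integrable M (\<lambda>\<omega>. (\<Sum>k\<in>A. \<zeta> k \<omega>)\<^sup>2)"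
    and "expectation (\<lambda>\<omega>. (\<Sum>k\<in>A. \<zeta> k \<omega>)\<^sup>2) \<le> c * real (card A)"
proof -
  have sub: "events \<subseteq> Pow (space M)" using sets.sets_into_space by auto
  have ind: "indep_gen events {}" by (rule indep_gen_trivial) auto
  have m: "\<zeta> k \<in> borel_measurable (sigma (space M) events)" if "k \<in> A" for k
    using \<zeta>[OF that] sub by (simp add: measurable_def sets_measure_of space_measure_of_conv sets.sigma_sets_eq)
  show "integrable M (\<lambda>\<omega>. (\<Sum>k\<in>A. \<zeta> k \<omega>)\<^sup>2)"
    using indep_gen_orthogonal_sum(1)[OF ind fin, where \<zeta>=\<zeta> and H="\<lambda>_ _. 1" and B=1 and c=c] m sq orth var by simp
  show "expectation (\<lambda>\<omega>. (\<Sum>k\<in>A. \<zeta> k \<omega>)\<^sup>2) \<le> c * real (card A)"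
    using indep_gen_orthogonal_sum(2)[OF ind fin, where \<zeta>=\<zeta> and H="\<lambda>_ _. 1" and B=1 and c=c] m sq orth var by (simp add: prob_space)
qed

end

lemma char_normal_law: "char (normal_law 0 (s\<^sup>2)) t = complex_of_real (exp (- (s * t)\<^sup>2 / 2))"
proof (cases "s = 0")
  case True
  then show ?thesis
    by (simp add: normal_law_def char_def integral_return)
next
  case False
  interpret N: prob_space "density lborel std_normal_density"
    by (rule prob_space_normal_density) simp
  have "distributed (density lborel std_normal_density) lborel (\<lambda>x. x) std_normal_density"
    by (simp add: distributed_def distr_id2)
  from N.normal_density_affine[OF this, of "\<bar>s\<bar>" 0] False
  have "distr (density lborel std_normal_density) lborel (\<lambda>x. \<bar>s\<bar> * x) = density lborel (normal_density 0 \<bar>s\<bar>)"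
    by (simp add: distributed_def)
  then have n: "normal_law 0 (s\<^sup>2) = distr (density lborel std_normal_density) borel (\<lambda>x. \<bar>s\<bar> * x)"
    using False by (simp add: normal_law_def cong: distr_cong)
  have "char (normal_law 0 (s\<^sup>2)) t = char std_normal_distribution (t * \<bar>s\<bar>)"
    unfolding n char_def by (subst integral_distr) (auto simp: mult.assoc)
  then show ?thesis by (simp add: char_std_normal_distribution power_mult_distrib mult.commute)
qed

lemma real_distribution_normal_law: "real_distribution (normal_law 0 (s\<^sup>2))"
proof (cases "s = 0")
  case True
  then show ?thesis
    by (auto simp: normal_law_def real_distribution_def real_distribution_axioms_def intro: prob_space_return)
next
  case False
  then show ?thesis
    by (auto simp: normal_law_def real_distribution_def real_distribution_axioms_def intro: prob_space_normal_density)
qed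

section \<open>Central limit theorem under a real-valued normalization\<close>

context prob_space
begin

text \<open>Marks and noise are numbered from 1, while the central limit theorem sums over indices
  below \<open>n\<close> starting at 0.\<close>

lemma indep_vars_Suc:
  assumes "indep_vars (\<lambda>_. N) X {1..}"
  shows "indep_vars (\<lambda>_. N) (\<lambda>n. X (Suc n)) UNIV"
  unfolding indep_vars_def2
proof (intro conjI ballI)
  from assms have rv: "\<And>i. 1 \<le> i \<Longrightarrow> random_variable N (X i)"
    and ind: "indep_sets (\<lambda>i. {X i -` A \<inter> space M |A. A \<in> sets N}) {1..}"
    by (auto simp: indep_vars_def2)
  then show "random_variable N (X (Suc n))" for n by simp
  show "indep_sets (\<lambda>i. {X (Suc i) -` A \<inter> space M |A. A \<in> sets N}) UNIV"
  proof (rule indep_setsI)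
    show "{X (Suc i) -` A \<inter> space M |A. A \<in> sets N} \<subseteq> events" for i
      using rv[of "Suc i"] by (auto intro: measurable_sets)
    fix A and J :: "nat set" assume J: "J \<noteq> {}" "finite J"
      and A: "\<forall>j\<in>J. A j \<in> {X (Suc j) -` A \<inter> space M |A. A \<in> sets N}"
    have "prob (\<Inter>j\<in>Suc ` J. A (j - 1)) = (\<Prod>j\<in>Suc ` J. prob (A (j - 1)))"
      using J A by (intro indep_setsD[OF ind]) auto
    then show "prob (\<Inter>j\<in>J. A j) = (\<Prod>j\<in>J. prob (A j))"
      by (simp add: prod.reindex image_image)
  qed
qed

text \<open>The sum of \<open>m n\<close> terms, \<open>m n\<close> being the floor of
  \<open>N n\<close>, is compared with the standardized sum \<open>U (m n)\<close>. The two differ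
  by the factor \<open>sqrt (m n / N n)\<close>, which tends to 1, and the first absolute moment of
  \<open>U\<close> is at most 1, so the characteristic functions have the same limit. Variance 0 is
  treated apart, since the sum cannot be standardized and the limit is a point mass.\<close>

lemma char_normalized_sum:
  fixes X :: "nat \<Rightarrow> 'a \<Rightarrow> real" and N :: "nat \<Rightarrow> real"
  assumes ind: "indep_vars (\<lambda>_. borel) X {1..}"
    and law: "\<And>k. 1 \<le> k \<Longrightarrow> distr M borel (X k) = \<mu>"
    and sq: "\<And>k. 1 \<le> k \<Longrightarrow> integrable M (\<lambda>\<omega>. (X k \<omega>)\<^sup>2)"
    and mean: "\<And>k. 1 \<le> k \<Longrightarrow> expectation (X k) = 0"
    and var: "\<And>k. 1 \<le> k \<Longrightarrow> expectation (\<lambda>\<omega>. (X k \<omega>)\<^sup>2) = s\<^sup>2"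
    and N: "filterlim N at_top sequentially"
  shows "(\<lambda>n. char (distr M borel (\<lambda>\<omega>. (\<Sum>k=1..nat \<lfloor>N n\<rfloor>. X k \<omega>) / sqrt (N n))) t)
    \<longlonglongrightarrow> char (normal_law 0 (s\<^sup>2)) t"
proof -
  have rv[measurable]: "random_variable borel (X k)" if "1 \<le> k" for k
    using ind that by (auto simp: indep_vars_def2)
  have int: "integrable M (X k)" if "1 \<le> k" for k
    by (rule square_integrable_imp_integrable[OF rv sq]) (use that in auto)
  define Sm where "Sm m \<omega> = (\<Sum>k=1..m. X k \<omega>)" for m \<omega>
  have Sm[measurable]: "random_variable borel (Sm m)" for m
    unfolding Sm_def by (intro borel_measurable_sum rv) auto
  have SmSuc: "Sm m \<omega> = (\<Sum>i<m. X (Suc i) \<omega>)" for m \<omega>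
    unfolding Sm_def by (rule sum.reindex_bij_witness[of _ Suc "\<lambda>k. k - 1"]) auto
  have Sm2: "integrable M (\<lambda>\<omega>. (Sm m \<omega>)\<^sup>2)" "expectation (\<lambda>\<omega>. (Sm m \<omega>)\<^sup>2) \<le> s\<^sup>2 * real m" for m
  proof -
    have orth: "expectation (\<lambda>\<omega>. X k \<omega> * X l \<omega>) = 0" if "k \<in> {1..m}" "l \<in> {1..m}" "k \<noteq> l" for k l
      using that int mean by (intro indep_vars_orthogonal[OF ind]) auto
    note * = orthogonal_sum[of "{1..m}" X "s\<^sup>2", OF _ _ _ orth]
    show "integrable M (\<lambda>\<omega>. (Sm m \<omega>)\<^sup>2)" unfolding Sm_def by (rule *(1)) (use rv sq var in simp_all)
    have "expectation (\<lambda>\<omega>. (\<Sum>k=1..m. X k \<omega>)\<^sup>2) \<le> s\<^sup>2 * real (card {1..m})"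
      by (rule *(2)) (use rv sq var in simp_all)
    then show "expectation (\<lambda>\<omega>. (Sm m \<omega>)\<^sup>2) \<le> s\<^sup>2 * real m" unfolding Sm_def by simp
  qed
  have Npos: "eventually (\<lambda>n. 1 \<le> N n) sequentially" using N by (simp add: filterlim_at_top)
  define m where "m n = nat \<lfloor>N n\<rfloor>" for n
  have mtop: "filterlim m at_top sequentially"
    unfolding m_def
    by (rule filterlim_compose[OF filterlim_nat_sequentially filterlim_compose[OF filterlim_floor_sequentially N]])
  have le: "real (m n) \<le> N n" "N n < real (m n) + 1" "1 \<le> m n" if "1 \<le> N n" for n
    using that unfolding m_def by linarith+
  have ratio: "(\<lambda>n. sqrt (real (m n) / N n)) \<longlonglongrightarrow> 1"
  proof -
    have "(\<lambda>n. real (m n) / N n) \<longlonglongrightarrow> 1"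
    proof (rule tendsto_sandwich[where f="\<lambda>n. 1 - 1 / N n" and h="\<lambda>_. 1"])
      show "eventually (\<lambda>n. 1 - 1 / N n \<le> real (m n) / N n) sequentially"
        using Npos
      proof eventually_elim
        case (elim n)
        then have "(N n - 1) / N n \<le> real (m n) / N n" using le(2)[of n] by (intro divide_right_mono) auto
        then show ?case using elim by (simp add: diff_divide_distrib)
      qed
      show "eventually (\<lambda>n. real (m n) / N n \<le> 1) sequentially"
        using Npos
      proof eventually_elim
        case (elim n)
        then show ?case using le(1)[of n] by (simp add: field_simps)
      qed
      have "(\<lambda>n. 1 / N n) \<longlonglongrightarrow> 0"
        using tendsto_inverse_0_at_top[OF N] by (simp add: inverse_eq_divide)
      from tendsto_diff[OF tendsto_const[of 1] this] show "(\<lambda>n. 1 - 1 / N n) \<longlonglongrightarrow> 1" by simp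
    qed auto
    then show ?thesis using tendsto_real_sqrt by fastforce
  qed
  show ?thesis
  proof (cases "s = 0")
    case True
    have "AE \<omega> in M. Sm m \<omega> = 0" for m
    proof -
      have "expectation (\<lambda>\<omega>. (Sm m \<omega>)\<^sup>2) = 0"
        using Sm2(2)[of m] True by (intro antisym) auto
      then have "AE \<omega> in M. (Sm m \<omega>)\<^sup>2 = 0"
        using Sm2(1) by (subst (asm) integral_nonneg_eq_0_iff_AE) auto
      then show ?thesis by simp
    qed
    then have "(CLINT \<omega>|M. iexp (t * (Sm m \<omega> / c))) = (CLINT \<omega>|M. 1)" for m c
    proof (intro integral_cong_AE)
      show "AE \<omega> in M. iexp (t * (Sm m \<omega> / c)) = 1"
        using \<open>AE \<omega> in M. Sm m \<omega> = 0\<close> by eventually_elim simp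
    qed auto
    then have "char (distr M borel (\<lambda>\<omega>. Sm m \<omega> / c)) t = 1" for m c
      unfolding char_def by (subst integral_distr) (auto simp: prob_space)
    then show ?thesis using True unfolding char_normal_law m_def[symmetric] Sm_def[symmetric] by simp
  next
    case False
    \<comment> \<open>The parameter \<open>s\<close> is any real number with the right square and
      may be negative; the standard deviation is its absolute value.\<close>
    define \<tau> where "\<tau> = \<bar>s\<bar>"
    have \<tau>: "0 < \<tau>" "\<tau>\<^sup>2 = s\<^sup>2" using False by (auto simp: \<tau>_def)
    define U where "U n \<omega> = Sm n \<omega> / sqrt (real n * \<tau>\<^sup>2)" for n \<omega>
    have U[measurable]: "random_variable borel (U n)" for n unfolding U_def by measurable
    have "weak_conv_m (\<lambda>n. distr M borel (U n)) std_normal_distribution"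
      unfolding U_def SmSuc
      by (rule central_limit_theorem_zero_mean[OF indep_vars_Suc[OF ind]])
        (use \<tau> mean var sq law in auto)
    then have cU: "(\<lambda>n. char (distr M borel (U n)) u) \<longlonglongrightarrow> char std_normal_distribution u" for u
      by (intro levy_continuity1) (auto simp: real_distribution_def real_distribution_axioms_def
          intro!: prob_space_distr prob_space_normal_density)
    have U1: "expectation (\<lambda>\<omega>. \<bar>U n \<omega>\<bar>) \<le> 1" "integrable M (U n)" if "1 \<le> n" for n
    proof -
      have "integrable M (\<lambda>\<omega>. (U n \<omega>)\<^sup>2)" "expectation (\<lambda>\<omega>. (U n \<omega>)\<^sup>2) \<le> 1"
        using Sm2[of n] \<tau> that False unfolding U_def
        by (auto simp: power_divide divide_le_eq_1_pos mult.commute)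
      from expectation_abs_le_sqrt[OF U this] show "expectation (\<lambda>\<omega>. \<bar>U n \<omega>\<bar>) \<le> 1" "integrable M (U n)"
        by auto
    qed
    let ?r = "\<lambda>n. sqrt (real (m n) / N n)"
    have scale: "char (distr M borel (\<lambda>\<omega>. c * U n \<omega>)) t = char (distr M borel (U n)) (c * t)" for c n
      unfolding char_def by (subst (1 2) integral_distr) (auto simp: mult_ac)
    have eq: "Sm (m n) \<omega> / sqrt (N n) = (\<tau> * ?r n) * U (m n) \<omega>" if "1 \<le> N n" for n \<omega>
      using le[OF that] that False unfolding U_def \<tau>_def by (simp add: real_sqrt_mult real_sqrt_divide)
    have "(\<lambda>n. char (distr M borel (\<lambda>\<omega>. Sm (m n) \<omega> / sqrt (N n))) t -
        char (distr M borel (U (m n))) (\<tau> * t)) \<longlonglongrightarrow> 0"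
    proof (rule Lim_null_comparison)
      show "(\<lambda>n. \<bar>t\<bar> * (\<tau> * \<bar>?r n - 1\<bar>)) \<longlonglongrightarrow> 0"
        using tendsto_rabs[OF tendsto_diff[OF ratio tendsto_const[of 1]]]
        by (intro tendsto_mult_right_zero) simp
      show "eventually (\<lambda>n. norm (char (distr M borel (\<lambda>\<omega>. Sm (m n) \<omega> / sqrt (N n))) t -
        char (distr M borel (U (m n))) (\<tau> * t)) \<le> \<bar>t\<bar> * (\<tau> * \<bar>?r n - 1\<bar>)) sequentially"
        using Npos
      proof eventually_elim
        case (elim n)
        have "norm (char (distr M borel (\<lambda>\<omega>. (\<tau> * ?r n) * U (m n) \<omega>)) t -
            char (distr M borel (\<lambda>\<omega>. \<tau> * U (m n) \<omega>)) t) \<le>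
          2 * prob (space M - space M) + \<bar>t\<bar> * expectation (\<lambda>\<omega>. \<tau> * \<bar>?r n - 1\<bar> * \<bar>U (m n) \<omega>\<bar>)"
        proof (rule char_distr_diff_le)
          have "\<bar>\<tau> * ?r n * u - \<tau> * u\<bar> = \<tau> * \<bar>?r n - 1\<bar> * \<bar>u\<bar>" for u :: real
          proof -
            have "\<tau> * ?r n * u - \<tau> * u = \<tau> * (?r n - 1) * u" by (simp add: algebra_simps)
            then show ?thesis using \<tau>(1) by (simp add: abs_mult)
          qed
          then show "AE \<omega> in M. \<omega> \<in> space M \<longrightarrow> \<bar>\<tau> * ?r n * U (m n) \<omega> - \<tau> * U (m n) \<omega>\<bar> \<le> \<tau> * \<bar>?r n - 1\<bar> * \<bar>U (m n) \<omega>\<bar>"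
            by simp
        qed (use \<tau> U1(2)[OF le(3)[OF elim]] in auto)
        also have "\<dots> = \<bar>t\<bar> * (\<tau> * \<bar>?r n - 1\<bar> * expectation (\<lambda>\<omega>. \<bar>U (m n) \<omega>\<bar>))" by simp
        also have "\<dots> \<le> \<bar>t\<bar> * (\<tau> * \<bar>?r n - 1\<bar> * 1)"
          using U1(1)[OF le(3)[OF elim]] \<tau> by (intro mult_left_mono) auto
        finally show ?case using elim by (simp add: eq scale)
      qed
    qed
    moreover have "(\<lambda>n. char (distr M borel (U (m n))) (\<tau> * t)) \<longlonglongrightarrow> char std_normal_distribution (\<tau> * t)"
      using filterlim_compose[OF cU mtop] .
    ultimately have "(\<lambda>n. char (distr M borel (\<lambda>\<omega>. Sm (m n) \<omega> / sqrt (N n))) t) \<longlonglongrightarrow> char std_normal_distribution (\<tau> * t)"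
      using tendsto_add by fastforce
    then show ?thesis
      unfolding Sm_def m_def char_normal_law char_std_normal_distribution using \<tau>(2)
      by (simp add: power_mult_distrib)
  qed
qed

end

section \<open>Elementary stochastic integrals\<close>

text \<open>For a fixed size the jumps exceeding it do not accumulate inside the open half-line:
  just to the right of \<open>v\<close> the path stays near \<open>x v\<close>, just to the left
  near the left limit, so jumps close to \<open>v\<close> but different from \<open>v\<close> are
  small. A sparse set is countable, and the sizes \<open>1 / Suc n\<close> exhaust all
  discontinuities.\<close>

lemma cadlag_jumps_countable:
  fixes x :: "real \<Rightarrow> real"
  assumes x: "cadlag x"
  shows "countable {u. 0 < u \<and> \<not> (x \<longlongrightarrow> x u) (at_left u)}"
proof -
  define l where "l u = Lim (at_left u) x" for u
  have l: "(x \<longlongrightarrow> l u) (at_left u)" if "0 < u" for u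
    using x that tendsto_Lim[of "at_left u" x] unfolding cadlag_def l_def by force
  define J where "J n = {u. 0 < u \<and> \<bar>x u - l u\<bar> > 1 / real (Suc n)}" for n
  have "countable ({0<..} \<inter> J n)" for n
  proof (rule sparse_imp_countable)
    show "J n sparse_in {0<..}" unfolding sparse_in_def
    proof
      fix v :: real assume v: "v \<in> {0<..}"
      \<comment> \<open>Half the jump size: near \<open>u\<close> both the value and the left limit
        are within \<open>e\<close> of the same number \<open>c\<close>, so the jump is at most
        \<open>2 * e\<close>.\<close>
      define e where "e = 1 / real (Suc n) / 2"
      have e: "0 < e" by (simp add: e_def)
      have bound: "u \<notin> J n" if "0 < u" and near: "eventually (\<lambda>w. \<bar>x w - c\<bar> < e) (at_left u)" "\<bar>x u - c\<bar> < e" for u c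
      proof -
        have "((\<lambda>w. \<bar>x w - c\<bar>) \<longlongrightarrow> \<bar>l u - c\<bar>) (at_left u)"
          by (intro tendsto_intros l that)
        then have "\<bar>l u - c\<bar> \<le> e"
          by (rule tendsto_upperbound) (use near(1) in \<open>auto elim: eventually_mono\<close>)
        moreover have "e + e = 1 / real (Suc n)" unfolding e_def by (rule field_sum_of_halves)
        ultimately have "\<bar>x u - l u\<bar> \<le> 1 / real (Suc n)" using near(2) by linarith
        then show ?thesis by (simp add: J_def)
      qed
      have "(x \<longlongrightarrow> x v) (at_right v)"
        using x v by (simp add: cadlag_def continuous_within)
      from tendstoD[OF this e] obtain b where b: "v < b" "\<And>y. v < y \<Longrightarrow> y < b \<Longrightarrow> \<bar>x y - x v\<bar> < e"
        unfolding eventually_at_right_field dist_real_def by blast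
      from tendstoD[OF l e, of v] v obtain c where c: "c < v" "\<And>y. c < y \<Longrightarrow> y < v \<Longrightarrow> \<bar>x y - l v\<bar> < e"
        unfolding eventually_at_left_field dist_real_def by auto
      have right: "u \<notin> J n" if "v < u" "u < b" for u
      proof (rule bound[where c="x v"])
        show "eventually (\<lambda>w. \<bar>x w - x v\<bar> < e) (at_left u)"
          unfolding eventually_at_left_field using that b by (intro exI[of _ v]) auto
      qed (use that b v in auto)
      have left: "u \<notin> J n" if "max 0 c < u" "u < v" for u
      proof (rule bound[where c="l v"])
        show "eventually (\<lambda>w. \<bar>x w - l v\<bar> < e) (at_left u)"
          unfolding eventually_at_left_field using that c by (intro exI[of _ "max 0 c"]) auto
      qed (use that c in auto)
      show "\<exists>B. v \<in> B \<and> open B \<and> (\<forall>y\<in>B. \<not> y islimpt J n)"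
      proof (intro exI conjI ballI)
        show "v \<in> {max 0 c<..<b}" "open {max 0 c<..<b}" using v b c by auto
        fix y assume y: "y \<in> {max 0 c<..<b}"
        show "\<not> y islimpt J n"
        proof
          assume "y islimpt J n"
          then have "infinite (J n \<inter> {max 0 c<..<b})"
            using y by (metis islimpt_eq_acc_point open_greaterThanLessThan Int_commute)
          moreover have "J n \<inter> {max 0 c<..<b} \<subseteq> {v}"
            using left right by (force simp: not_less)
          ultimately show False using finite_subset by blast
        qed
      qed
    qed
  qed auto
  then have "countable (\<Union>n. {0<..} \<inter> J n)" by blast
  moreover have "{u. 0 < u \<and> \<not> (x \<longlongrightarrow> x u) (at_left u)} \<subseteq> (\<Union>n. {0<..} \<inter> J n)"
  proof
    fix u assume u: "u \<in> {u. 0 < u \<and> \<not> (x \<longlongrightarrow> x u) (at_left u)}"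
    then have "x u \<noteq> l u" using l[of u] by auto
    then obtain n where "inverse (real (Suc n)) < \<bar>x u - l u\<bar>"
      using reals_Archimedean[of "\<bar>x u - l u\<bar>"] by auto
    then show "u \<in> (\<Union>n. {0<..} \<inter> J n)" using u by (auto simp: J_def inverse_eq_divide)
  qed
  ultimately show ?thesis by (rule countable_subset[rotated])
qed

section \<open>Grids and elementary integrands as lists\<close>

definition grid :: "real \<Rightarrow> real \<Rightarrow> nat \<Rightarrow> nat \<Rightarrow> real" where
  "grid s t k j = s + (t - s) * real j / real k"

lemma grid_simps: "grid s t k 0 = s" "0 < k \<Longrightarrow> grid s t k k = t"
  by (simp_all add: grid_def)

lemma grid_Suc_diff: "grid s t k (Suc j) - grid s t k j = (t - s) / real k"
  by (simp add: grid_def field_simps add_divide_distrib[symmetric])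

lemma grid_mono: "s < t \<Longrightarrow> i \<le> j \<Longrightarrow> grid s t k i \<le> grid s t k j"
  by (simp add: grid_def divide_right_mono mult_left_mono)

lemma grid_cell:
  assumes "s < t" "0 < k" "s < u" "u \<le> t"
  obtains j where "j < k" "grid s t k j < u" "u \<le> grid s t k (Suc j)"
proof -
  have "\<exists>j. u \<le> grid s t k (Suc j)" using assms grid_simps(2)[of k s t] by (intro exI[of _ "k - 1"]) auto
  then obtain j where j: "u \<le> grid s t k (Suc j)" "\<And>i. i < j \<Longrightarrow> \<not> u \<le> grid s t k (Suc i)"
    using exists_least_iff[of "\<lambda>j. u \<le> grid s t k (Suc j)"] by auto
  have gt: "grid s t k j < u"
  proof (cases j)
    case 0 then show ?thesis using assms by (simp add: grid_simps)
  next
    case (Suc i) then show ?thesis using j(2)[of i] by auto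
  qed
  have "j < k"
  proof (rule ccontr)
    assume "\<not> j < k"
    then have "grid s t k k \<le> grid s t k j" using assms by (intro grid_mono) auto
    then show False using gt assms by (simp add: grid_simps)
  qed
  then show ?thesis using gt j(1) that by blast
qed

text \<open>
  An elementary integrand is a list of triples \<open>(a, b, h)\<close>, standing for the sum of
  the \<open>h * indicator {a<..b}\<close>; the intervals may overlap, so that concatenation is addition.
\<close>

type_synonym 'a elem = "(real \<times> real \<times> ('a \<Rightarrow> real)) list"

definition elem_integrand :: "'a elem \<Rightarrow> real \<Rightarrow> 'a \<Rightarrow> real" where
  "elem_integrand L u \<omega> = (\<Sum>(a, b, h)\<leftarrow>L. h \<omega> * indicator {a<..b} u)"

definition elem_integral :: "(real \<Rightarrow> 'a \<Rightarrow> real) \<Rightarrow> 'a elem \<Rightarrow> 'a \<Rightarrow> real" where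
  "elem_integral W L \<omega> = (\<Sum>(a, b, h)\<leftarrow>L. h \<omega> * (W b \<omega> - W a \<omega>))"

definition elem_neg :: "'a elem \<Rightarrow> 'a elem" where
  "elem_neg = map (\<lambda>(a, b, h). (a, b, \<lambda>\<omega>. - h \<omega>))"

text \<open>Left endpoints make each coefficient measurable at the start of its interval, as an Ito
  integrand has to be.\<close>

definition riemann :: "(real \<Rightarrow> 'a \<Rightarrow> real) \<Rightarrow> real \<Rightarrow> real \<Rightarrow> nat \<Rightarrow> 'a elem" where
  "riemann H s t k = map (\<lambda>j. (grid s t k j, grid s t k (Suc j), H (grid s t k j))) [0..<k]"

text \<open>Cuts a step process at the horizon \<open>T\<close>. The outer \<open>max\<close>
  collapses an interval that starts beyond \<open>T\<close> to an empty one instead of reversing its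
  endpoints.\<close>

definition truncated_step :: "nat \<Rightarrow> (nat \<Rightarrow> real) \<Rightarrow> (nat \<Rightarrow> 'a \<Rightarrow> real) \<Rightarrow> real \<Rightarrow> 'a elem" where
  "truncated_step m \<tau> h T = map (\<lambda>j. (\<tau> j, max (\<tau> j) (min T (\<tau> (Suc j))), h j)) [0..<m]"

lemma elem_append:
  "elem_integrand (L @ L') u \<omega> = elem_integrand L u \<omega> + elem_integrand L' u \<omega>"
  "elem_integral W (L @ L') \<omega> = elem_integral W L \<omega> + elem_integral W L' \<omega>"
  by (simp_all add: elem_integrand_def elem_integral_def)

lemma elem_neg_eq:
  "elem_integrand (elem_neg L) u \<omega> = - elem_integrand L u \<omega>"
  "elem_integral W (elem_neg L) \<omega> = - elem_integral W L \<omega>"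
  by (induction L) (auto simp: elem_integrand_def elem_integral_def elem_neg_def)

lemma elem_nth:
  "elem_integrand L u \<omega> = (\<Sum>i<length L. snd (snd (L ! i)) \<omega> * indicator {fst (L ! i)<..fst (snd (L ! i))} u)"
  "elem_integral W L \<omega> = (\<Sum>i<length L. snd (snd (L ! i)) \<omega> * (W (fst (snd (L ! i))) \<omega> - W (fst (L ! i)) \<omega>))"
  unfolding elem_integrand_def elem_integral_def
  by (simp_all add: sum_list_sum_nth split_def atLeast0LessThan)

lemma elem_integral_riemann:
  "elem_integral W (riemann H s t k) \<omega> =
    (\<Sum>j<k. H (grid s t k j) \<omega> * (W (grid s t k (Suc j)) \<omega> - W (grid s t k j) \<omega>))"
  by (simp add: elem_integral_def riemann_def sum_list_sum_nth atLeast0LessThan)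

lemma elem_integrand_riemann:
  assumes "s < t" "0 < k" "s < u" "u \<le> t"
  obtains j where "j < k" "grid s t k j < u" "u \<le> grid s t k (Suc j)"
    "\<And>\<omega>. elem_integrand (riemann H s t k) u \<omega> = H (grid s t k j) \<omega>"
proof -
  obtain j where j: "j < k" "grid s t k j < u" "u \<le> grid s t k (Suc j)"
    using grid_cell[OF assms] .
  have ind: "indicat_real {grid s t k i<..grid s t k (Suc i)} u = (if i = j then 1 else 0)" for i
  proof (cases i j rule: linorder_cases)
    case less
    then have "grid s t k (Suc i) \<le> grid s t k j" using assms by (intro grid_mono) auto
    then show ?thesis using j less by auto
  next
    case greater
    then have "grid s t k (Suc j) \<le> grid s t k i" using assms by (intro grid_mono) auto
    then show ?thesis using j greater by auto
  qed (use j in auto)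
  have "elem_integrand (riemann H s t k) u \<omega> = H (grid s t k j) \<omega>" for \<omega>
    using j(1) by (simp add: elem_integrand_def riemann_def sum_list_sum_nth atLeast0LessThan ind
        if_distrib[of "\<lambda>x. _ * x"] cong: if_cong)
  with j show ?thesis by (rule that)
qed

lemma elem_integrand_riemann_outside:
  assumes "s < t" "\<not> (s < u \<and> u \<le> t)"
  shows "elem_integrand (riemann H s t k) u \<omega> = 0"
proof -
  have "indicat_real {grid s t k i<..grid s t k (Suc i)} u = 0" if "i < k" for i
    using grid_mono[of s t 0 i k] grid_mono[of s t "Suc i" k k] that assms
    by (auto simp: grid_simps)
  then show ?thesis
    by (simp add: elem_integrand_def riemann_def sum_list_sum_nth atLeast0LessThan)
qed

lemma riemann_integrand_bound:
  assumes "s < t" "0 \<le> C" "\<And>u. 0 \<le> u \<Longrightarrow> \<bar>H u \<omega>\<bar> \<le> C" "0 \<le> s"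
  shows "\<bar>elem_integrand (riemann H s t k) u \<omega>\<bar> \<le> C * indicator {s<..t} u"
proof (cases "k = 0")
  case True
  then show ?thesis using assms by (simp add: elem_integrand_def riemann_def)
next
  case False
  show ?thesis
  proof (cases "s < u \<and> u \<le> t")
    case True
    obtain j where j: "j < k" "\<And>\<omega>. elem_integrand (riemann H s t k) u \<omega> = H (grid s t k j) \<omega>"
      using elem_integrand_riemann[of s t k u H] assms(1) False True by blast
    have "0 \<le> grid s t k j" using grid_mono[of s t 0 j k] assms by (simp add: grid_simps)
    then show ?thesis using j True assms(3) by simp
  next
    case False
    then show ?thesis using elem_integrand_riemann_outside[of s t u H k \<omega>] assms by auto
  qed
qed

text \<open>The value at \<open>u\<close> is taken at a grid point strictly below \<open>u\<close>
  and within one mesh width of it, so the limit is governed by the left limit alone.\<close>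

lemma riemann_integrand_tendsto:
  assumes "s < t" "0 \<le> s" "s < u" "u \<le> t" and lim: "((\<lambda>v. H v \<omega>) \<longlongrightarrow> c) (at_left u)"
  shows "(\<lambda>k. elem_integrand (riemann H s t k) u \<omega>) \<longlonglongrightarrow> c"
proof (rule tendstoI)
  fix e :: real assume "0 < e"
  from tendstoD[OF lim this] obtain b where b: "b < u" "\<And>y. b < y \<Longrightarrow> y < u \<Longrightarrow> dist (H y \<omega>) c < e"
    unfolding eventually_at_left_field by blast
  have "(\<lambda>k. (t - s) / real k) \<longlonglongrightarrow> 0"
    by (rule tendsto_divide_0[OF tendsto_const]) (simp add: filterlim_at_top_imp_at_infinity filterlim_real_sequentially)
  then have "eventually (\<lambda>k. (t - s) / real k < u - b) sequentially"
    using b(1) by (intro order_tendstoD) auto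
  then show "eventually (\<lambda>k. dist (elem_integrand (riemann H s t k) u \<omega>) c < e) sequentially"
    using eventually_gt_at_top[of 0]
  proof eventually_elim
    case (elim k)
    obtain j where j: "grid s t k j < u" "u \<le> grid s t k (Suc j)"
      "\<And>\<omega>. elem_integrand (riemann H s t k) u \<omega> = H (grid s t k j) \<omega>"
      using elem_integrand_riemann[of s t k u H] assms elim by blast
    then have "b < grid s t k j" using elim grid_Suc_diff[of s t k j] by linarith
    then show ?case using j b by simp
  qed
qed

text \<open>Left limit and value of a cadlag path differ at countably many times only, a Lebesgue
  null set.\<close>

lemma AE_riemann_integrand_tendsto:
  assumes "s < t" "0 \<le> s" "cadlag (\<lambda>v. H v \<omega>)"
  shows "AE u in lborel. (\<lambda>k. elem_integrand (riemann H s t k) u \<omega>) \<longlonglongrightarrow> H u \<omega> * indicator {s<..t} u"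
proof -
  have "{u. 0 < u \<and> \<not> ((\<lambda>v. H v \<omega>) \<longlongrightarrow> H u \<omega>) (at_left u)} \<in> null_sets lborel"
    using cadlag_jumps_countable[OF assms(3)] countable_imp_null_set_lborel by blast
  then have "AE u in lborel. u \<notin> {u. 0 < u \<and> \<not> ((\<lambda>v. H v \<omega>) \<longlongrightarrow> H u \<omega>) (at_left u)}"
    by (rule AE_not_in)
  then show ?thesis
  proof eventually_elim
    case (elim u)
    show ?case
    proof (cases "s < u \<and> u \<le> t")
      case True
      then have "(\<lambda>k. elem_integrand (riemann H s t k) u \<omega>) \<longlonglongrightarrow> H u \<omega>"
        using assms elim by (intro riemann_integrand_tendsto) auto
      then show ?thesis using True by simp
    next
      case False
      then have "elem_integrand (riemann H s t k) u \<omega> = 0" for k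
        using assms(1) by (intro elem_integrand_riemann_outside)
      then show ?thesis using False by auto
    qed
  qed
qed

lemma elem_integrand_truncated_step:
  assumes "\<And>j. j < m \<Longrightarrow> 0 \<le> \<tau> j \<and> \<tau> j \<le> \<tau> (Suc j)"
  shows "elem_integrand (truncated_step m \<tau> h T) u \<omega> = step_process m \<tau> h u \<omega> * indicator {0..T} u"
proof -
  have "h j \<omega> * indicat_real {\<tau> j<..max (\<tau> j) (min T (\<tau> (Suc j)))} u =
      h j \<omega> * indicat_real {\<tau> j<..\<tau> (Suc j)} u * indicator {0..T} u" if "j < m" for j
    using assms[OF that] by (auto simp: indicator_def)
  then show ?thesis
    unfolding elem_integrand_def truncated_step_def step_process_def map_map comp_def prod.case
      interv_sum_list_conv_sum_set_nat set_upt atLeast0LessThan sum_distrib_right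
    by (intro sum.cong) auto
qed

lemma elem_integral_truncated_step:
  assumes "\<And>j. j < m \<Longrightarrow> 0 \<le> \<tau> j \<and> \<tau> j \<le> \<tau> (Suc j)"
  shows "elem_integral W (truncated_step m \<tau> h T) \<omega> = step_integral m \<tau> h W T \<omega>"
proof -
  have "W (max (\<tau> j) (min T (\<tau> (Suc j)))) \<omega> - W (\<tau> j) \<omega> = W (min T (\<tau> (Suc j))) \<omega> - W (min T (\<tau> j)) \<omega>"
    if "j < m" for j
    using assms[OF that] by (auto simp: max_def min_def)
  then show ?thesis
    by (simp add: elem_integral_def truncated_step_def step_integral_def sum_list_sum_nth atLeast0LessThan)
qed

text \<open>Completing the square moves the mean of the density to \<open>u\<close> times the
  variance.\<close>

lemma normal_mgf:
  assumes "0 < s"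
  shows "(\<integral>\<^sup>+x. ennreal (normal_density 0 s x) * ennreal (exp (u * x)) \<partial>lborel) = ennreal (exp (u\<^sup>2 * s\<^sup>2 / 2))"
proof -
  have "normal_density 0 s x * exp (u * x) = exp (u\<^sup>2 * s\<^sup>2 / 2) * normal_density (u * s\<^sup>2) s x" for x
  proof -
    have "- (x\<^sup>2 / (2 * s\<^sup>2)) + u * x = u\<^sup>2 * s\<^sup>2 / 2 - (x - u * s\<^sup>2)\<^sup>2 / (2 * s\<^sup>2)"
      using assms by (simp add: field_simps power2_eq_square)
    then have "exp (- (x\<^sup>2 / (2 * s\<^sup>2))) * exp (u * x) = exp (u\<^sup>2 * s\<^sup>2 / 2) * exp (- ((x - u * s\<^sup>2)\<^sup>2 / (2 * s\<^sup>2)))"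
      by (simp only: exp_add[symmetric]) simp
    then show ?thesis by (simp add: normal_density_def)
  qed
  then have "(\<integral>\<^sup>+x. ennreal (normal_density 0 s x) * ennreal (exp (u * x)) \<partial>lborel) =
      (\<integral>\<^sup>+x. ennreal (exp (u\<^sup>2 * s\<^sup>2 / 2)) * ennreal (normal_density (u * s\<^sup>2) s x) \<partial>lborel)"
    by (simp add: ennreal_mult''[symmetric])
  also have "\<dots> = ennreal (exp (u\<^sup>2 * s\<^sup>2 / 2)) * (\<integral>\<^sup>+x. ennreal (normal_density (u * s\<^sup>2) s x) \<partial>lborel)"
    by (rule nn_integral_cmult) auto
  also have "(\<integral>\<^sup>+x. ennreal (normal_density (u * s\<^sup>2) s x) \<partial>lborel) = 1"
    using assms by (simp add: nn_integral_eq_integral)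
  finally show ?thesis by simp
qed

section \<open>Brownian increments and the Ito isometry for elementary integrands\<close>

context filtered_prob_space
begin

lemma space_F: "0 \<le> t \<Longrightarrow> space (F t) = space M"
  using subalg[of t] by (auto simp: subalgebra_def)

lemma measurable_F: "X \<in> measurable (F t) N \<Longrightarrow> 0 \<le> t \<Longrightarrow> X \<in> measurable M N"
  using measurable_from_subalg[OF subalg] .

lemma measurable_F_mono: "X \<in> measurable (F s) N \<Longrightarrow> 0 \<le> s \<Longrightarrow> s \<le> t \<Longrightarrow> X \<in> measurable (F t) N"
  using filtration_mono[of s t] space_F[of s] space_F[of t] by (auto simp: measurable_def)

lemma brownian_adapted: "brownian W \<Longrightarrow> 0 \<le> t \<Longrightarrow> W t \<in> borel_measurable (F t)"
  by (auto simp: brownian_def adapted_def)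

text \<open>The transformation \<open>g\<close> is there to cover the increment, its square, and the
  increment embedded in a product space.\<close>

lemma brownian_indep:
  assumes W: "brownian W" and st: "0 \<le> s" "s < t" and X: "X \<in> measurable (F s) N"
    and g: "g \<in> measurable borel L"
  shows "indep_var N X L (\<lambda>\<omega>. g (W t \<omega> - W s \<omega>))"
proof (rule indep_gen_imp_indep_var)
  show ind: "indep_gen (sets (F s)) (cylinders {()} (\<lambda>_ \<omega>. W t \<omega> - W s \<omega>))"
    using W st by (auto simp: brownian_def)
  show "X \<in> measurable (sigma (space M) (sets (F s))) N"
    using X st space_F[of s] sets.sigma_sets_eq[of "F s"] indep_gen_Pow(1)[OF ind]
    by (simp add: measurable_def sets_measure_of space_measure_of_conv)
  show "(\<lambda>\<omega>. g (W t \<omega> - W s \<omega>)) \<in> measurable (sigma (space M) (cylinders {()} (\<lambda>_ \<omega>. W t \<omega> - W s \<omega>))) L"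
    using measurable_compose[OF _ g] measurable_cylinders[OF subset_refl cylinders_subset_Pow, of "()" "{()}" "\<lambda>_ \<omega>. W t \<omega> - W s \<omega>"] by simp
qed

lemma brownian_increment:
  assumes W: "brownian W" and st: "0 \<le> s" "s \<le> t"
  shows "random_variable borel (\<lambda>\<omega>. W t \<omega> - W s \<omega>)" "integrable M (\<lambda>\<omega>. (W t \<omega> - W s \<omega>)\<^sup>2)"
    "expectation (\<lambda>\<omega>. W t \<omega> - W s \<omega>) = 0" "expectation (\<lambda>\<omega>. (W t \<omega> - W s \<omega>)\<^sup>2) = t - s"
proof -
  show [measurable]: "random_variable borel (\<lambda>\<omega>. W t \<omega> - W s \<omega>)"
    using st by (intro borel_measurable_diff measurable_F[OF brownian_adapted[OF W]]) auto
  have "integrable M (\<lambda>\<omega>. (W t \<omega> - W s \<omega>)\<^sup>2) \<and> expectation (\<lambda>\<omega>. W t \<omega> - W s \<omega>) = 0 \<and>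
      expectation (\<lambda>\<omega>. (W t \<omega> - W s \<omega>)\<^sup>2) = t - s"
  proof (cases "s = t")
    case False
    then have D: "distributed M lborel (\<lambda>\<omega>. W t \<omega> - W s \<omega>) (normal_density 0 (sqrt (t - s)))"
      and pos: "0 < sqrt (t - s)"
      using W st by (auto simp: brownian_def)
    have 1: "integrable M (\<lambda>\<omega>. (W t \<omega> - W s \<omega>)\<^sup>2)"
      using distributed_integrable[OF D, of "\<lambda>x. x\<^sup>2"] integrable_normal_moment[OF pos, of 0 2] by simp
    have 2: "expectation (\<lambda>\<omega>. W t \<omega> - W s \<omega>) = 0"
      using normal_distributed_expectation[OF pos D] by simp
    show ?thesis
      using 1 2 normal_distributed_variance[OF pos D] pos by simp
  qed simp
  then show "integrable M (\<lambda>\<omega>. (W t \<omega> - W s \<omega>)\<^sup>2)"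
    "expectation (\<lambda>\<omega>. W t \<omega> - W s \<omega>) = 0" "expectation (\<lambda>\<omega>. (W t \<omega> - W s \<omega>)\<^sup>2) = t - s" by auto
qed

lemma brownian_increment_mult:
  assumes W: "brownian W" and st: "0 \<le> s" "s \<le> t"
    and X: "X \<in> borel_measurable (F s)" "integrable M X"
  shows "integrable M (\<lambda>\<omega>. X \<omega> * (W t \<omega> - W s \<omega>))" "expectation (\<lambda>\<omega>. X \<omega> * (W t \<omega> - W s \<omega>)) = 0"
    "integrable M (\<lambda>\<omega>. X \<omega> * (W t \<omega> - W s \<omega>)\<^sup>2)"
    "expectation (\<lambda>\<omega>. X \<omega> * (W t \<omega> - W s \<omega>)\<^sup>2) = expectation X * (t - s)"
proof -
  note inc = brownian_increment[OF W st]
  have i1: "integrable M (\<lambda>\<omega>. W t \<omega> - W s \<omega>)"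
    using inc(1,2) by (rule square_integrable_imp_integrable)
  have "integrable M (\<lambda>\<omega>. X \<omega> * (W t \<omega> - W s \<omega>)) \<and> expectation (\<lambda>\<omega>. X \<omega> * (W t \<omega> - W s \<omega>)) = 0 \<and>
    integrable M (\<lambda>\<omega>. X \<omega> * (W t \<omega> - W s \<omega>)\<^sup>2) \<and>
    expectation (\<lambda>\<omega>. X \<omega> * (W t \<omega> - W s \<omega>)\<^sup>2) = expectation X * (t - s)"
  proof (cases "s = t")
    case False
    then have iv: "indep_var borel X borel (\<lambda>\<omega>. W t \<omega> - W s \<omega>)"
      using brownian_indep[OF W _ _ X(1), of t "\<lambda>x. x" borel] st by simp
    have iv2: "indep_var borel X borel (\<lambda>\<omega>. (W t \<omega> - W s \<omega>)\<^sup>2)"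
      using brownian_indep[OF W _ _ X(1), of t "\<lambda>x. x\<^sup>2" borel] st False by simp
    show ?thesis
      using indep_var_integrable[OF iv X(2) i1] indep_var_lebesgue_integral[OF iv X(2) i1]
        indep_var_integrable[OF iv2 X(2) inc(2)] indep_var_lebesgue_integral[OF iv2 X(2) inc(2)] inc
      by simp
  qed simp
  then show "integrable M (\<lambda>\<omega>. X \<omega> * (W t \<omega> - W s \<omega>))" "expectation (\<lambda>\<omega>. X \<omega> * (W t \<omega> - W s \<omega>)) = 0"
    "integrable M (\<lambda>\<omega>. X \<omega> * (W t \<omega> - W s \<omega>)\<^sup>2)"
    "expectation (\<lambda>\<omega>. X \<omega> * (W t \<omega> - W s \<omega>)\<^sup>2) = expectation X * (t - s)" by auto
qed

definition elem_ok :: "'a elem \<Rightarrow> bool" where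
  "elem_ok L \<longleftrightarrow> (\<forall>(a, b, h)\<in>set L. 0 \<le> a \<and> a \<le> b \<and> h \<in> borel_measurable (F a) \<and>
    (\<exists>C. \<forall>\<omega>\<in>space M. \<bar>h \<omega>\<bar> \<le> C))"

text \<open>The product \<open>h * g\<close> is known at time \<open>c\<close>. If the first
  interval ends before \<open>c\<close>, the second increment is centred given the past. Otherwise
  the first interval is split at \<open>c\<close>; with \<open>m\<close> and \<open>n\<close> the
  smaller and larger right endpoint, the overlapping part is the square of \<open>W m - W c\<close>
  plus \<open>(W m - W c) * (W n - W m)\<close>, and only the square has non-zero mean.\<close>

lemma brownian_pair_ordered:
  assumes W: "brownian W" and ab: "0 \<le> a" "a \<le> b" "c \<le> d" and ac: "a \<le> c"
    and h: "h \<in> borel_measurable (F a)" "\<And>\<omega>. \<omega> \<in> space M \<Longrightarrow> \<bar>h \<omega>\<bar> \<le> B"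
    and g: "g \<in> borel_measurable (F c)" "\<And>\<omega>. \<omega> \<in> space M \<Longrightarrow> \<bar>g \<omega>\<bar> \<le> B'"
  shows "integrable M (\<lambda>\<omega>. (h \<omega> * (W b \<omega> - W a \<omega>)) * (g \<omega> * (W d \<omega> - W c \<omega>)))"
    "expectation (\<lambda>\<omega>. (h \<omega> * (W b \<omega> - W a \<omega>)) * (g \<omega> * (W d \<omega> - W c \<omega>))) =
      expectation (\<lambda>\<omega>. h \<omega> * g \<omega>) * max 0 (min b d - max a c)"
proof -
  have hg: "(\<lambda>\<omega>. h \<omega> * g \<omega>) \<in> borel_measurable (F c)"
    using measurable_F_mono[OF h(1)] g(1) ab ac by (intro borel_measurable_times) auto
  have bnd: "\<bar>h \<omega> * g \<omega>\<bar> \<le> B * B'" if "\<omega> \<in> space M" for \<omega>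
    using mult_mono[OF h(2)[OF that] g(2)[OF that]] h(2)[OF that] by (simp add: abs_mult)
  have c0: "0 \<le> c" using ab ac by simp
  have hgi: "integrable M (\<lambda>\<omega>. h \<omega> * g \<omega>)"
    by (rule bounded_integrable[where C="B * B'"]) (use measurable_F[OF hg c0] bnd in auto)
  have inc: "(\<lambda>\<omega>. W q \<omega> - W p \<omega>) \<in> borel_measurable (F r)" "integrable M (\<lambda>\<omega>. (h \<omega> * g \<omega>) * (W q \<omega> - W p \<omega>))"
    "(\<lambda>\<omega>. (h \<omega> * g \<omega>) * (W q \<omega> - W p \<omega>)) \<in> borel_measurable (F r)"
    if "0 \<le> p" "p \<le> q" "q \<le> r" "c \<le> r" for p q r
  proof -
    show 1: "(\<lambda>\<omega>. W q \<omega> - W p \<omega>) \<in> borel_measurable (F r)"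
      using that by (intro borel_measurable_diff measurable_F_mono[OF brownian_adapted[OF W]]) auto
    show "(\<lambda>\<omega>. (h \<omega> * g \<omega>) * (W q \<omega> - W p \<omega>)) \<in> borel_measurable (F r)"
      using that by (intro borel_measurable_times[OF measurable_F_mono[OF hg c0] 1]) auto
    show "integrable M (\<lambda>\<omega>. (h \<omega> * g \<omega>) * (W q \<omega> - W p \<omega>))"
      by (rule bounded_mult_integrable[OF measurable_F[OF hg c0] bnd square_integrable_imp_integrable[OF brownian_increment(1,2)[OF W]]])
        (use that in auto)
  qed
  let ?P = "\<lambda>\<omega>. (h \<omega> * (W b \<omega> - W a \<omega>)) * (g \<omega> * (W d \<omega> - W c \<omega>))"
  have "integrable M ?P \<and> expectation ?P = expectation (\<lambda>\<omega>. h \<omega> * g \<omega>) * max 0 (min b d - max a c)"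
  proof (cases "b \<le> c")
    case True
    have eq: "?P = (\<lambda>\<omega>. ((h \<omega> * g \<omega>) * (W b \<omega> - W a \<omega>)) * (W d \<omega> - W c \<omega>))"
      by (simp add: fun_eq_iff)
    note m = brownian_increment_mult[OF W c0 ab(3) inc(3)[of a b c] inc(2)[of a b c]]
    show ?thesis unfolding eq using m(1,2) ab ac True by simp
  next
    case False
    define m n where "m = min b d" and "n = max b d"
    have mn: "c \<le> m" "m \<le> n" "0 \<le> m" using False ab ac c0 by (auto simp: m_def n_def)
    have eq: "?P = (\<lambda>\<omega>. ((h \<omega> * g \<omega>) * (W c \<omega> - W a \<omega>)) * (W d \<omega> - W c \<omega>) +
        ((h \<omega> * g \<omega>) * (W m \<omega> - W c \<omega>)\<^sup>2 + ((h \<omega> * g \<omega>) * (W m \<omega> - W c \<omega>)) * (W n \<omega> - W m \<omega>)))"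
      by (auto simp: fun_eq_iff m_def n_def min_def max_def algebra_simps power2_eq_square)
    note 1 = brownian_increment_mult(1,2)[OF W c0 ab(3) inc(3)[of a c c] inc(2)[of a c c]]
    note 2 = brownian_increment_mult(3,4)[OF W c0 mn(1) hg hgi]
    note 3 = brownian_increment_mult(1,2)[OF W mn(3) mn(2) inc(3)[of c m m] inc(2)[of c m m]]
    show ?thesis unfolding eq using 1 2 3 ab ac c0 mn False by (simp add: m_def)
  qed
  then show "integrable M ?P" "expectation ?P = expectation (\<lambda>\<omega>. h \<omega> * g \<omega>) * max 0 (min b d - max a c)"
    by auto
qed

lemma brownian_pair:
  assumes W: "brownian W" and ab: "0 \<le> a" "0 \<le> c" "a \<le> b" "c \<le> d"
    and h: "h \<in> borel_measurable (F a)" "\<And>\<omega>. \<omega> \<in> space M \<Longrightarrow> \<bar>h \<omega>\<bar> \<le> B"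
    and g: "g \<in> borel_measurable (F c)" "\<And>\<omega>. \<omega> \<in> space M \<Longrightarrow> \<bar>g \<omega>\<bar> \<le> B'"
  shows "integrable M (\<lambda>\<omega>. (h \<omega> * (W b \<omega> - W a \<omega>)) * (g \<omega> * (W d \<omega> - W c \<omega>)))"
    "expectation (\<lambda>\<omega>. (h \<omega> * (W b \<omega> - W a \<omega>)) * (g \<omega> * (W d \<omega> - W c \<omega>))) =
      expectation (\<lambda>\<omega>. h \<omega> * g \<omega>) * max 0 (min b d - max a c)"
  using brownian_pair_ordered[OF W ab(1,3,4) _ h g] brownian_pair_ordered[OF W ab(2,4,3) _ g h]
  by (cases "a \<le> c"; simp add: mult.commute min.commute max.commute)+

lemma elem_okD:
  assumes "elem_ok L" "i < length L"
  shows "0 \<le> fst (L ! i)" "fst (L ! i) \<le> fst (snd (L ! i))"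
    "snd (snd (L ! i)) \<in> borel_measurable (F (fst (L ! i)))"
    "\<exists>C. \<forall>\<omega>\<in>space M. \<bar>snd (snd (L ! i)) \<omega>\<bar> \<le> C"
    "snd (snd (L ! i)) \<in> borel_measurable M"
proof -
  show 1: "0 \<le> fst (L ! i)" "fst (L ! i) \<le> fst (snd (L ! i))"
    "snd (snd (L ! i)) \<in> borel_measurable (F (fst (L ! i)))"
    "\<exists>C. \<forall>\<omega>\<in>space M. \<bar>snd (snd (L ! i)) \<omega>\<bar> \<le> C"
    using assms nth_mem[of i L] unfolding elem_ok_def by (auto simp: split_def)
  show "snd (snd (L ! i)) \<in> borel_measurable M" using measurable_F[OF 1(3,1)] .
qed

text \<open>Both sides are double sums over pairs of triples, weighted by the length
  \<open>v i j\<close> of the overlap of their intervals. Treating overlaps directly avoids a common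
  refinement when integrands with different partitions are subtracted.\<close>

lemma elem_isometry:
  assumes W: "brownian W" and L: "elem_ok L"
  shows "(\<integral>\<^sup>+\<omega>. ennreal ((elem_integral W L \<omega>)\<^sup>2) \<partial>M) =
    (\<integral>\<^sup>+\<omega>. (\<integral>\<^sup>+u. ennreal ((elem_integrand L u \<omega>)\<^sup>2) \<partial>lborel) \<partial>M)"
proof -
  define n where "n = length L"
  define a b h where "a i = fst (L ! i)" and "b i = fst (snd (L ! i))" and "h i = snd (snd (L ! i))" for i
  note ok = elem_okD[OF L, folded n_def a_def b_def h_def]
  define v where "v i j = max 0 (min (b i) (b j) - max (a i) (a j))" for i j
  have v0: "0 \<le> v i j" for i j by (simp add: v_def)
  have pair: "integrable M (\<lambda>\<omega>. (h i \<omega> * (W (b i) \<omega> - W (a i) \<omega>)) * (h j \<omega> * (W (b j) \<omega> - W (a j) \<omega>)))"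
    "expectation (\<lambda>\<omega>. (h i \<omega> * (W (b i) \<omega> - W (a i) \<omega>)) * (h j \<omega> * (W (b j) \<omega> - W (a j) \<omega>))) =
      expectation (\<lambda>\<omega>. h i \<omega> * h j \<omega>) * v i j" "integrable M (\<lambda>\<omega>. h i \<omega> * h j \<omega>)"
    if ii: "i < n" and jj: "j < n" for i j
  proof -
    note that = ii jj
    obtain B where B1: "\<And>\<omega>. \<omega> \<in> space M \<Longrightarrow> \<bar>h i \<omega>\<bar> \<le> B" using ok(4)[OF ii] by blast
    obtain B' where B2: "\<And>\<omega>. \<omega> \<in> space M \<Longrightarrow> \<bar>h j \<omega>\<bar> \<le> B'" using ok(4)[OF jj] by blast
    note B = B1 B2
    show "integrable M (\<lambda>\<omega>. (h i \<omega> * (W (b i) \<omega> - W (a i) \<omega>)) * (h j \<omega> * (W (b j) \<omega> - W (a j) \<omega>)))"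
      "expectation (\<lambda>\<omega>. (h i \<omega> * (W (b i) \<omega> - W (a i) \<omega>)) * (h j \<omega> * (W (b j) \<omega> - W (a j) \<omega>))) =
      expectation (\<lambda>\<omega>. h i \<omega> * h j \<omega>) * v i j"
      using brownian_pair[OF W ok(1)[OF that(1)] ok(1)[OF that(2)] ok(2)[OF that(1)] ok(2)[OF that(2)]
          ok(3)[OF that(1)] B(1) ok(3)[OF that(2)] B(2)] unfolding v_def by auto
    show "integrable M (\<lambda>\<omega>. h i \<omega> * h j \<omega>)"
      by (rule bounded_mult_integrable[OF ok(5)[OF that(1)] B(1) bounded_integrable[OF ok(5)[OF that(2)] B(2)]])
  qed
  \<comment> \<open>The pathwise time integral of the squared integrand, see \<open>Gi\<close>; this
    is where non-negativity of \<open>Q\<close> comes from.\<close>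
  define Q where "Q \<omega> = (\<Sum>i<n. \<Sum>j<n. h i \<omega> * h j \<omega> * v i j)" for \<omega>
  have Q: "integrable M Q" "expectation Q = (\<Sum>i<n. \<Sum>j<n. expectation (\<lambda>\<omega>. h i \<omega> * h j \<omega>) * v i j)"
  proof -
    have "has_bochner_integral M Q (\<Sum>i<n. \<Sum>j<n. expectation (\<lambda>\<omega>. h i \<omega> * h j \<omega>) * v i j)"
      unfolding Q_def using pair(3)
      by (intro has_bochner_integral_sum has_bochner_integral_mult_left has_bochner_integral_integrable) auto
    then show "integrable M Q" "expectation Q = (\<Sum>i<n. \<Sum>j<n. expectation (\<lambda>\<omega>. h i \<omega> * h j \<omega>) * v i j)"
      by (auto simp: has_bochner_integral_iff)
  qed
  have S: "elem_integral W L \<omega> ^ 2 = (\<Sum>i<n. \<Sum>j<n. (h i \<omega> * (W (b i) \<omega> - W (a i) \<omega>)) * (h j \<omega> * (W (b j) \<omega> - W (a j) \<omega>)))" for \<omega>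
    unfolding elem_nth power2_eq_square sum_product n_def a_def b_def h_def ..
  have Si: "integrable M (\<lambda>\<omega>. elem_integral W L \<omega> ^ 2)" "expectation (\<lambda>\<omega>. elem_integral W L \<omega> ^ 2) = expectation Q"
  proof -
    have "has_bochner_integral M (\<lambda>\<omega>. elem_integral W L \<omega> ^ 2) (\<Sum>i<n. \<Sum>j<n. expectation (\<lambda>\<omega>. h i \<omega> * h j \<omega>) * v i j)"
      unfolding S using pair(1,2)
      by (intro has_bochner_integral_sum) (auto simp: has_bochner_integral_iff)
    then show "integrable M (\<lambda>\<omega>. elem_integral W L \<omega> ^ 2)" "expectation (\<lambda>\<omega>. elem_integral W L \<omega> ^ 2) = expectation Q"
      by (auto simp: has_bochner_integral_iff Q(2))
  qed
  have ov: "has_bochner_integral lborel (\<lambda>u. indicat_real {a i<..b i} u * indicator {a j<..b j} u) (v i j)" for i j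
  proof -
    have "has_bochner_integral lborel (indicat_real {max (a i) (a j)<..min (b i) (b j)}) (v i j)"
      by (cases "max (a i) (a j) \<le> min (b i) (b j)")
        (auto simp: has_bochner_integral_iff v_def measure_def emeasure_lborel_Ioc max_def)
    moreover have "indicat_real {a i<..b i} u * indicator {a j<..b j} u = indicat_real {max (a i) (a j)<..min (b i) (b j)} u" for u
      by (auto simp: indicator_def)
    ultimately show ?thesis by simp
  qed
  have G: "elem_integrand L u \<omega> ^ 2 = (\<Sum>i<n. \<Sum>j<n. h i \<omega> * h j \<omega> * (indicat_real {a i<..b i} u * indicator {a j<..b j} u))" for u \<omega>
    unfolding elem_nth power2_eq_square sum_product n_def a_def b_def h_def by (simp add: mult_ac)
  have Gi: "has_bochner_integral lborel (\<lambda>u. elem_integrand L u \<omega> ^ 2) (Q \<omega>)" for \<omega>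
    unfolding G Q_def by (intro has_bochner_integral_sum has_bochner_integral_mult_right ov)
  have inner: "(\<integral>\<^sup>+u. ennreal ((elem_integrand L u \<omega>)\<^sup>2) \<partial>lborel) = ennreal (Q \<omega>)" for \<omega>
    using Gi[of \<omega>] by (subst nn_integral_eq_integral) (auto simp: has_bochner_integral_iff)
  have Q0: "0 \<le> Q \<omega>" for \<omega>
    using Gi[of \<omega>] Bochner_Integration.integral_nonneg[of lborel "\<lambda>u. elem_integrand L u \<omega> ^ 2"] by (auto simp: has_bochner_integral_iff)
  show ?thesis unfolding inner
    using Si Q Q0 by (simp add: nn_integral_eq_integral)
qed

lemma elem_ok_append: "elem_ok (L @ L') \<longleftrightarrow> elem_ok L \<and> elem_ok L'"
  by (simp add: elem_ok_def ball_Un)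

lemma elem_ok_neg: "elem_ok L \<Longrightarrow> elem_ok (elem_neg L)"
  by (fastforce simp: elem_ok_def elem_neg_def)

lemma elem_ok_riemann:
  assumes H: "bounded_cadlag H" and "0 \<le> s" "s < t"
  shows "elem_ok (riemann H s t k)"
proof -
  have "0 \<le> grid s t k j" "grid s t k j \<le> grid s t k (Suc j)" for j
    using grid_mono[of s t 0 j k] grid_mono[of s t j "Suc j" k] assms by (auto simp: grid_simps)
  then show ?thesis
    using H by (fastforce simp: elem_ok_def riemann_def bounded_cadlag_def adapted_def)
qed

lemma simple_integrand_times:
  assumes "simple_integrand m \<tau> h" "j < m"
  shows "0 \<le> \<tau> j \<and> \<tau> j \<le> \<tau> (Suc j)"
proof -
  have "0 \<le> \<tau> j" using assms(2)
  proof (induction j)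
    case (Suc j)
    then show ?case using assms(1) order_trans[of 0 "\<tau> j" "\<tau> (Suc j)"] unfolding simple_integrand_def by simp
  qed (use assms in \<open>simp add: simple_integrand_def\<close>)
  then show ?thesis using assms by (simp add: simple_integrand_def)
qed

lemma elem_ok_truncated_step:
  assumes "simple_integrand m \<tau> h"
  shows "elem_ok (truncated_step m \<tau> h T)"
  using assms simple_integrand_times[OF assms]
  by (auto simp: elem_ok_def truncated_step_def simple_integrand_def)

text \<open>Right-continuity: the process is the limit of its values at the next point of a grid of
  width \<open>1 / Suc k\<close>. The indicator restricts to non-negative times, the only ones at
  which anything is assumed.\<close>

lemma bounded_cadlag_measurable:
  assumes H: "bounded_cadlag H"
  shows "(\<lambda>p. H (snd p) (fst p) * indicator {0..} (snd p)) \<in> borel_measurable (M \<Otimes>\<^sub>M borel)"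
proof (rule borel_measurable_LIMSEQ_real)
  \<comment> \<open>Adding 1 to the floor keeps the grid point strictly to the right of
    \<open>u\<close>, also when \<open>u\<close> itself lies on the grid; convergence along
    \<open>at_right\<close> requires this.\<close>
  let ?g = "\<lambda>k u. max 0 (of_int (\<lfloor>u * real (Suc k)\<rfloor> + 1) / real (Suc k))"
  fix k
  have "(\<lambda>p. H (?g k (snd p)) (fst p)) \<in> borel_measurable (M \<Otimes>\<^sub>M borel)"
  proof (rule measurable_compose_countable[where f="\<lambda>i p. H (max 0 (of_int i / real (Suc k))) (fst p)" and g="\<lambda>p. \<lfloor>snd p * real (Suc k)\<rfloor> + 1"])
    show "(\<lambda>p. \<lfloor>snd p * real (Suc k)\<rfloor> + 1) \<in> M \<Otimes>\<^sub>M borel \<rightarrow>\<^sub>M count_space UNIV" by measurable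
    fix i :: int
    have "H (max 0 (of_int i / real (Suc k))) \<in> borel_measurable M"
      using H measurable_F[of "H (max 0 (of_int i / real (Suc k)))" "max 0 (of_int i / real (Suc k))"]
      by (auto simp: bounded_cadlag_def adapted_def)
    then show "(\<lambda>p. H (max 0 (of_int i / real (Suc k))) (fst p)) \<in> borel_measurable (M \<Otimes>\<^sub>M borel)"
      by measurable
  qed
  then show "(\<lambda>p. H (?g k (snd p)) (fst p) * indicator {0..} (snd p)) \<in> borel_measurable (M \<Otimes>\<^sub>M borel)"
    by measurable
next
  fix p assume p: "p \<in> space (M \<Otimes>\<^sub>M (borel :: real measure))"
  obtain \<omega> u where pu: "p = (\<omega>, u)" by force
  let ?g = "\<lambda>k. max 0 (of_int (\<lfloor>u * real (Suc k)\<rfloor> + 1) / real (Suc k))"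
  show "(\<lambda>k. H (max 0 (of_int (\<lfloor>snd p * real (Suc k)\<rfloor> + 1) / real (Suc k))) (fst p) * indicator {0..} (snd p))
      \<longlonglongrightarrow> H (snd p) (fst p) * indicator {0..} (snd p)"
  proof (cases "0 \<le> u")
    case True
    have g: "u < ?g k" "?g k \<le> u + 1 / real (Suc k)" for k
    proof -
      let ?m = "of_int (\<lfloor>u * real (Suc k)\<rfloor> + 1) :: real"
      have m: "u * real (Suc k) < ?m" "?m \<le> u * real (Suc k) + 1" by linarith+
      have "u < ?m / real (Suc k)" using m(1) by (simp add: pos_less_divide_eq)
      moreover have "?m / real (Suc k) \<le> (u * real (Suc k) + 1) / real (Suc k)"
        using m(2) by (intro divide_right_mono) auto
      moreover have "(u * real (Suc k) + 1) / real (Suc k) = u + 1 / real (Suc k)"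
        by (simp add: add_divide_distrib del: of_nat_Suc)
      ultimately show "u < ?g k" "?g k \<le> u + 1 / real (Suc k)" using True by auto
    qed
    have "(\<lambda>k. u + 1 / real (Suc k)) \<longlonglongrightarrow> u + 0"
      by (intro tendsto_add tendsto_const lim_1_over_n[THEN LIMSEQ_Suc])
    then have "?g \<longlonglongrightarrow> u"
    proof (intro tendsto_sandwich[of "\<lambda>_. u" ?g sequentially "\<lambda>k. u + 1 / real (Suc k)"])
      show "eventually (\<lambda>k. u \<le> ?g k) sequentially" "eventually (\<lambda>k. ?g k \<le> u + 1 / real (Suc k)) sequentially"
        by (intro always_eventually allI less_imp_le[OF g(1)] g(2))+
    qed simp_all
    moreover have "eventually (\<lambda>k. ?g k \<in> {u<..} \<and> ?g k \<noteq> u) sequentially"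
      by (intro always_eventually allI conjI) (use g(1) in \<open>metis greaterThan_iff less_irrefl\<close>)+
    ultimately have lim: "filterlim ?g (at_right u) sequentially"
      unfolding filterlim_at by blast
    have "\<omega> \<in> space M" using p pu by (simp add: space_pair_measure)
    then have "((\<lambda>t. H t \<omega>) \<longlongrightarrow> H u \<omega>) (at_right u)"
      using H True by (auto simp: bounded_cadlag_def cadlag_def continuous_within)
    from filterlim_compose[OF this lim] show ?thesis using True pu by simp
  qed (simp add: pu)
qed

end

section \<open>Ito integrals as limits of Riemann sums\<close>

lemma nn_integral_diff3_square_le:
  fixes f g h :: "'b \<Rightarrow> real"
  assumes [measurable]: "f \<in> borel_measurable N" "g \<in> borel_measurable N" "h \<in> borel_measurable N"
  shows "(\<integral>\<^sup>+x. ennreal ((f x - g x - h x)\<^sup>2) \<partial>N) \<le>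
    3 * ((\<integral>\<^sup>+x. ennreal ((f x)\<^sup>2) \<partial>N) + (\<integral>\<^sup>+x. ennreal ((g x)\<^sup>2) \<partial>N) + (\<integral>\<^sup>+x. ennreal ((h x)\<^sup>2) \<partial>N))"
proof -
  have "(x - y - z)\<^sup>2 \<le> 3 * (x\<^sup>2 + y\<^sup>2 + z\<^sup>2)" for x y z :: real
  proof -
    have "0 \<le> (x + y)\<^sup>2 + (x + z)\<^sup>2 + (y - z)\<^sup>2" by simp
    then show ?thesis by (simp add: power2_eq_square algebra_simps)
  qed
  then have "(\<integral>\<^sup>+x. ennreal ((f x - g x - h x)\<^sup>2) \<partial>N) \<le> (\<integral>\<^sup>+x. 3 * (ennreal ((f x)\<^sup>2) + ennreal ((g x)\<^sup>2) + ennreal ((h x)\<^sup>2)) \<partial>N)"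
    by (intro nn_integral_mono) (simp add: ennreal_plus[symmetric] ennreal_mult''[symmetric] ennreal_numeral[symmetric] ennreal_leI del: ennreal_plus ennreal_numeral)
  also have "\<dots> = 3 * ((\<integral>\<^sup>+x. ennreal ((f x)\<^sup>2) \<partial>N) + (\<integral>\<^sup>+x. ennreal ((g x)\<^sup>2) \<partial>N) + (\<integral>\<^sup>+x. ennreal ((h x)\<^sup>2) \<partial>N))"
    by (simp add: nn_integral_cmult nn_integral_add)
  finally show ?thesis .
qed

context filtered_prob_space
begin

lemma ito_integral_measurable: "ito_integral W H I \<Longrightarrow> 0 \<le> t \<Longrightarrow> random_variable borel (I t)"
  using measurable_F[of "I t" t] by (simp add: ito_integral_def adapted_def)

lemma elem_integrand_measurable:
  assumes "elem_ok L"
  shows "(\<lambda>p. elem_integrand L (snd p) (fst p)) \<in> borel_measurable (M \<Otimes>\<^sub>M borel)"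
  unfolding elem_nth
proof (rule borel_measurable_sum)
  fix i assume "i \<in> {..<length L}"
  then have [measurable]: "snd (snd (L ! i)) \<in> borel_measurable M"
    using elem_okD(5)[OF assms] by simp
  show "(\<lambda>p. snd (snd (L ! i)) (fst p) * indicator {fst (L ! i)<..fst (snd (L ! i))} (snd p)) \<in> borel_measurable (M \<Otimes>\<^sub>M borel)"
    by measurable
qed

lemma elem_integral_measurable:
  assumes W: "brownian W" and L: "elem_ok L"
  shows "random_variable borel (elem_integral W L)"
proof -
  have "random_variable borel (\<lambda>\<omega>. \<Sum>i<length L. snd (snd (L ! i)) \<omega> * (W (fst (snd (L ! i))) \<omega> - W (fst (L ! i)) \<omega>))"
  proof (intro borel_measurable_sum borel_measurable_times borel_measurable_diff)
    fix i assume "i \<in> {..<length L}"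
    then have i: "i < length L" by simp
    note ok = elem_okD[OF L i]
    show "random_variable borel (snd (snd (L ! i)))" by (rule ok(5))
    show "random_variable borel (W (fst (snd (L ! i))))" "random_variable borel (W (fst (L ! i)))"
      using ok(1,2) by (auto intro!: measurable_F[OF brownian_adapted[OF W]])
  qed
  then show ?thesis by (simp add: elem_nth[abs_def])
qed

text \<open>Dominated convergence twice, in time for each path and then over the probability space,
  with \<open>2 * C\<close> on the interval as bound.\<close>

lemma riemann_integrand_L2:
  assumes H: "bounded_cadlag H" and st: "0 \<le> s" "s < t"
  shows "(\<lambda>k. \<integral>\<^sup>+\<omega>. (\<integral>\<^sup>+u. ennreal ((elem_integrand (riemann H s t k) u \<omega> - H u \<omega> * indicator {s<..t} u)\<^sup>2) \<partial>lborel) \<partial>M)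
    \<longlonglongrightarrow> 0"
proof -
  obtain C0 where "\<And>\<omega> u. \<omega> \<in> space M \<Longrightarrow> 0 \<le> u \<Longrightarrow> \<bar>H u \<omega>\<bar> \<le> C0"
    using H by (auto simp: bounded_cadlag_def)
  then obtain C where C: "0 \<le> C" "\<And>\<omega> u. \<omega> \<in> space M \<Longrightarrow> 0 \<le> u \<Longrightarrow> \<bar>H u \<omega>\<bar> \<le> C"
    by (metis abs_ge_zero order_trans abs_ge_self)
  have cad: "\<omega> \<in> space M \<Longrightarrow> cadlag (\<lambda>u. H u \<omega>)" for \<omega> using H by (auto simp: bounded_cadlag_def)
  have Hm: "(\<lambda>p. H (snd p) (fst p) * indicator {s<..t} (snd p)) \<in> borel_measurable (M \<Otimes>\<^sub>M borel)"
  proof -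
    note [measurable] = bounded_cadlag_measurable[OF H]
    have "(\<lambda>p. H (snd p) (fst p) * indicator {0..} (snd p) * indicator {s<..t} (snd p)) \<in> borel_measurable (M \<Otimes>\<^sub>M borel)"
      by measurable
    moreover have "H u \<omega> * indicator {0..} u * indicator {s<..t} u = H u \<omega> * indicator {s<..t} u" for u \<omega>
      using st by (auto simp: indicator_def)
    ultimately show ?thesis by simp
  qed
  let ?d = "\<lambda>k u \<omega>. elem_integrand (riemann H s t k) u \<omega> - H u \<omega> * indicator {s<..t} u"
  have dm: "(\<lambda>p. ?d k (snd p) (fst p)) \<in> borel_measurable (M \<Otimes>\<^sub>M borel)" for k
    using Hm elem_integrand_measurable[OF elem_ok_riemann[OF H st]] by (intro borel_measurable_diff)
  have dm': "(\<lambda>p. ennreal ((?d k (snd p) (fst p))\<^sup>2)) \<in> borel_measurable (M \<Otimes>\<^sub>M lborel)" for k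
    using dm by (simp add: measurable_cong_sets[OF sets_pair_measure_cong[OF refl sets_lborel] refl])
  have bound: "ennreal ((?d k u \<omega>)\<^sup>2) \<le> ennreal ((2 * C)\<^sup>2) * indicator {s<..t} u" if "\<omega> \<in> space M" for k u \<omega>
  proof -
    have "\<bar>elem_integrand (riemann H s t k) u \<omega>\<bar> \<le> C * indicator {s<..t} u"
      by (rule riemann_integrand_bound) (use st C that in auto)
    moreover have "\<bar>H u \<omega> * indicator {s<..t} u\<bar> \<le> C * indicator {s<..t} u"
      using C that st by (auto simp: indicator_def)
    ultimately have "\<bar>?d k u \<omega>\<bar> \<le> 2 * C * indicator {s<..t} u" by linarith
    then have "(?d k u \<omega>)\<^sup>2 \<le> (2 * C * indicator {s<..t} u)\<^sup>2" by (rule abs_le_square_iff[THEN iffD1, OF order_trans]) simp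
    then show ?thesis by (auto simp: indicator_def ennreal_leI split: if_splits)
  qed
  have um: "(\<lambda>u. ennreal ((?d k u \<omega>)\<^sup>2)) \<in> borel_measurable lborel" if "\<omega> \<in> space M" for k \<omega>
    using measurable_compose[OF measurable_Pair1'[OF that] dm'[of k]] by simp
  have fin: "(\<integral>\<^sup>+u. ennreal ((2 * C)\<^sup>2) * indicator {s<..t} u \<partial>lborel) = ennreal ((2 * C)\<^sup>2 * (t - s))"
    using st C by (simp add: nn_integral_cmult ennreal_mult'')
  have inner: "(\<lambda>k. \<integral>\<^sup>+u. ennreal ((?d k u \<omega>)\<^sup>2) \<partial>lborel) \<longlonglongrightarrow> 0" if "\<omega> \<in> space M" for \<omega>
  proof -
    have "(\<lambda>k. \<integral>\<^sup>+u. ennreal ((?d k u \<omega>)\<^sup>2) \<partial>lborel) \<longlonglongrightarrow> (\<integral>\<^sup>+u. 0 \<partial>(lborel :: real measure))"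
    proof (rule nn_integral_dominated_convergence[where w="\<lambda>u. ennreal ((2 * C)\<^sup>2) * indicator {s<..t} u"])
      show "AE u in lborel. (\<lambda>k. ennreal ((?d k u \<omega>)\<^sup>2)) \<longlonglongrightarrow> 0"
        using AE_riemann_integrand_tendsto[where H=H and \<omega>=\<omega>, OF st(2,1) cad[OF that]]
      proof eventually_elim
        case (elim u)
        have "(\<lambda>k. (?d k u \<omega>)\<^sup>2) \<longlonglongrightarrow> (H u \<omega> * indicator {s<..t} u - H u \<omega> * indicator {s<..t} u)\<^sup>2"
          by (intro tendsto_intros elim)
        then show ?case using tendsto_ennrealI by fastforce
      qed
      show "AE u in lborel. ennreal ((?d k u \<omega>)\<^sup>2) \<le> ennreal ((2 * C)\<^sup>2) * indicator {s<..t} u" for k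
        using bound[OF that] by simp
    qed (use um[OF that] fin in \<open>auto\<close>)
    then show ?thesis by simp
  qed
  have "(\<lambda>k. \<integral>\<^sup>+\<omega>. (\<integral>\<^sup>+u. ennreal ((?d k u \<omega>)\<^sup>2) \<partial>lborel) \<partial>M) \<longlonglongrightarrow> (\<integral>\<^sup>+\<omega>. 0 \<partial>M)"
  proof (rule nn_integral_dominated_convergence[where w="\<lambda>_. ennreal ((2 * C)\<^sup>2 * (t - s))"])
    show "(\<lambda>\<omega>. \<integral>\<^sup>+u. ennreal ((?d k u \<omega>)\<^sup>2) \<partial>lborel) \<in> borel_measurable M" for k
      using lborel.borel_measurable_nn_integral_fst[OF dm'[of k]] by simp
    show "AE \<omega> in M. (\<integral>\<^sup>+u. ennreal ((?d k u \<omega>)\<^sup>2) \<partial>lborel) \<le> ennreal ((2 * C)\<^sup>2 * (t - s))" for k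
      unfolding fin[symmetric] using bound by (intro AE_I2 nn_integral_mono) auto
    show "AE \<omega> in M. (\<lambda>k. \<integral>\<^sup>+u. ennreal ((?d k u \<omega>)\<^sup>2) \<partial>lborel) \<longlonglongrightarrow> 0"
      using inner by (intro AE_I2) auto
  qed (auto simp: emeasure_space_1)
  then show ?thesis by simp
qed

text \<open>The approximating integrands for the horizons \<open>t\<close> and \<open>s\<close> come
  without any relation to each other or to Riemann sums. Still, all of them approximate the same
  process, so the integrand \<open>L - L' - riemann\<close> vanishes in the limit, and the isometry
  transfers this to the integrals.\<close>

lemma ito_riemann_L2:
  assumes W: "brownian W" and H: "bounded_cadlag H" and I: "ito_integral W H I" and st: "0 \<le> s" "s < t"
  shows "(\<lambda>k. \<integral>\<^sup>+\<omega>. ennreal ((I t \<omega> - I s \<omega> - elem_integral W (riemann H s t k) \<omega>)\<^sup>2) \<partial>M) \<longlonglongrightarrow> 0"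
proof -
  let ?d = "\<lambda>E A \<omega>. \<integral>\<^sup>+u. ennreal ((elem_integrand E u \<omega> - H u \<omega> * indicator A u)\<^sup>2) \<partial>lborel"
  have Iad: "random_variable borel (I T)" if "0 \<le> T" for T
    using ito_integral_measurable[OF I that] .
  define stp where "stp T m \<tau> h \<longleftrightarrow> (\<forall>k::nat. simple_integrand (m k) (\<tau> k) (h k)) \<and>
      (\<lambda>k. \<integral>\<^sup>+\<omega>. (\<integral>\<^sup>+s. ennreal ((step_process (m k) (\<tau> k) (h k) s \<omega> - H s \<omega>)\<^sup>2) *
            indicator {0..T} s \<partial>lborel) \<partial>M) \<longlonglongrightarrow> 0 \<and>
      (\<lambda>k. \<integral>\<^sup>+\<omega>. ennreal ((step_integral (m k) (\<tau> k) (h k) W T \<omega> - I T \<omega>)\<^sup>2) \<partial>M) \<longlonglongrightarrow> 0" for T m \<tau> h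
  have "\<exists>m \<tau> h. stp T m \<tau> h" if "0 \<le> T" for T
    using I that unfolding ito_integral_def stp_def by blast
  then have "\<exists>L. (\<forall>k. elem_ok (L k)) \<and>
      (\<lambda>k. \<integral>\<^sup>+\<omega>. ?d (L k) {0..T} \<omega> \<partial>M) \<longlonglongrightarrow> 0 \<and>
      (\<lambda>k. \<integral>\<^sup>+\<omega>. ennreal ((elem_integral W (L k) \<omega> - I T \<omega>)\<^sup>2) \<partial>M) \<longlonglongrightarrow> 0" if T: "0 \<le> T" for T
  proof -
    obtain m \<tau> h where S: "stp T m \<tau> h" using \<open>\<And>T. 0 \<le> T \<Longrightarrow> \<exists>m \<tau> h. stp T m \<tau> h\<close> T by blast
    then have si: "simple_integrand (m k) (\<tau> k) (h k)" for k by (simp add: stp_def)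
    note times = simple_integrand_times[OF si]
    define L where "L k = truncated_step (m k) (\<tau> k) (h k) T" for k
    have 1: "elem_integrand (L k) u \<omega> = step_process (m k) (\<tau> k) (h k) u \<omega> * indicator {0..T} u" for k u \<omega>
      unfolding L_def by (rule elem_integrand_truncated_step) (rule times)
    have 2: "elem_integral W (L k) \<omega> = step_integral (m k) (\<tau> k) (h k) W T \<omega>" for k \<omega>
      unfolding L_def by (rule elem_integral_truncated_step) (rule times)
    have 3: "ennreal ((elem_integrand (L k) u \<omega> - H u \<omega> * indicator {0..T} u)\<^sup>2) =
        ennreal ((step_process (m k) (\<tau> k) (h k) u \<omega> - H u \<omega>)\<^sup>2) * indicator {0..T} u" for k u \<omega>
      unfolding 1 by (simp add: indicator_def)
    have "elem_ok (L k)" for k unfolding L_def by (rule elem_ok_truncated_step[OF si])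
    then show ?thesis
      using S unfolding stp_def by (intro exI[of _ L]) (simp add: 2 3)
  qed
  note approx = this
  have s0: "0 \<le> s" "0 \<le> t" using st by auto
  obtain L where L: "\<And>k. elem_ok (L k)"
    "(\<lambda>k. \<integral>\<^sup>+\<omega>. ?d (L k) {0..t} \<omega> \<partial>M) \<longlonglongrightarrow> 0"
    "(\<lambda>k. \<integral>\<^sup>+\<omega>. ennreal ((elem_integral W (L k) \<omega> - I t \<omega>)\<^sup>2) \<partial>M) \<longlonglongrightarrow> 0"
    using approx[OF s0(2)] by blast
  obtain L' where L': "\<And>k. elem_ok (L' k)"
    "(\<lambda>k. \<integral>\<^sup>+\<omega>. ?d (L' k) {0..s} \<omega> \<partial>M) \<longlonglongrightarrow> 0"
    "(\<lambda>k. \<integral>\<^sup>+\<omega>. ennreal ((elem_integral W (L' k) \<omega> - I s \<omega>)\<^sup>2) \<partial>M) \<longlonglongrightarrow> 0"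
    using approx[OF s0(1)] by blast
  let ?R = "riemann H s t"
  note okR = elem_ok_riemann[OF H st]
  \<comment> \<open>Concatenation with negated lists represents the difference as a single
    elementary integrand. Splitting \<open>{0..t}\<close> into \<open>{0..s}\<close> and
    \<open>{s<..t}\<close> makes the three copies of \<open>H\<close> cancel in
    \<open>Dg\<close>.\<close>
  define D where "D k = L k @ elem_neg (L' k) @ elem_neg (?R k)" for k
  have okD: "elem_ok (D k)" for k
    unfolding D_def elem_ok_append using L(1) L'(1) okR elem_ok_neg by auto
  have Dint: "elem_integral W (D k) \<omega> = elem_integral W (L k) \<omega> - elem_integral W (L' k) \<omega> - elem_integral W (?R k) \<omega>" for k \<omega>
    by (simp add: D_def elem_append elem_neg_eq)
  have Dg: "elem_integrand (D k) u \<omega> = (elem_integrand (L k) u \<omega> - H u \<omega> * indicator {0..t} u) -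
      (elem_integrand (L' k) u \<omega> - H u \<omega> * indicator {0..s} u) -
      (elem_integrand (?R k) u \<omega> - H u \<omega> * indicator {s<..t} u)" for k u \<omega>
  proof -
    have "indicat_real {0..t} u = indicator {0..s} u + indicator {s<..t} u"
      using st by (auto simp: indicator_def)
    then show ?thesis by (simp add: D_def elem_append elem_neg_eq algebra_simps)
  qed
  have Hm: "(\<lambda>p. H (snd p) (fst p) * indicator {0..} (snd p)) \<in> borel_measurable (M \<Otimes>\<^sub>M borel)"
    by (rule bounded_cadlag_measurable[OF H])
  have HA: "(\<lambda>p. H (snd p) (fst p) * indicator A (snd p)) \<in> borel_measurable (M \<Otimes>\<^sub>M borel)"
    if "A \<subseteq> {0..}" "A \<in> sets borel" for A
  proof -
    note [measurable] = Hm that(2)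
    have "(\<lambda>p. H (snd p) (fst p) * indicator {0..} (snd p) * indicator A (snd p)) \<in> borel_measurable (M \<Otimes>\<^sub>M borel)"
      by measurable
    moreover have "H u \<omega> * indicator {0..} u * indicator A u = H u \<omega> * indicator A u" for u \<omega>
      using that(1) by (auto simp: indicator_def)
    ultimately show ?thesis by simp
  qed
  have joint: "(\<lambda>p. elem_integrand E (snd p) (fst p) - H (snd p) (fst p) * indicator A (snd p)) \<in> borel_measurable (M \<Otimes>\<^sub>M lborel)"
    if "elem_ok E" "A \<subseteq> {0..}" "A \<in> sets borel" for E A
    using borel_measurable_diff[OF elem_integrand_measurable[OF that(1)] HA[OF that(2,3)]]
    by (simp add: measurable_cong_sets[OF sets_pair_measure_cong[OF refl sets_lborel] refl])
  have sect: "(\<lambda>u. elem_integrand E u \<omega> - H u \<omega> * indicator A u) \<in> borel_measurable lborel"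
    if "elem_ok E" "A \<subseteq> {0..}" "A \<in> sets borel" "\<omega> \<in> space M" for E A \<omega>
    using measurable_compose[OF measurable_Pair1'[OF that(4)] joint[OF that(1-3)]] by simp
  have outer: "(\<lambda>\<omega>. ?d E A \<omega>) \<in> borel_measurable M"
    if "elem_ok E" "A \<subseteq> {0..}" "A \<in> sets borel" for E A
  proof -
    have "(\<lambda>p. ennreal ((elem_integrand E (snd p) (fst p) - H (snd p) (fst p) * indicator A (snd p))\<^sup>2)) \<in> borel_measurable (M \<Otimes>\<^sub>M lborel)"
      using joint[OF that] by measurable
    from lborel.borel_measurable_nn_integral_fst[OF this] show ?thesis by simp
  qed
  define e1 e2 e3 where
    "e1 k = (\<integral>\<^sup>+\<omega>. ?d (L k) {0..t} \<omega> \<partial>M)" and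
    "e2 k = (\<integral>\<^sup>+\<omega>. ?d (L' k) {0..s} \<omega> \<partial>M)" and
    "e3 k = (\<integral>\<^sup>+\<omega>. ?d (?R k) {s<..t} \<omega> \<partial>M)" for k
  have sub: "{0..t} \<subseteq> {0..}" "{0..s} \<subseteq> {0..}" "{s<..t} \<subseteq> {0..}" using st by auto
  have D2: "(\<integral>\<^sup>+\<omega>. ennreal ((elem_integral W (D k) \<omega>)\<^sup>2) \<partial>M) \<le> 3 * (e1 k + e2 k + e3 k)" for k
  proof -
    have "(\<integral>\<^sup>+\<omega>. ennreal ((elem_integral W (D k) \<omega>)\<^sup>2) \<partial>M) = (\<integral>\<^sup>+\<omega>. (\<integral>\<^sup>+u. ennreal ((elem_integrand (D k) u \<omega>)\<^sup>2) \<partial>lborel) \<partial>M)"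
      by (rule elem_isometry[OF W okD])
    also have "\<dots> \<le> (\<integral>\<^sup>+\<omega>. 3 * (?d (L k) {0..t} \<omega>
      + ?d (L' k) {0..s} \<omega>
      + ?d (?R k) {s<..t} \<omega>) \<partial>M)"
      unfolding Dg
      by (intro nn_integral_mono nn_integral_diff3_square_le sect L(1) L'(1) okR sub) auto
    also have "\<dots> = 3 * (e1 k + e2 k + e3 k)"
      unfolding e1_def e2_def e3_def using outer[OF L(1) sub(1), of k] outer[OF L'(1) sub(2), of k] outer[OF okR sub(3), of k]
      by (simp add: nn_integral_cmult nn_integral_add)
    finally show ?thesis .
  qed
  let ?e = "\<lambda>k. 3 * ((\<integral>\<^sup>+\<omega>. ennreal ((elem_integral W (L' k) \<omega> - I s \<omega>)\<^sup>2) \<partial>M) +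
      (\<integral>\<^sup>+\<omega>. ennreal ((elem_integral W (L k) \<omega> - I t \<omega>)\<^sup>2) \<partial>M) + 3 * (e1 k + e2 k + e3 k))"
  have main: "(\<integral>\<^sup>+\<omega>. ennreal ((I t \<omega> - I s \<omega> - elem_integral W (?R k) \<omega>)\<^sup>2) \<partial>M) \<le> ?e k" for k
  proof -
    note [measurable] = Iad[OF s0(1)] Iad[OF s0(2)] elem_integral_measurable[OF W L(1)]
      elem_integral_measurable[OF W L'(1)] elem_integral_measurable[OF W okD]
    have "(\<integral>\<^sup>+\<omega>. ennreal ((I t \<omega> - I s \<omega> - elem_integral W (?R k) \<omega>)\<^sup>2) \<partial>M) =
      (\<integral>\<^sup>+\<omega>. ennreal (((elem_integral W (L' k) \<omega> - I s \<omega>) -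
        (elem_integral W (L k) \<omega> - I t \<omega>) - (- elem_integral W (D k) \<omega>))\<^sup>2) \<partial>M)"
      by (intro nn_integral_cong arg_cong[where f="\<lambda>x. ennreal (x\<^sup>2)"]) (simp add: Dint)
    also have "\<dots> \<le> 3 * ((\<integral>\<^sup>+\<omega>. ennreal ((elem_integral W (L' k) \<omega> - I s \<omega>)\<^sup>2) \<partial>M) +
      (\<integral>\<^sup>+\<omega>. ennreal ((elem_integral W (L k) \<omega> - I t \<omega>)\<^sup>2) \<partial>M) + (\<integral>\<^sup>+\<omega>. ennreal ((- elem_integral W (D k) \<omega>)\<^sup>2) \<partial>M))"
      by (rule nn_integral_diff3_square_le) measurable
    also have "\<dots> \<le> ?e k" using D2[of k] by (intro mult_left_mono add_left_mono) auto
    finally show ?thesis .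
  qed
  have "e1 \<longlonglongrightarrow> 0" "e2 \<longlonglongrightarrow> 0" "e3 \<longlonglongrightarrow> 0"
    using L(2) L'(2) riemann_integrand_L2[OF H st] unfolding e1_def e2_def e3_def by auto
  then have "?e \<longlonglongrightarrow> 3 * (0 + 0 + 3 * (0 + 0 + 0))"
    using L(3) L'(3) by (intro tendsto_add ennreal_tendsto_cmult) auto
  then have "?e \<longlonglongrightarrow> 0" by simp
  then show ?thesis
    by (rule tendsto_sandwich[OF _ _ tendsto_const, rotated 2]) (use main in auto)
qed

section \<open>Exponential moments and tails\<close>

lemma brownian_exp_increment:
  assumes W: "brownian W" and st: "0 \<le> s" "s \<le> t"
    and G: "G \<in> borel_measurable (F s)" and h: "h \<in> borel_measurable (F s)"
    and C: "\<And>\<omega>. \<omega> \<in> space M \<Longrightarrow> \<bar>h \<omega>\<bar> \<le> C"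
  shows "(\<integral>\<^sup>+\<omega>. G \<omega> * ennreal (exp (h \<omega> * (W t \<omega> - W s \<omega>))) \<partial>M) \<le> ennreal (exp (C\<^sup>2 * (t - s) / 2)) * (\<integral>\<^sup>+\<omega>. G \<omega> \<partial>M)"
proof (cases "s = t")
  case True
  then show ?thesis by simp
next
  case False
  then have lt: "s < t" "0 < sqrt (t - s)" using st by auto
  note D = brownian_def[of W, THEN iffD1, OF W]
  have dist: "distributed M lborel (\<lambda>\<omega>. W t \<omega> - W s \<omega>) (normal_density 0 (sqrt (t - s)))"
    using D st lt by blast
  let ?W = "\<lambda>\<omega>. W t \<omega> - W s \<omega>"
  \<comment> \<open>\<open>indep_var\<close> takes two variables with values in the same type, so
    the increment is padded with a first component 0 to match the pair \<open>?X\<close>.\<close>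
  let ?V = "\<lambda>\<omega>. (0, ?W \<omega>)" and ?X = "\<lambda>\<omega>. (G \<omega>, h \<omega>)"
  let ?N = "borel \<Otimes>\<^sub>M borel :: (ennreal \<times> real) measure"
  have X: "?X \<in> measurable (F s) ?N" using G h by measurable
  note Gm[measurable] = measurable_F[OF G st(1)] and hm[measurable] = measurable_F[OF h st(1)]
  note [measurable] = brownian_increment(1)[OF W st]
  have iv: "distr M ?N ?X \<Otimes>\<^sub>M distr M ?N ?V = distr M (?N \<Otimes>\<^sub>M ?N) (\<lambda>\<omega>. (?X \<omega>, ?V \<omega>))"
    using brownian_indep[OF W st(1) lt(1) X, of "\<lambda>v. (0, v)" ?N] unfolding indep_var_distribution_eq by simp
  interpret V: prob_space "distr M ?N ?V" by (rule prob_space_distr) measurable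
  let ?f = "\<lambda>p. fst (fst p) * ennreal (exp (snd (fst p) * snd (snd p)))"
  have "(\<integral>\<^sup>+\<omega>. G \<omega> * ennreal (exp (h \<omega> * ?W \<omega>)) \<partial>M) = (\<integral>\<^sup>+p. ?f p \<partial>distr M (?N \<Otimes>\<^sub>M ?N) (\<lambda>\<omega>. (?X \<omega>, ?V \<omega>)))"
    by (subst nn_integral_distr) auto
  also have "\<dots> = (\<integral>\<^sup>+p. ?f p \<partial>(distr M ?N ?X \<Otimes>\<^sub>M distr M ?N ?V))" unfolding iv ..
  also have "\<dots> = (\<integral>\<^sup>+x. \<integral>\<^sup>+v. ?f (x, v) \<partial>distr M ?N ?V \<partial>distr M ?N ?X)"
    by (rule V.nn_integral_fst[symmetric]) simp
  also have "\<dots> = (\<integral>\<^sup>+x. \<integral>\<^sup>+\<omega>'. fst x * ennreal (exp (snd x * ?W \<omega>')) \<partial>M \<partial>distr M ?N ?X)"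
    by (intro nn_integral_cong) (subst nn_integral_distr, auto)
  also have "\<dots> = (\<integral>\<^sup>+\<omega>. \<integral>\<^sup>+\<omega>'. G \<omega> * ennreal (exp (h \<omega> * ?W \<omega>')) \<partial>M \<partial>M)"
    by (subst nn_integral_distr) auto
  \<comment> \<open>Fubini has taken the place of conditioning: with the first outcome frozen, the
    inner integral is the normal moment generating function at \<open>h \<omega>\<close>.\<close>
  also have "\<dots> = (\<integral>\<^sup>+\<omega>. G \<omega> * ennreal (exp ((h \<omega>)\<^sup>2 * (t - s) / 2)) \<partial>M)"
  proof (rule nn_integral_cong)
    fix \<omega>
    have "(\<integral>\<^sup>+\<omega>'. G \<omega> * ennreal (exp (h \<omega> * ?W \<omega>')) \<partial>M) = G \<omega> * (\<integral>\<^sup>+\<omega>'. ennreal (exp (h \<omega> * ?W \<omega>')) \<partial>M)"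
      by (rule nn_integral_cmult) auto
    also have "(\<integral>\<^sup>+\<omega>'. ennreal (exp (h \<omega> * ?W \<omega>')) \<partial>M) = (\<integral>\<^sup>+x. ennreal (normal_density 0 (sqrt (t - s)) x) * ennreal (exp (h \<omega> * x)) \<partial>lborel)"
      by (rule distributed_nn_integral[OF dist, symmetric]) auto
    also have "\<dots> = ennreal (exp ((h \<omega>)\<^sup>2 * (t - s) / 2))"
      using normal_mgf[OF lt(2), of "h \<omega>"] lt by simp
    finally show "(\<integral>\<^sup>+\<omega>'. G \<omega> * ennreal (exp (h \<omega> * ?W \<omega>')) \<partial>M) = G \<omega> * ennreal (exp ((h \<omega>)\<^sup>2 * (t - s) / 2))" .
  qed
  also have "\<dots> \<le> (\<integral>\<^sup>+\<omega>. ennreal (exp (C\<^sup>2 * (t - s) / 2)) * G \<omega> \<partial>M)"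
  proof (rule nn_integral_mono)
    fix \<omega> assume "\<omega> \<in> space M"
    then have "(h \<omega>)\<^sup>2 \<le> C\<^sup>2" using abs_le_square_iff[of "h \<omega>" C] C[of \<omega>] by auto
    then have "exp ((h \<omega>)\<^sup>2 * (t - s) / 2) \<le> exp (C\<^sup>2 * (t - s) / 2)"
      using lt by (simp add: mult_right_mono)
    then show "G \<omega> * ennreal (exp ((h \<omega>)\<^sup>2 * (t - s) / 2)) \<le> ennreal (exp (C\<^sup>2 * (t - s) / 2)) * G \<omega>"
      by (subst mult.commute) (intro mult_right_mono ennreal_leI, auto)
  qed
  also have "\<dots> = ennreal (exp (C\<^sup>2 * (t - s) / 2)) * (\<integral>\<^sup>+\<omega>. G \<omega> \<partial>M)"
    by (rule nn_integral_cmult) auto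
  finally show ?thesis .
qed

text \<open>The partial sum up to a grid point is known at that point, so each further cell costs a
  factor given by \<open>brownian_exp_increment\<close>. The exponents add up to the length of the
  interval, hence the bound is uniform in \<open>k\<close>.\<close>

lemma riemann_exp_moment:
  assumes W: "brownian W" and H: "bounded_cadlag H" and st: "0 \<le> s" "s < t"
    and C: "\<And>\<omega> u. \<omega> \<in> space M \<Longrightarrow> 0 \<le> u \<Longrightarrow> \<bar>H u \<omega>\<bar> \<le> C"
  shows "(\<integral>\<^sup>+\<omega>. ennreal (exp (\<theta> * elem_integral W (riemann H s t k) \<omega>)) \<partial>M) \<le> ennreal (exp (\<theta>\<^sup>2 * C\<^sup>2 * (t - s) / 2))"
proof (cases "k = 0")
  case True
  then show ?thesis using st by (simp add: elem_integral_riemann emeasure_space_1)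
next
  case False
  let ?g = "grid s t k"
  define P where "P j \<omega> = (\<Sum>i<j. H (?g i) \<omega> * (W (?g (Suc i)) \<omega> - W (?g i) \<omega>))" for j \<omega>
  have g0: "0 \<le> ?g j" "?g j \<le> ?g (Suc j)" "i \<le> j \<Longrightarrow> ?g i \<le> ?g j" for i j
    using grid_mono[of s t 0 j k] grid_mono[of s t j "Suc j" k] grid_mono[of s t i j k] st by (auto simp: grid_simps)
  have Had: "H (?g i) \<in> borel_measurable (F (?g i))" for i
    using H g0 by (auto simp: bounded_cadlag_def adapted_def)
  have P: "P j \<in> borel_measurable (F (?g j))" for j
    unfolding P_def
    by (intro borel_measurable_sum borel_measurable_times borel_measurable_diff
        measurable_F_mono[OF Had] measurable_F_mono[OF brownian_adapted[OF W]] g0) auto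
  have "(\<integral>\<^sup>+\<omega>. ennreal (exp (\<theta> * P j \<omega>)) \<partial>M) \<le> ennreal (exp (\<theta>\<^sup>2 * C\<^sup>2 * (?g j - s) / 2))" for j
  proof (induction j)
    case 0
    then show ?case by (simp add: P_def grid_simps emeasure_space_1)
  next
    case (Suc j)
    have "(\<integral>\<^sup>+\<omega>. ennreal (exp (\<theta> * P (Suc j) \<omega>)) \<partial>M) =
        (\<integral>\<^sup>+\<omega>. ennreal (exp (\<theta> * P j \<omega>)) * ennreal (exp ((\<theta> * H (?g j) \<omega>) * (W (?g (Suc j)) \<omega> - W (?g j) \<omega>))) \<partial>M)"
      by (simp add: P_def algebra_simps exp_add[symmetric] ennreal_mult''[symmetric])
    also have "\<dots> \<le> ennreal (exp ((\<bar>\<theta>\<bar> * C)\<^sup>2 * (?g (Suc j) - ?g j) / 2)) * (\<integral>\<^sup>+\<omega>. ennreal (exp (\<theta> * P j \<omega>)) \<partial>M)"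
    proof (rule brownian_exp_increment[OF W g0(1,2)])
      show "(\<lambda>\<omega>. ennreal (exp (\<theta> * P j \<omega>))) \<in> borel_measurable (F (?g j))" using P by measurable
      show "(\<lambda>\<omega>. \<theta> * H (?g j) \<omega>) \<in> borel_measurable (F (?g j))" using Had by measurable
      show "\<bar>\<theta> * H (?g j) \<omega>\<bar> \<le> \<bar>\<theta>\<bar> * C" if "\<omega> \<in> space M" for \<omega>
        using C[OF that g0(1)] by (simp add: abs_mult mult_left_mono)
    qed
    also have "\<dots> \<le> ennreal (exp ((\<bar>\<theta>\<bar> * C)\<^sup>2 * (?g (Suc j) - ?g j) / 2)) * ennreal (exp (\<theta>\<^sup>2 * C\<^sup>2 * (?g j - s) / 2))"
      by (intro mult_left_mono Suc.IH) auto
    also have "\<dots> = ennreal (exp (\<theta>\<^sup>2 * C\<^sup>2 * (?g (Suc j) - s) / 2))"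
      by (simp add: ennreal_mult''[symmetric] exp_add[symmetric] power_mult_distrib add_divide_distrib[symmetric] algebra_simps)
    finally show ?case .
  qed
  from this[of k] show ?thesis using False by (simp add: P_def elem_integral_riemann grid_simps)
qed

lemma riemann_tail:
  assumes W: "brownian W" and H: "bounded_cadlag H" and st: "0 \<le> s" "s < t"
    and C: "0 < C" "\<And>\<omega> u. \<omega> \<in> space M \<Longrightarrow> 0 \<le> u \<Longrightarrow> \<bar>H u \<omega>\<bar> \<le> C" and d: "0 < d"
  shows "prob {\<omega>\<in>space M. d \<le> \<bar>elem_integral W (riemann H s t k) \<omega>\<bar>} \<le> 2 * exp (- d\<^sup>2 / (2 * C\<^sup>2 * (t - s)))"
proof -
  let ?R = "elem_integral W (riemann H s t k)"
  have [measurable]: "random_variable borel ?R" by (rule elem_integral_measurable[OF W elem_ok_riemann[OF H st]])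
  \<comment> \<open>The minimizer of the Chernoff exponent, which is quadratic in \<theta>. The sign
    \<open>c\<close> below handles the two tails with one argument.\<close>
  define \<theta> where "\<theta> = d / (C\<^sup>2 * (t - s))"
  have \<theta>: "0 < \<theta>" using d C st by (simp add: \<theta>_def)
  have one: "prob {\<omega>\<in>space M. d \<le> c * ?R \<omega>} \<le> exp (- d\<^sup>2 / (2 * C\<^sup>2 * (t - s)))" if c: "c\<^sup>2 = 1" for c
  proof -
    have "emeasure M {\<omega>\<in>space M. 1 \<le> ennreal (exp (- \<theta> * d)) * ennreal (exp (\<theta> * c * ?R \<omega>))} \<le>
        ennreal (exp (- \<theta> * d)) * (\<integral>\<^sup>+\<omega>. ennreal (exp (\<theta> * c * ?R \<omega>)) * indicator (space M) \<omega> \<partial>M)"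
      by (rule nn_integral_Markov_inequality) auto
    also have "(\<integral>\<^sup>+\<omega>. ennreal (exp (\<theta> * c * ?R \<omega>)) * indicator (space M) \<omega> \<partial>M) = (\<integral>\<^sup>+\<omega>. ennreal (exp (\<theta> * c * ?R \<omega>)) \<partial>M)"
      by (intro nn_integral_cong) simp
    also have "\<dots> \<le> ennreal (exp ((\<theta> * c)\<^sup>2 * C\<^sup>2 * (t - s) / 2))"
      by (rule riemann_exp_moment[OF W H st C(2)])
    also have "ennreal (exp (- \<theta> * d)) * ennreal (exp ((\<theta> * c)\<^sup>2 * C\<^sup>2 * (t - s) / 2)) = ennreal (exp (- d\<^sup>2 / (2 * C\<^sup>2 * (t - s))))"
    proof -
      have ne: "C\<^sup>2 \<noteq> 0" "t - s \<noteq> 0" using C st by auto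
      have "\<theta>\<^sup>2 * C\<^sup>2 * (t - s) = d * \<theta>"
        using ne by (simp add: \<theta>_def power2_eq_square)
      moreover have "d\<^sup>2 / (2 * C\<^sup>2 * (t - s)) = d * \<theta> / 2"
        using ne by (simp add: \<theta>_def power2_eq_square)
      ultimately show ?thesis
        by (simp add: ennreal_mult''[symmetric] exp_add[symmetric] power_mult_distrib c mult.commute)
    qed
    finally have *: "emeasure M {\<omega>\<in>space M. 1 \<le> ennreal (exp (- \<theta> * d)) * ennreal (exp (\<theta> * c * ?R \<omega>))} \<le>
        ennreal (exp (- d\<^sup>2 / (2 * C\<^sup>2 * (t - s))))" by (simp add: mult_left_mono)
    have "1 \<le> ennreal (exp (- \<theta> * d)) * ennreal (exp (\<theta> * c * ?R \<omega>)) \<longleftrightarrow> d \<le> c * ?R \<omega>" for \<omega>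
    proof -
      have "ennreal (exp (- \<theta> * d)) * ennreal (exp (\<theta> * c * ?R \<omega>)) = ennreal (exp (\<theta> * (c * ?R \<omega> - d)))"
        by (simp add: ennreal_mult''[symmetric] exp_add[symmetric] algebra_simps)
      then show ?thesis using \<theta> by (simp add: one_le_exp_iff zero_le_mult_iff ennreal_1[symmetric] del: ennreal_1)
    qed
    with * show ?thesis by (simp add: emeasure_eq_measure)
  qed
  have "prob {\<omega>\<in>space M. d \<le> \<bar>?R \<omega>\<bar>} = prob ({\<omega>\<in>space M. d \<le> 1 * ?R \<omega>} \<union> {\<omega>\<in>space M. d \<le> - 1 * ?R \<omega>})"
    using d by (intro arg_cong[where f=prob]) (auto simp: abs_if)
  also have "\<dots> \<le> prob {\<omega>\<in>space M. d \<le> 1 * ?R \<omega>} + prob {\<omega>\<in>space M. d \<le> - 1 * ?R \<omega>}"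
    by (rule measure_Un_le) measurable
  also have "\<dots> \<le> 2 * exp (- d\<^sup>2 / (2 * C\<^sup>2 * (t - s)))"
    using one[of 1] one[of "-1"] by simp
  finally show ?thesis .
qed

text \<open>Half of \<open>d\<close> is granted to the Riemann sum and half to its distance from the
  integral, whose probability vanishes as the mesh is refined. Halving \<open>d\<close> turns the 2
  of \<open>riemann_tail\<close> into 8.\<close>

lemma ito_tail:
  assumes W: "brownian W" and H: "bounded_cadlag H" and I: "ito_integral W H I" and st: "0 \<le> s" "s < t"
    and C: "0 < C" "\<And>\<omega> u. \<omega> \<in> space M \<Longrightarrow> 0 \<le> u \<Longrightarrow> \<bar>H u \<omega>\<bar> \<le> C" and d: "0 < d"
  shows "prob {\<omega>\<in>space M. d \<le> \<bar>I t \<omega> - I s \<omega>\<bar>} \<le> 2 * exp (- d\<^sup>2 / (8 * C\<^sup>2 * (t - s)))"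
proof -
  let ?R = "\<lambda>k. elem_integral W (riemann H s t k)"
  have Rm[measurable]: "random_variable borel (?R k)" for k
    by (rule elem_integral_measurable[OF W elem_ok_riemann[OF H st]])
  have [measurable]: "random_variable borel (I t)" "random_variable borel (I s)"
    using ito_integral_measurable[OF I] st by auto
  let ?E = "\<lambda>k \<omega>. I t \<omega> - I s \<omega> - ?R k \<omega>"
  have le: "prob {\<omega>\<in>space M. d \<le> \<bar>I t \<omega> - I s \<omega>\<bar>} \<le> 2 * exp (- d\<^sup>2 / (8 * C\<^sup>2 * (t - s))) + prob {\<omega>\<in>space M. d / 2 \<le> \<bar>?E k \<omega>\<bar>}" for k
  proof -
    have "prob {\<omega>\<in>space M. d \<le> \<bar>I t \<omega> - I s \<omega>\<bar>} \<le> prob ({\<omega>\<in>space M. d / 2 \<le> \<bar>?R k \<omega>\<bar>} \<union> {\<omega>\<in>space M. d / 2 \<le> \<bar>?E k \<omega>\<bar>})"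
    proof (rule finite_measure_mono)
      have "d / 2 \<le> \<bar>r\<bar> \<or> d / 2 \<le> \<bar>x - r\<bar>" if "d \<le> \<bar>x\<bar>" for x r :: real
        using that by linarith
      then show "{\<omega>\<in>space M. d \<le> \<bar>I t \<omega> - I s \<omega>\<bar>} \<subseteq> {\<omega>\<in>space M. d / 2 \<le> \<bar>?R k \<omega>\<bar>} \<union> {\<omega>\<in>space M. d / 2 \<le> \<bar>?E k \<omega>\<bar>}"
        by blast
    qed measurable
    also have "\<dots> \<le> prob {\<omega>\<in>space M. d / 2 \<le> \<bar>?R k \<omega>\<bar>} + prob {\<omega>\<in>space M. d / 2 \<le> \<bar>?E k \<omega>\<bar>}"
      by (rule measure_Un_le) measurable
    also have "prob {\<omega>\<in>space M. d / 2 \<le> \<bar>?R k \<omega>\<bar>} \<le> 2 * exp (- (d / 2)\<^sup>2 / (2 * C\<^sup>2 * (t - s)))"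
      using d by (intro riemann_tail[OF W H st C]) auto
    also have "- (d / 2)\<^sup>2 / (2 * C\<^sup>2 * (t - s)) = - d\<^sup>2 / (8 * C\<^sup>2 * (t - s))"
      by (simp add: power_divide)
    finally show ?thesis by simp
  qed
  have "(\<lambda>k. ennreal (1 / (d / 2)\<^sup>2) * (\<integral>\<^sup>+\<omega>. ennreal ((?E k \<omega>)\<^sup>2) \<partial>M)) \<longlonglongrightarrow> ennreal (1 / (d / 2)\<^sup>2) * 0"
    by (intro ennreal_tendsto_cmult ito_riemann_L2[OF W H I st]) auto
  then have lim0: "(\<lambda>k. ennreal (1 / (d / 2)\<^sup>2) * (\<integral>\<^sup>+\<omega>. ennreal ((?E k \<omega>)\<^sup>2) \<partial>M)) \<longlonglongrightarrow> ennreal 0"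
    by (simp only: mult_zero_right ennreal_0)
  have "(\<lambda>k. ennreal (prob {\<omega>\<in>space M. d / 2 \<le> \<bar>?E k \<omega>\<bar>})) \<longlonglongrightarrow> ennreal 0"
  proof (rule tendsto_sandwich[where f="\<lambda>_. ennreal 0" and
        h="\<lambda>k. ennreal (1 / (d / 2)\<^sup>2) * (\<integral>\<^sup>+\<omega>. ennreal ((?E k \<omega>)\<^sup>2) \<partial>M)"])
    show "eventually (\<lambda>k. ennreal (prob {\<omega>\<in>space M. d / 2 \<le> \<bar>?E k \<omega>\<bar>}) \<le>
        ennreal (1 / (d / 2)\<^sup>2) * (\<integral>\<^sup>+\<omega>. ennreal ((?E k \<omega>)\<^sup>2) \<partial>M)) sequentially"
      using d by (intro always_eventually allI nn_square_markov) auto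
  qed (use lim0 in simp_all)
  then have "(\<lambda>k. prob {\<omega>\<in>space M. d / 2 \<le> \<bar>?E k \<omega>\<bar>}) \<longlonglongrightarrow> 0"
    by (subst (asm) tendsto_ennreal_iff) auto
  then have "(\<lambda>k. 2 * exp (- d\<^sup>2 / (8 * C\<^sup>2 * (t - s))) + prob {\<omega>\<in>space M. d / 2 \<le> \<bar>?E k \<omega>\<bar>}) \<longlonglongrightarrow> 2 * exp (- d\<^sup>2 / (8 * C\<^sup>2 * (t - s))) + 0"
    by (intro tendsto_add tendsto_const)
  then show ?thesis
    using le by (intro tendsto_lowerbound[where F=sequentially]) auto
qed

text \<open>The integrands in the definition of the integral may use the whole filtration, but the integral
  itself is a limit of Riemann sums and hence a function of \<open>W\<close> and \<open>H\<close> alone.\<close>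

lemma ito_version:
  assumes W: "brownian W" and H: "bounded_cadlag H" and I: "ito_integral W H I" and st: "0 \<le> s" "s < t"
    and G: "cylinders {0..} W \<union> cylinders {0..} H \<subseteq> G" "G \<subseteq> Pow (space M)"
  shows "\<exists>D\<in>borel_measurable (sigma (space M) G). AE \<omega> in M. D \<omega> = I t \<omega> - I s \<omega>"
proof -
  let ?R = "\<lambda>k. elem_integral W (riemann H s t k)"
  let ?E = "\<lambda>k \<omega>. I t \<omega> - I s \<omega> - ?R k \<omega>"
  have Rm[measurable]: "random_variable borel (?R k)" for k
    by (rule elem_integral_measurable[OF W elem_ok_riemann[OF H st]])
  have [measurable]: "random_variable borel (I t)" "random_variable borel (I s)"
    using ito_integral_measurable[OF I] st by auto
  have RG: "?R k \<in> borel_measurable (sigma (space M) G)" for k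
  proof -
    have g0: "0 \<le> grid s t k j" for j using grid_mono[of s t 0 j k] st by (auto simp: grid_simps)
    have WG: "W u \<in> borel_measurable (sigma (space M) G)" and HG: "H u \<in> borel_measurable (sigma (space M) G)" if "0 \<le> u" for u
      using measurable_cylinders[OF _ G(2), of "{0..}" W] measurable_cylinders[OF _ G(2), of "{0..}" H] G(1) that by auto
    show ?thesis unfolding elem_integral_riemann[abs_def]
      by (intro borel_measurable_sum borel_measurable_times borel_measurable_diff WG HG g0)
  qed
  note lim = ito_riemann_L2[OF W H I st]
  \<comment> \<open>Finite second moments are guaranteed only from some index on, and the passage
    from convergence in mean to an almost surely convergent subsequence needs integrability
    throughout; hence the shift by \<open>n\<close>.\<close>
  then have "eventually (\<lambda>k. (\<integral>\<^sup>+\<omega>. ennreal ((?E k \<omega>)\<^sup>2) \<partial>M) < 1) sequentially"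
    by (rule order_tendstoD) simp
  then obtain n where n: "\<And>k. n \<le> k \<Longrightarrow> (\<integral>\<^sup>+\<omega>. ennreal ((?E k \<omega>)\<^sup>2) \<partial>M) < 1"
    by (auto simp: eventually_sequentially)
  have int: "integrable M (\<lambda>\<omega>. (?E (k + n) \<omega>)\<^sup>2)" for k
    using n[of "k + n"] by (intro integrableI_nonneg) (auto intro: order.strict_trans)
  have "(\<lambda>k. ennreal (\<integral>\<omega>. (?E (k + n) \<omega>)\<^sup>2 \<partial>M)) \<longlonglongrightarrow> ennreal 0"
    using LIMSEQ_ignore_initial_segment[OF lim, of n] by (simp add: nn_integral_eq_integral[OF int])
  then have "(\<lambda>k. \<integral>\<omega>. (?E (k + n) \<omega>)\<^sup>2 \<partial>M) \<longlonglongrightarrow> 0"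
    by (subst (asm) tendsto_ennreal_iff) auto
  then have "(\<lambda>k. \<integral>\<omega>. norm ((?E (k + n) \<omega>)\<^sup>2) \<partial>M) \<longlonglongrightarrow> 0" by simp
  from tendsto_L1_AE_subseq[OF int this] obtain r where
    r: "AE \<omega> in M. (\<lambda>k. (?E (r k + n) \<omega>)\<^sup>2) \<longlonglongrightarrow> 0" by auto
  \<comment> \<open>Where the sequence diverges \<open>lim\<close> takes an arbitrary value, but the
    function is measurable with respect to the small sigma-algebra everywhere.\<close>
  define D where "D \<omega> = lim (\<lambda>k. ?R (r k + n) \<omega>)" for \<omega>
  have "D \<in> borel_measurable (sigma (space M) G)"
    unfolding D_def by (rule borel_measurable_lim_metric) (rule RG)
  moreover have "AE \<omega> in M. D \<omega> = I t \<omega> - I s \<omega>"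
    using r
  proof eventually_elim
    case (elim \<omega>)
    then have "(\<lambda>k. sqrt ((?E (r k + n) \<omega>)\<^sup>2)) \<longlonglongrightarrow> sqrt 0" by (rule tendsto_real_sqrt)
    then have "(\<lambda>k. ?E (r k + n) \<omega>) \<longlonglongrightarrow> 0" by (simp add: tendsto_rabs_zero_iff)
    from tendsto_diff[OF tendsto_const[of "I t \<omega> - I s \<omega>"] this]
    have "(\<lambda>k. ?R (r k + n) \<omega>) \<longlonglongrightarrow> I t \<omega> - I s \<omega>" by simp
    then show ?case unfolding D_def by (rule limI)
  qed
  ultimately show ?thesis by blast
qed

section \<open>Drift integrals\<close>

lemma drift_facts:
  assumes H: "bounded_cadlag H" and \<omega>: "\<omega> \<in> space M"
    and C: "0 \<le> C" "\<And>\<omega> u. \<omega> \<in> space M \<Longrightarrow> 0 \<le> u \<Longrightarrow> \<bar>H u \<omega>\<bar> \<le> C" and st: "0 \<le> s" "s \<le> t"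
  shows drift_diff: "(LINT u:{0..t}|lborel. H u \<omega>) - (LINT u:{0..s}|lborel. H u \<omega>) = (LINT u:{s<..t}|lborel. H u \<omega>)"
    and drift_bound: "\<bar>LINT u:{s<..t}|lborel. H u \<omega>\<bar> \<le> C * (t - s)"
    and drift_riemann: "s < t \<Longrightarrow> (\<lambda>k. \<Sum>j<k. H (grid s t k j) \<omega> * (grid s t k (Suc j) - grid s t k j)) \<longlonglongrightarrow> (LINT u:{s<..t}|lborel. H u \<omega>)"
proof -
  have Hm: "(\<lambda>u. H u \<omega> * indicator {0..} u) \<in> borel_measurable borel"
    using measurable_compose[OF measurable_Pair1'[OF \<omega>] bounded_cadlag_measurable[OF H]] by simp
  have int: "set_integrable lborel A (\<lambda>u. H u \<omega>)" if A: "A \<in> sets borel" "A \<subseteq> {0..b}" for A b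
    unfolding set_integrable_def
  proof (rule Bochner_Integration.integrable_bound[where f="\<lambda>u. C * indicator {0..b} u"])
    show "integrable lborel (\<lambda>u. C * indicator {0..b} u :: real)"
      by (intro integrable_mult_right integrable_real_indicator) (auto simp: emeasure_lborel_Icc_eq)
    have "(\<lambda>u. (H u \<omega> * indicator {0..} u) * indicator A u) \<in> borel_measurable borel"
      using Hm A by measurable
    moreover have "(H u \<omega> * indicator {0..} u) * indicator A u = indicator A u * H u \<omega>" for u
      using A by (auto simp: indicator_def)
    ultimately show "(\<lambda>u. indicator A u *\<^sub>R H u \<omega>) \<in> borel_measurable lborel" by simp
    show "AE u in lborel. norm (indicator A u *\<^sub>R H u \<omega>) \<le> norm (C * indicator {0..b} u)"
      using A C(1) C(2)[OF \<omega>] by (intro AE_I2) (force simp: indicator_def)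
  qed
  have sub: "{s<..t} \<subseteq> {0..t}" using st by auto
  have "(LINT u:{0..s} \<union> {s<..t}|lborel. H u \<omega>) = (LINT u:{0..s}|lborel. H u \<omega>) + (LINT u:{s<..t}|lborel. H u \<omega>)"
    using st by (intro set_integral_Un int[of _ t]) auto
  moreover have "{0..s} \<union> {s<..t} = {0..t}" using st by auto
  ultimately show "(LINT u:{0..t}|lborel. H u \<omega>) - (LINT u:{0..s}|lborel. H u \<omega>) = (LINT u:{s<..t}|lborel. H u \<omega>)"
    by simp
  have "norm (LINT u:{s<..t}|lborel. H u \<omega>) \<le> (LINT u|lborel. C * indicator {s<..t} u)"
    unfolding set_lebesgue_integral_def
  proof (rule Bochner_Integration.integral_norm_bound_integral)
    show "integrable lborel (\<lambda>u. indicat_real {s<..t} u *\<^sub>R H u \<omega>)"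
      using int[of "{s<..t}" t] sub unfolding set_integrable_def by auto
    show "integrable lborel (\<lambda>u. C * indicator {s<..t} u :: real)"
      using st by (intro integrable_mult_right integrable_real_indicator) auto
    show "norm (indicat_real {s<..t} u *\<^sub>R H u \<omega>) \<le> C * indicator {s<..t} u" for u
      using C(2)[OF \<omega>, of u] st by (auto simp: indicator_def)
  qed
  then show "\<bar>LINT u:{s<..t}|lborel. H u \<omega>\<bar> \<le> C * (t - s)" using st by simp
  assume lt: "s < t"
  have "(\<lambda>k. LINT u|lborel. elem_integrand (riemann H s t k) u \<omega>) \<longlonglongrightarrow> (LINT u|lborel. H u \<omega> * indicator {s<..t} u)"
  proof (rule integral_dominated_convergence[where w="\<lambda>u. C * indicator {s<..t} u"])
    show "(\<lambda>u. elem_integrand (riemann H s t k) u \<omega>) \<in> borel_measurable lborel" for k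
      unfolding elem_nth by (intro borel_measurable_sum borel_measurable_times) auto
    show "(\<lambda>u. H u \<omega> * indicator {s<..t} u) \<in> borel_measurable lborel"
      using int[of "{s<..t}" t] sub unfolding set_integrable_def by (auto simp: mult.commute)
    show "integrable lborel (\<lambda>u. C * indicator {s<..t} u :: real)"
      using st by (intro integrable_mult_right integrable_real_indicator) auto
    show "AE u in lborel. (\<lambda>k. elem_integrand (riemann H s t k) u \<omega>) \<longlonglongrightarrow> H u \<omega> * indicator {s<..t} u"
      using H \<omega> by (intro AE_riemann_integrand_tendsto lt st) (auto simp: bounded_cadlag_def)
    show "AE u in lborel. norm (elem_integrand (riemann H s t k) u \<omega>) \<le> C * indicator {s<..t} u" for k
      using riemann_integrand_bound[where H=H, OF lt C(1) C(2)[OF \<omega>] st(1)] by (intro AE_I2) auto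
  qed
  moreover have "(LINT u|lborel. elem_integrand (riemann H s t k) u \<omega>) =
      (\<Sum>j<k. H (grid s t k j) \<omega> * (grid s t k (Suc j) - grid s t k j))" for k
  proof -
    have "grid s t k j \<le> grid s t k (Suc j)" for j using lt by (intro grid_mono) auto
    then have "has_bochner_integral lborel (\<lambda>u. \<Sum>j<k. H (grid s t k j) \<omega> * indicator {grid s t k j<..grid s t k (Suc j)} u)
        (\<Sum>j<k. H (grid s t k j) \<omega> * (grid s t k (Suc j) - grid s t k j))"
      by (intro has_bochner_integral_sum has_bochner_integral_mult_right) (auto simp: has_bochner_integral_iff)
    then show ?thesis
      by (simp add: has_bochner_integral_iff elem_integrand_def riemann_def sum_list_sum_nth atLeast0LessThan)
  qed
  ultimately show "(\<lambda>k. \<Sum>j<k. H (grid s t k j) \<omega> * (grid s t k (Suc j) - grid s t k j)) \<longlonglongrightarrow> (LINT u:{s<..t}|lborel. H u \<omega>)"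
    by (simp add: set_lebesgue_integral_def mult.commute)
qed

text \<open>Joint measurability in time and outcome was obtained for the full sigma-algebra of
  \<open>M\<close> only. Riemann sums involve finitely many coordinates of \<open>H\<close> and
  therefore stay inside the algebra generated by its cylinders.\<close>

lemma drift_measurable:
  assumes H: "bounded_cadlag H" and st: "0 \<le> s" "s < t"
    and G: "cylinders {0..} H \<subseteq> G" "G \<subseteq> Pow (space M)"
  shows "(\<lambda>\<omega>. LINT u:{s<..t}|lborel. H u \<omega>) \<in> borel_measurable (sigma (space M) G)"
proof (rule borel_measurable_LIMSEQ_real)
  obtain C0 where "\<And>\<omega> u. \<omega> \<in> space M \<Longrightarrow> 0 \<le> u \<Longrightarrow> \<bar>H u \<omega>\<bar> \<le> C0"
    using H by (auto simp: bounded_cadlag_def)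
  then have C: "\<And>\<omega> u. \<omega> \<in> space M \<Longrightarrow> 0 \<le> u \<Longrightarrow> \<bar>H u \<omega>\<bar> \<le> \<bar>C0\<bar>" by (meson abs_ge_self order_trans)
  show "(\<lambda>k. \<Sum>j<k. H (grid s t k j) \<omega> * (grid s t k (Suc j) - grid s t k j)) \<longlonglongrightarrow> (LINT u:{s<..t}|lborel. H u \<omega>)"
    if "\<omega> \<in> space (sigma (space M) G)" for \<omega>
    using that st by (intro drift_riemann[OF H _ abs_ge_zero C]) (auto simp: space_measure_of_conv)
  fix k
  have g0: "0 \<le> grid s t k j" for j using grid_mono[of s t 0 j k] st by (auto simp: grid_simps)
  have HG: "H u \<in> borel_measurable (sigma (space M) G)" if "0 \<le> u" for u
    using measurable_cylinders[OF G] that by auto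
  show "(\<lambda>\<omega>. \<Sum>j<k. H (grid s t k j) \<omega> * (grid s t k (Suc j) - grid s t k j)) \<in> borel_measurable (sigma (space M) G)"
    by (intro borel_measurable_sum borel_measurable_times HG g0) auto
qed

section \<open>Continuous part of an increment\<close>

definition continuous_part :: "(real \<Rightarrow> 'a \<Rightarrow> real) \<Rightarrow> (real \<Rightarrow> 'a \<Rightarrow> real) \<Rightarrow> real \<Rightarrow> real \<Rightarrow> 'a \<Rightarrow> real" where
  "continuous_part b I s t \<omega> = (LINT u:{s<..t}|lborel. b u \<omega>) + (I t \<omega> - I s \<omega>)"

lemma continuous_part_version:
  assumes "brownian W" "bounded_cadlag b" "bounded_cadlag H" "ito_integral W H I" "0 \<le> s" "s < t"
    and G: "cylinders {0..} W \<union> cylinders {0..} b \<union> cylinders {0..} H \<subseteq> G" "G \<subseteq> Pow (space M)"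
  shows "\<exists>D\<in>borel_measurable (sigma (space M) G). AE \<omega> in M. D \<omega> = continuous_part b I s t \<omega>"
proof -
  obtain D where D: "D \<in> borel_measurable (sigma (space M) G)" "AE \<omega> in M. D \<omega> = I t \<omega> - I s \<omega>"
    using ito_version[OF assms(1,3-6) _ G(2)] G(1) by blast
  have "(\<lambda>\<omega>. LINT u:{s<..t}|lborel. b u \<omega>) \<in> borel_measurable (sigma (space M) G)"
    using drift_measurable[OF assms(2,5,6)] G by auto
  with D show ?thesis unfolding continuous_part_def
    by (intro bexI[of _ "\<lambda>\<omega>. (LINT u:{s<..t}|lborel. b u \<omega>) + D \<omega>"]) auto
qed

text \<open>By the second condition on \<open>d\<close> the drift uses up at most half of it. The
  other half is left to the Ito integral, which turns the 8 of \<open>ito_tail\<close> into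
  32.\<close>

lemma continuous_part_tail:
  assumes W: "brownian W" and b: "bounded_cadlag b" and H: "bounded_cadlag H" and I: "ito_integral W H I"
    and st: "0 \<le> s" "s < t"
    and C: "0 < C" "\<And>\<omega> u. \<omega> \<in> space M \<Longrightarrow> 0 \<le> u \<Longrightarrow> \<bar>H u \<omega>\<bar> \<le> C"
      "\<And>\<omega> u. \<omega> \<in> space M \<Longrightarrow> 0 \<le> u \<Longrightarrow> \<bar>b u \<omega>\<bar> \<le> C"
    and d: "0 < d" "C * (t - s) \<le> d / 2"
  shows "{\<omega>\<in>space M. d < \<bar>continuous_part b I s t \<omega>\<bar>} \<in> events"
    and "prob {\<omega>\<in>space M. d < \<bar>continuous_part b I s t \<omega>\<bar>} \<le> 2 * exp (- d\<^sup>2 / (32 * C\<^sup>2 * (t - s)))"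
proof -
  have Im[measurable]: "random_variable borel (I t)" "random_variable borel (I s)"
    using ito_integral_measurable[OF I] st by auto
  have bm: "b u \<in> borel_measurable M" if "0 \<le> u" for u
    using b that measurable_F[of "b u" u] by (auto simp: bounded_cadlag_def adapted_def)
  have sub: "cylinders {0..} b \<subseteq> events"
    using bm by (auto simp: cylinders_def intro: measurable_sets)
  have sp: "events \<subseteq> Pow (space M)" using sets.sets_into_space by auto
  have sig: "sets (sigma (space M) events) = events" using sp by (simp add: sets_measure_of sets.sigma_sets_eq)
  have [measurable]: "(\<lambda>\<omega>. LINT u:{s<..t}|lborel. b u \<omega>) \<in> borel_measurable M"
    using drift_measurable[OF b st sub sp] by (simp add: measurable_def sig space_measure_of_conv)
  show "{\<omega>\<in>space M. d < \<bar>continuous_part b I s t \<omega>\<bar>} \<in> events"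
    unfolding continuous_part_def by measurable
  have "\<bar>continuous_part b I s t \<omega>\<bar> \<le> d / 2 + \<bar>I t \<omega> - I s \<omega>\<bar>" if "\<omega> \<in> space M" for \<omega>
    using drift_bound[OF b that _ C(3) st(1) less_imp_le[OF st(2)]] C(1) d(2) unfolding continuous_part_def by linarith
  then have "prob {\<omega>\<in>space M. d < \<bar>continuous_part b I s t \<omega>\<bar>} \<le> prob {\<omega>\<in>space M. d / 2 \<le> \<bar>I t \<omega> - I s \<omega>\<bar>}"
    by (intro finite_measure_mono) force+
  also have "\<dots> \<le> 2 * exp (- (d / 2)\<^sup>2 / (8 * C\<^sup>2 * (t - s)))"
    by (rule ito_tail[OF W H I st C(1,2)]) (use d in auto)
  also have "- (d / 2)\<^sup>2 / (8 * C\<^sup>2 * (t - s)) = - d\<^sup>2 / (32 * C\<^sup>2 * (t - s))"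
    by (simp add: power_divide)
  finally show "prob {\<omega>\<in>space M. d < \<bar>continuous_part b I s t \<omega>\<bar>} \<le> 2 * exp (- d\<^sup>2 / (32 * C\<^sup>2 * (t - s)))"
    by simp
qed

end

section \<open>Increments of the model\<close>

locale counting_path =
  fixes r :: "real \<Rightarrow> nat" and x :: "nat \<Rightarrow> real" and c z :: "real \<Rightarrow> real"
  assumes r0: "r 0 = 0" and r_mono: "\<And>s t. 0 \<le> s \<Longrightarrow> s \<le> t \<Longrightarrow> r s \<le> r t"
    and r_cadlag: "cadlag (\<lambda>t. real (r t))"
    and c: "continuous_on {0..} c"
    and z: "\<And>t. 0 \<le> t \<Longrightarrow> z t = c t + (\<Sum>i=1..r t. x i)"
begin

text \<open>The pathwise form of \<open>arrival\<close>. A level never reached gives the infimum of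
  the empty set, so the bounds below ask for a time at which level \<open>k\<close> is
  reached.\<close>

definition "T k = Inf {t. 0 \<le> t \<and> k \<le> r t}"

text \<open>The continuous part cancels between value and left limit; what remains is the difference
  of the mark sums at \<open>s\<close> and just before \<open>s\<close>.\<close>

lemma jump_eq:
  assumes "0 \<le> u" "u < s" and const: "\<And>v. u < v \<Longrightarrow> v < s \<Longrightarrow> r v = m"
  shows "jump z s = (\<Sum>i=1..r s. x i) - (\<Sum>i=1..m. x i)"
proof -
  have s: "0 < s" using assms by simp
  have "continuous_on {0<..} c" using c by (rule continuous_on_subset) auto
  then have "isCont c s" using s continuous_on_eq_continuous_at[of "{0<..}" c] by auto
  then have "(c \<longlongrightarrow> c s) (at_left s)"
    unfolding isCont_def by (rule tendsto_mono[rotated]) (rule at_le, simp)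
  then have "((\<lambda>v. c v + (\<Sum>i=1..m. x i)) \<longlongrightarrow> c s + (\<Sum>i=1..m. x i)) (at_left s)"
    by (intro tendsto_add tendsto_const)
  moreover have "eventually (\<lambda>v. c v + (\<Sum>i=1..m. x i) = z v) (at_left s)"
    unfolding eventually_at_left_field using assms z by (intro exI[of _ u]) auto
  ultimately have "(z \<longlongrightarrow> c s + (\<Sum>i=1..m. x i)) (at_left s)"
    using tendsto_cong by fastforce
  then have "Lim (at_left s) z = c s + (\<Sum>i=1..m. x i)"
    by (intro tendsto_Lim) auto
  then show ?thesis unfolding jump_def using z s by simp
qed

lemma T_lower: "0 \<le> t \<Longrightarrow> k \<le> r t \<Longrightarrow> T k \<le> t"
  unfolding T_def by (rule cInf_lower) (auto intro: bdd_belowI[of _ 0])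

lemma T_less:
  assumes "0 \<le> t" "k \<le> r t" "T k < s"
  obtains u where "0 \<le> u" "u < s" "k \<le> r u"
  using cInf_lessD[of "{t. 0 \<le> t \<and> k \<le> r t}" s] assms unfolding T_def by auto

text \<open>A right-continuous path with integer values is locally constant to the right: being
  closer than 1 to the limit means being equal to it.\<close>

lemma right_const:
  assumes "0 \<le> p"
  obtains e where "0 < e" "\<And>v. p \<le> v \<Longrightarrow> v < p + e \<Longrightarrow> r v = r p"
proof -
  have "((\<lambda>t. real (r t)) \<longlongrightarrow> real (r p)) (at_right p)"
    using r_cadlag assms by (auto simp: cadlag_def continuous_within)
  from tendstoD[OF this, of 1] obtain b where b: "p < b" "\<And>y. p < y \<Longrightarrow> y < b \<Longrightarrow> \<bar>real (r y) - real (r p)\<bar> < 1"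
    unfolding eventually_at_right_field dist_real_def by auto
  have const: "r v = r p" if "p \<le> v" "v < p + (b - p)" for v
    using b(2)[of v] that by (cases "v = p") auto
  show ?thesis by (rule that[of "b - p", OF _ const]) (use b(1) in simp_all)
qed

text \<open>If the level \<open>r s\<close> had been reached before \<open>s\<close>, monotonicity
  would keep the count constant up to and including \<open>s\<close>, and \<open>jump_eq\<close>
  would give a zero jump. Several arrivals at the same time do no harm here.\<close>

lemma jump_nonzero_imp_arrival:
  assumes "0 < s" "jump z s \<noteq> 0"
  shows "s = T (r s)" "1 \<le> r s"
proof -
  show "1 \<le> r s"
  proof (rule ccontr)
    assume "\<not> 1 \<le> r s"
    then have "r v = r s" if "0 < v" "v < s" for v using r_mono[of v s] that by auto
    from jump_eq[OF order_refl assms(1) this] show False using assms by simp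
  qed
  show "s = T (r s)"
  proof (rule ccontr)
    assume "s \<noteq> T (r s)"
    then have "T (r s) < s" using T_lower[of s "r s"] assms(1) by simp
    then obtain u where u: "0 \<le> u" "u < s" "r s \<le> r u" using T_less[of s "r s" s] assms(1) by auto
    have "r v = r s" if "u < v" "v < s" for v
      using r_mono[of u v] r_mono[of v s] that u by linarith
    from jump_eq[OF u(1,2) this] show False using assms by simp
  qed
qed

lemma jumps_finite: "finite {s. 0 < s \<and> s \<le> t \<and> jump z s \<noteq> 0}"
proof (rule finite_subset)
  show "{s. 0 < s \<and> s \<le> t \<and> jump z s \<noteq> 0} \<subseteq> T ` {1..r t}"
  proof
    fix s assume s: "s \<in> {s. 0 < s \<and> s \<le> t \<and> jump z s \<noteq> 0}"
    then have "s = T (r s)" "1 \<le> r s" "r s \<le> r t"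
      using jump_nonzero_imp_arrival[of s] r_mono[of s t] by auto
    then show "s \<in> T ` {1..r t}" by (metis atLeastAtMost_iff imageI)
  qed
qed simp

context
  fixes p t :: real
  assumes pt: "0 \<le> p" "p < t"
begin

lemma jump_zero_before:
  assumes "p < s" "r s = r p"
  shows "jump z s = 0"
proof -
  have "r v = r s" if "p < v" "v < s" for v
    using r_mono[of p v] r_mono[of v s] pt that assms by linarith
  from jump_eq[OF pt(1) assms(1) this] show ?thesis by simp
qed

text \<open>With finitely many non-zero jumps the \<open>infsum\<close> over an uncountable interval
  is an ordinary sum and may be split at \<open>p\<close>.\<close>

lemma jump_sum_diff:
  fixes e :: "real \<Rightarrow> real"
  shows "(\<Sum>\<^sub>\<infinity>s\<in>{0<..t}. e s * jump z s) - (\<Sum>\<^sub>\<infinity>s\<in>{0<..p}. e s * jump z s) =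
    (\<Sum>s\<in>{s. p < s \<and> s \<le> t \<and> jump z s \<noteq> 0}. e s * jump z s)"
proof -
  have eq: "(\<Sum>\<^sub>\<infinity>s\<in>{0<..u}. e s * jump z s) = (\<Sum>s\<in>{s. 0 < s \<and> s \<le> u \<and> jump z s \<noteq> 0}. e s * jump z s)" for u
  proof -
    have "(\<Sum>\<^sub>\<infinity>s\<in>{0<..u}. e s * jump z s) = (\<Sum>\<^sub>\<infinity>s\<in>{s. 0 < s \<and> s \<le> u \<and> jump z s \<noteq> 0}. e s * jump z s)"
      by (rule infsum_cong_neutral) auto
    then show ?thesis using jumps_finite by simp
  qed
  have "{s. 0 < s \<and> s \<le> t \<and> jump z s \<noteq> 0} =
      {s. 0 < s \<and> s \<le> p \<and> jump z s \<noteq> 0} \<union> {s. p < s \<and> s \<le> t \<and> jump z s \<noteq> 0}"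
    using pt by auto
  moreover have "finite {s. p < s \<and> s \<le> t \<and> jump z s \<noteq> 0}"
    by (rule finite_subset[OF _ jumps_finite[of t]]) (use pt in auto)
  moreover have "{s. 0 < s \<and> s \<le> p \<and> jump z s \<noteq> 0} \<inter> {s. p < s \<and> s \<le> t \<and> jump z s \<noteq> 0} = {}"
    by auto
  ultimately show ?thesis unfolding eq using jumps_finite[of p] by (simp only: sum.union_disjoint add_diff_cancel_left')
qed

lemma jump_sum_no_arrival:
  fixes e :: "real \<Rightarrow> real"
  assumes "r t = r p"
  shows "(\<Sum>\<^sub>\<infinity>s\<in>{0<..t}. e s * jump z s) - (\<Sum>\<^sub>\<infinity>s\<in>{0<..p}. e s * jump z s) = 0"
proof -
  have "jump z s = 0" if "p < s" "s \<le> t" for s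
    using jump_zero_before[of s] r_mono[of p s] r_mono[of s t] that pt assms by auto
  then have "{s. p < s \<and> s \<le> t \<and> jump z s \<noteq> 0} = {}" by auto
  then show ?thesis unfolding jump_sum_diff by (simp only: sum.empty)
qed

text \<open>Local constancy at \<open>p\<close> places the arrival strictly after \<open>p\<close>,
  and local constancy at the infimum shows that the level is attained there. A zero mark produces no
  jump at all; then both sides are 0.\<close>

lemma jump_sum_one_arrival:
  fixes e :: "real \<Rightarrow> real"
  assumes rt: "r t = Suc (r p)"
  shows "(\<Sum>\<^sub>\<infinity>s\<in>{0<..t}. e s * jump z s) - (\<Sum>\<^sub>\<infinity>s\<in>{0<..p}. e s * jump z s) = e (T (r t)) * x (r t)"
proof -
  let ?k = "r t"
  obtain d where d: "0 < d" "\<And>v. p \<le> v \<Longrightarrow> v < p + d \<Longrightarrow> r v = r p" using right_const[OF pt(1)] by metis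
  have Tp: "p < T ?k"
  proof (rule ccontr)
    assume "\<not> p < T ?k"
    then obtain u where u: "0 \<le> u" "u < p + d" "?k \<le> r u" using T_less[of t ?k "p + d"] pt d(1) by auto
    show False using u d(2)[of u] r_mono[of u p] rt by linarith
  qed
  have Tt: "T ?k \<le> t" using T_lower[of t ?k] pt by auto
  have before: "r v = r p" if "p < v" "v < T ?k" for v
  proof -
    have "\<not> ?k \<le> r v" using T_lower[of v ?k] that pt by auto
    then show ?thesis using r_mono[of p v] that pt rt by auto
  qed
  have at: "r (T ?k) = ?k"
  proof -
    obtain d' where d': "0 < d'" "\<And>v. T ?k \<le> v \<Longrightarrow> v < T ?k + d' \<Longrightarrow> r v = r (T ?k)"
      using right_const[of "T ?k"] less_imp_le[OF order.strict_trans1[OF pt(1) Tp]] by metis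
    obtain u where u: "0 \<le> u" "u < T ?k + d'" "?k \<le> r u" using T_less[of t ?k "T ?k + d'"] pt d'(1) by auto
    have "T ?k \<le> u" using T_lower u by auto
    then show ?thesis using d'(2)[of u] u r_mono[of "T ?k" t] Tt Tp pt by linarith
  qed
  have jk: "jump z (T ?k) = x ?k"
    using jump_eq[OF pt(1) Tp before] at rt by simp
  have other: "s = T ?k" if "p < s" "s \<le> t" "jump z s \<noteq> 0" for s
  proof -
    have "r s \<noteq> r p" using jump_zero_before[of s] that by auto
    then have "r s = ?k" using r_mono[of p s] r_mono[of s t] that pt rt by auto
    then show ?thesis using jump_nonzero_imp_arrival(1)[of s] that pt by auto
  qed
  show ?thesis
  proof (cases "x ?k = 0")
    case True
    have "jump z s = 0" if "p < s" "s \<le> t" for s using other[OF that] jk True by metis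
    then have none: "{s. p < s \<and> s \<le> t \<and> jump z s \<noteq> 0} = {}" by blast
    show ?thesis unfolding jump_sum_diff none using True by (simp only: sum.empty mult_zero_right)
  next
    case False
    have one: "{s. p < s \<and> s \<le> t \<and> jump z s \<noteq> 0} = {T ?k}"
    proof (intro set_eqI iffI)
      fix s assume "s \<in> {s. p < s \<and> s \<le> t \<and> jump z s \<noteq> 0}"
      then show "s \<in> {T ?k}" using other[of s] by blast
    next
      fix s assume "s \<in> {T ?k}"
      then have s: "s = T ?k" by (rule singletonD)
      have "p < s \<and> s \<le> t \<and> jump z s \<noteq> 0" unfolding s jk using False Tp Tt by blast
      then show "s \<in> {s. p < s \<and> s \<le> t \<and> jump z s \<noteq> 0}" by (rule CollectI)
    qed
    show ?thesis unfolding jump_sum_diff one by (simp add: jk)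
  qed
qed

end

end

context filtered_prob_space
begin

lemma drift_continuous:
  assumes H: "bounded_cadlag H" and \<omega>: "\<omega> \<in> space M"
  shows "continuous_on {0..} (\<lambda>t. LINT u:{0..t}|lborel. H u \<omega>)"
proof -
  obtain C0 where "\<And>\<omega> u. \<omega> \<in> space M \<Longrightarrow> 0 \<le> u \<Longrightarrow> \<bar>H u \<omega>\<bar> \<le> C0"
    using H by (auto simp: bounded_cadlag_def)
  then have C: "\<And>\<omega> u. \<omega> \<in> space M \<Longrightarrow> 0 \<le> u \<Longrightarrow> \<bar>H u \<omega>\<bar> \<le> \<bar>C0\<bar>" by (meson abs_ge_self order_trans)
  let ?f = "\<lambda>t. LINT u:{0..t}|lborel. H u \<omega>"
  have le: "\<bar>?f t - ?f s\<bar> \<le> \<bar>C0\<bar> * (t - s)" if "0 \<le> s" "s \<le> t" for s t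
  proof -
    have "?f t - ?f s = (LINT u:{s<..t}|lborel. H u \<omega>)"
      by (rule drift_diff[OF H \<omega>, where C="\<bar>C0\<bar>"]) (use C that in auto)
    moreover have "\<bar>LINT u:{s<..t}|lborel. H u \<omega>\<bar> \<le> \<bar>C0\<bar> * (t - s)"
      by (rule drift_bound[OF H \<omega>]) (use C that in auto)
    ultimately show ?thesis by simp
  qed
  have "\<bar>C0\<bar>-lipschitz_on {0..} ?f"
  proof (rule lipschitz_onI)
    fix s t :: real assume "s \<in> {0..}" "t \<in> {0..}"
    then show "dist (?f s) (?f t) \<le> \<bar>C0\<bar> * dist s t"
      using le[of s t] le[of t s] by (cases "s \<le> t") (auto simp: dist_real_def abs_minus_commute)
  qed simp
  then show ?thesis by (rule lipschitz_on_continuous_on)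
qed

end

section \<open>Increments over intervals with at most one arrival\<close>

context jump_regression
begin

definition noise :: "nat \<Rightarrow> 'a \<Rightarrow> real" where
  "noise k \<omega> = \<eta> (arrival R k \<omega>) \<omega>"

text \<open>The pathwise lemmas hold outside one null set that depends on neither \<open>p\<close>
  nor \<open>t\<close>. Intervals with two or more arrivals are left out, because they belong to the
  exceptional event.\<close>

lemma model_increments:
  obtains I I' where "ito_integral W \<sigma> I" "ito_integral W' \<sigma>' I'"
    "AE \<omega> in M. \<forall>p t. 0 \<le> p \<and> p < t \<longrightarrow>
      (R t \<omega> = R p \<omega> \<longrightarrow> Z t \<omega> - Z p \<omega> = continuous_part a' I' p t \<omega> \<and>
        Y t \<omega> - Y p \<omega> = continuous_part a I p t \<omega>) \<and>
      (R t \<omega> = Suc (R p \<omega>) \<longrightarrow> Z t \<omega> - Z p \<omega> = continuous_part a' I' p t \<omega> + \<xi> (R t \<omega>) \<omega> \<and>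
        Y t \<omega> - Y p \<omega> = continuous_part a I p t \<omega> + (\<beta> + noise (R t \<omega>) \<omega>) * \<xi> (R t \<omega>) \<omega>)"
proof -
  obtain I' where I': "ito_integral W' \<sigma>' I'"
    and Z: "AE \<omega> in M. \<forall>t\<ge>0. Z t \<omega> = Z 0 \<omega> + (LINT s:{0..t}|lborel. a' s \<omega>) + I' t \<omega> + compound R \<xi> t \<omega>"
    using Z_eq by blast
  obtain I where I: "ito_integral W \<sigma> I"
    and Y: "AE \<omega> in M. \<forall>t\<ge>0. Y t \<omega> = Y 0 \<omega> + (LINT s:{0..t}|lborel. a s \<omega>) + I t \<omega> +
        (\<Sum>\<^sub>\<infinity>s\<in>{0<..t}. (\<beta> + \<eta> s \<omega>) * jump (\<lambda>u. Z u \<omega>) s)"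
    using Y_eq by blast
  have dr: "(LINT u:{0..t}|lborel. b u \<omega>) - (LINT u:{0..p}|lborel. b u \<omega>) = (LINT u:{p<..t}|lborel. b u \<omega>)"
    if b: "bounded_cadlag b" and "\<omega> \<in> space M" "0 \<le> p" "p < t" for b \<omega> p t
  proof -
    obtain C0 where "\<And>\<omega> u. \<omega> \<in> space M \<Longrightarrow> 0 \<le> u \<Longrightarrow> \<bar>b u \<omega>\<bar> \<le> C0"
      using b by (auto simp: bounded_cadlag_def)
    then have C: "\<And>\<omega> u. \<omega> \<in> space M \<Longrightarrow> 0 \<le> u \<Longrightarrow> \<bar>b u \<omega>\<bar> \<le> \<bar>C0\<bar>" by (meson abs_ge_self order_trans)
    show ?thesis by (rule drift_diff[OF b that(2), where C="\<bar>C0\<bar>"]) (use C that in auto)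
  qed
  show ?thesis
  proof (rule that[OF I I'])
    show "AE \<omega> in M. \<forall>p t. 0 \<le> p \<and> p < t \<longrightarrow>
      (R t \<omega> = R p \<omega> \<longrightarrow> Z t \<omega> - Z p \<omega> = continuous_part a' I' p t \<omega> \<and>
        Y t \<omega> - Y p \<omega> = continuous_part a I p t \<omega>) \<and>
      (R t \<omega> = Suc (R p \<omega>) \<longrightarrow> Z t \<omega> - Z p \<omega> = continuous_part a' I' p t \<omega> + \<xi> (R t \<omega>) \<omega> \<and>
        Y t \<omega> - Y p \<omega> = continuous_part a I p t \<omega> + (\<beta> + noise (R t \<omega>) \<omega>) * \<xi> (R t \<omega>) \<omega>)"
      using Z Y AE_space
    proof eventually_elim
      case (elim \<omega>)
      interpret cp: counting_path "\<lambda>t. R t \<omega>" "\<lambda>k. \<xi> k \<omega>"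
        "\<lambda>t. Z 0 \<omega> + (LINT s:{0..t}|lborel. a' s \<omega>) + I' t \<omega>" "\<lambda>t. Z t \<omega>"
      proof
        show "R 0 \<omega> = 0" "cadlag (\<lambda>t. real (R t \<omega>))"
          using poisson_R elim(3) by (auto simp: inhom_poisson_def)
        show "R s \<omega> \<le> R t \<omega>" if "0 \<le> s" "s \<le> t" for s t
          using poisson_R elim(3) that by (auto simp: inhom_poisson_def mono_on_def)
        show "continuous_on {0..} (\<lambda>t. Z 0 \<omega> + (LINT s:{0..t}|lborel. a' s \<omega>) + I' t \<omega>)"
          using I' elim(3) drift_continuous[OF coefficients(2) elim(3)]
          by (intro continuous_on_add continuous_on_const) (auto simp: ito_integral_def)
        show "Z t \<omega> = Z 0 \<omega> + (LINT s:{0..t}|lborel. a' s \<omega>) + I' t \<omega> + (\<Sum>i = 1..R t \<omega>. \<xi> i \<omega>)" if "0 \<le> t" for t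
          using elim(1)[rule_format, OF that] by (simp add: compound_def)
      qed
      have T: "cp.T k = arrival R k \<omega>" for k by (simp add: cp.T_def arrival_def)
      show ?case
      proof (intro allI impI)
        fix p t :: real assume pt: "0 \<le> p \<and> p < t"
        then have pt': "0 \<le> p" "p < t" "0 \<le> t" by auto
        have Zd: "Z t \<omega> - Z p \<omega> = continuous_part a' I' p t \<omega> + (compound R \<xi> t \<omega> - compound R \<xi> p \<omega>)"
          unfolding continuous_part_def
          using dr[OF coefficients(2) elim(3) pt'(1,2)] elim(1)[rule_format, OF pt'(1)]
            elim(1)[rule_format, OF pt'(3)] by linarith
        have Yd: "Y t \<omega> - Y p \<omega> = continuous_part a I p t \<omega> +
          ((\<Sum>\<^sub>\<infinity>s\<in>{0<..t}. (\<beta> + \<eta> s \<omega>) * jump (\<lambda>u. Z u \<omega>) s) - (\<Sum>\<^sub>\<infinity>s\<in>{0<..p}. (\<beta> + \<eta> s \<omega>) * jump (\<lambda>u. Z u \<omega>) s))"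
          unfolding continuous_part_def
          using dr[OF coefficients(1) elim(3) pt'(1,2)] elim(2)[rule_format, OF pt'(1)]
            elim(2)[rule_format, OF pt'(3)] by linarith
        show "(R t \<omega> = R p \<omega> \<longrightarrow> Z t \<omega> - Z p \<omega> = continuous_part a' I' p t \<omega> \<and>
            Y t \<omega> - Y p \<omega> = continuous_part a I p t \<omega>) \<and>
          (R t \<omega> = Suc (R p \<omega>) \<longrightarrow> Z t \<omega> - Z p \<omega> = continuous_part a' I' p t \<omega> + \<xi> (R t \<omega>) \<omega> \<and>
            Y t \<omega> - Y p \<omega> = continuous_part a I p t \<omega> + (\<beta> + noise (R t \<omega>) \<omega>) * \<xi> (R t \<omega>) \<omega>)"
        proof (intro conjI impI)
          assume eq: "R t \<omega> = R p \<omega>"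
          show "Z t \<omega> - Z p \<omega> = continuous_part a' I' p t \<omega>" using Zd eq by (simp add: compound_def)
          show "Y t \<omega> - Y p \<omega> = continuous_part a I p t \<omega>"
            using Yd cp.jump_sum_no_arrival[OF pt'(1,2) eq, of "\<lambda>s. \<beta> + \<eta> s \<omega>"] by simp
        next
          assume eq: "R t \<omega> = Suc (R p \<omega>)"
          show "Z t \<omega> - Z p \<omega> = continuous_part a' I' p t \<omega> + \<xi> (R t \<omega>) \<omega>" using Zd eq by (simp add: compound_def)
          show "Y t \<omega> - Y p \<omega> = continuous_part a I p t \<omega> + (\<beta> + noise (R t \<omega>) \<omega>) * \<xi> (R t \<omega>) \<omega>"
            using Yd cp.jump_sum_one_arrival[OF pt'(1,2) eq, of "\<lambda>s. \<beta> + \<eta> s \<omega>"] by (simp add: T noise_def)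
        qed
      qed
    qed
  qed
qed

end

section \<open>Counting exceedances\<close>

definition cnt :: "(nat \<Rightarrow> bool) \<Rightarrow> nat \<Rightarrow> nat" where
  "cnt e i = (\<Sum>j=1..i. of_bool (e j))"

text \<open>\<open>pick e n k x\<close> is \<open>x i\<close> for the \<open>k\<close>-th index \<open>i\<close> in \<open>{1..n}\<close> with \<open>e i\<close>, and 0 if there is none.\<close>

definition pick :: "(nat \<Rightarrow> bool) \<Rightarrow> nat \<Rightarrow> nat \<Rightarrow> (nat \<Rightarrow> real) \<Rightarrow> real" where
  "pick e n k x = (\<Sum>i=1..n. of_bool (e i \<and> cnt e i = k) * x i)"

lemma cnt_0 [simp]: "cnt e 0 = 0"
  by (simp add: cnt_def)

lemma cnt_Suc: "cnt e (Suc i) = cnt e i + of_bool (e (Suc i))"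
  by (simp add: cnt_def)

lemma cnt_mono: "i \<le> j \<Longrightarrow> cnt e i \<le> cnt e j"
  unfolding cnt_def by (rule sum_mono2) auto

lemma cnt_pos: "e i \<Longrightarrow> 1 \<le> i \<Longrightarrow> 1 \<le> cnt e i"
  by (cases i) (auto simp: cnt_Suc)

text \<open>Along the selected indices \<open>cnt\<close> runs through 1, 2, 3, ... without gaps or
  repetitions.\<close>

lemma sum_over_cnt: "(\<Sum>i=1..n. of_bool (e i) * g (cnt e i)) = (\<Sum>k=1..cnt e n. g k :: real)"
  by (induction n) (auto simp: cnt_Suc)

lemma pick_cong: "(\<And>i. 1 \<le> i \<Longrightarrow> i \<le> n \<Longrightarrow> e i = e' i) \<Longrightarrow> (\<And>i. 1 \<le> i \<Longrightarrow> i \<le> n \<Longrightarrow> e i \<Longrightarrow> x i = x' i) \<Longrightarrow>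
    pick e n k x = pick e' n k x'"
proof -
  assume e: "\<And>i. 1 \<le> i \<Longrightarrow> i \<le> n \<Longrightarrow> e i = e' i" and x: "\<And>i. 1 \<le> i \<Longrightarrow> i \<le> n \<Longrightarrow> e i \<Longrightarrow> x i = x' i"
  have "cnt e i = cnt e' i" if "i \<le> n" for i
    unfolding cnt_def using e that by (intro sum.cong) auto
  then show ?thesis unfolding pick_def using e x by (intro sum.cong) auto
qed

text \<open>At most one selected index carries the number \<open>k\<close>, so the bound is that of
  a single term.\<close>

lemma pick_bound:
  assumes "0 \<le> B" "\<And>i. 1 \<le> i \<Longrightarrow> i \<le> n \<Longrightarrow> e i \<Longrightarrow> \<bar>x i\<bar> \<le> B"
  shows "\<bar>pick e n k x\<bar> \<le> B"
proof -
  have "\<bar>pick e n k x\<bar> \<le> (\<Sum>i=1..n. \<bar>of_bool (e i \<and> cnt e i = k) * x i\<bar>)"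
    unfolding pick_def by (rule sum_abs)
  also have "\<dots> \<le> (\<Sum>i=1..n. of_bool (e i) * (B * of_bool (cnt e i = k)))"
    using assms by (intro sum_mono) auto
  also have "\<dots> = (\<Sum>l=1..cnt e n. B * of_bool (l = k))"
    by (rule sum_over_cnt)
  also have "\<dots> \<le> B"
    using assms(1) by (simp add: of_bool_def if_distrib[of "\<lambda>x. B * x"] sum.delta cong: if_cong)
  finally show ?thesis .
qed

text \<open>Changes a sum over time intervals into a sum over arrival numbers with the deterministic
  range \<open>m\<close>. In the second form the factor \<open>z k\<close> has a fixed index and can
  be separated from its random position.\<close>

lemma sum_pick:
  assumes "cnt e n \<le> m"
  shows "(\<Sum>k=1..m. z k * pick e n k x) = (\<Sum>i=1..n. of_bool (e i) * (z (cnt e i) * x i))"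
proof -
  have "(\<Sum>k=1..m. z k * pick e n k x) = (\<Sum>i=1..n. \<Sum>k=1..m. z k * (of_bool (e i \<and> cnt e i = k) * x i))"
    unfolding pick_def sum_distrib_left by (rule sum.swap)
  also have "\<dots> = (\<Sum>i=1..n. of_bool (e i) * (z (cnt e i) * x i))"
  proof (rule sum.cong[OF refl])
    fix i assume i: "i \<in> {1..n}"
    show "(\<Sum>k=1..m. z k * (of_bool (e i \<and> cnt e i = k) * x i)) = of_bool (e i) * (z (cnt e i) * x i)"
    proof (cases "e i")
      case True
      then have "cnt e i \<in> {1..m}" using i cnt_pos[of e i] cnt_mono[of i n e] assms by auto
      moreover have "(\<Sum>k=1..m. z k * (of_bool (e i \<and> cnt e i = k) * x i)) = (\<Sum>k=1..m. if cnt e i = k then z k * x i else 0)"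
        using True by (intro sum.cong) auto
      ultimately show ?thesis using True by (simp add: sum.delta')
    qed simp
  qed
  finally show ?thesis .
qed

lemma cnt_measurable:
  assumes "\<And>i. 1 \<le> i \<Longrightarrow> i \<le> j \<Longrightarrow> (\<lambda>\<omega>. e i \<omega>) \<in> measurable S (count_space UNIV)"
  shows "(\<lambda>\<omega>. cnt (\<lambda>i. e i \<omega>) j) \<in> measurable S (count_space UNIV)"
  unfolding cnt_def
proof (rule measurable_sum_nat)
  fix i assume "i \<in> {1..j}"
  then have [measurable]: "(\<lambda>\<omega>. e i \<omega>) \<in> measurable S (count_space UNIV)" using assms by simp
  show "(\<lambda>\<omega>. of_bool (e i \<omega>) :: nat) \<in> measurable S (count_space UNIV)" by measurable
qed

lemma pick_measurable:
  assumes e: "\<And>i. 1 \<le> i \<Longrightarrow> i \<le> n \<Longrightarrow> (\<lambda>\<omega>. e i \<omega>) \<in> measurable S (count_space UNIV)"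
    and x: "\<And>i. 1 \<le> i \<Longrightarrow> i \<le> n \<Longrightarrow> (\<lambda>\<omega>. x i \<omega>) \<in> borel_measurable S"
  shows "(\<lambda>\<omega>. pick (\<lambda>i. e i \<omega>) n k (\<lambda>i. x i \<omega>)) \<in> borel_measurable S"
  unfolding pick_def
proof (rule borel_measurable_sum)
  fix i assume "i \<in> {1..n}"
  then have [measurable]: "(\<lambda>\<omega>. e i \<omega>) \<in> measurable S (count_space UNIV)" "(\<lambda>\<omega>. x i \<omega>) \<in> borel_measurable S"
    "(\<lambda>\<omega>. cnt (\<lambda>i. e i \<omega>) i) \<in> measurable S (count_space UNIV)"
    using e x by (auto intro!: cnt_measurable)
  show "(\<lambda>\<omega>. of_bool (e i \<omega> \<and> cnt (\<lambda>i. e i \<omega>) i = k) * x i \<omega>) \<in> borel_measurable S"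
    by measurable
qed

text \<open>Counts the integers between \<open>p\<close> and \<open>q\<close>. This is the cost, in
  units of one noise variance, of replacing a random number of summands by a fixed one.\<close>

lemma sum_indicator_diff_square:
  assumes "p \<le> m" "q \<le> m"
  shows "(\<Sum>k=1..m. (of_bool (k \<le> p) - of_bool (k \<le> q))\<^sup>2 :: real) = \<bar>real p - real q\<bar>"
proof -
  have le: "(\<Sum>k=1..m. (of_bool (k \<le> p) - of_bool (k \<le> q))\<^sup>2 :: real) = real p - real q" if "q \<le> p" "p \<le> m" for p q
  proof -
    have "(\<Sum>k=1..m. (of_bool (k \<le> p) - of_bool (k \<le> q))\<^sup>2 :: real) = (\<Sum>k=1..m. of_bool (k \<in> {q<..p}))"
      using that by (intro sum.cong) auto
    also have "\<dots> = real (card {q<..p})"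
    proof -
      have "{Suc 0..m} \<inter> {k. q < k \<and> k \<le> p} = {q<..p}" using that by auto
      then show ?thesis by (simp add: of_bool_def sum.If_cases)
    qed
    finally show ?thesis using that by simp
  qed
  show ?thesis
  proof (cases "q \<le> p")
    case True then show ?thesis using le[of q p] assms by simp
  next
    case False
    then have "(\<Sum>k=1..m. (of_bool (k \<le> q) - of_bool (k \<le> p))\<^sup>2 :: real) = real q - real p"
      using le[of p q] assms by simp
    then show ?thesis using False by (simp add: power2_commute[of "of_bool (_ \<le> p)"])
  qed
qed

section \<open>Pathwise expansion of the estimation error\<close>

context
  fixes n m m0 :: nat and r :: "nat \<Rightarrow> nat" and z x D D' dY dZ :: "nat \<Rightarrow> real" and K d N \<kappa> \<beta> :: real
  assumes r0: "r 0 = 0"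
    and step: "\<And>i. 1 \<le> i \<Longrightarrow> i \<le> n \<Longrightarrow> r i = r (i - 1) \<or> r i = Suc (r (i - 1))"
    and none: "\<And>i. 1 \<le> i \<Longrightarrow> i \<le> n \<Longrightarrow> r i = r (i - 1) \<Longrightarrow> dZ i = D' i"
    and one: "\<And>i. 1 \<le> i \<Longrightarrow> i \<le> n \<Longrightarrow> r i = Suc (r (i - 1)) \<Longrightarrow>
      dZ i = D' i + x (r i) \<and> dY i = D i + (\<beta> + z (r i)) * x (r i)"
    and small: "\<And>i. 1 \<le> i \<Longrightarrow> i \<le> n \<Longrightarrow> \<bar>D i\<bar> \<le> d \<and> \<bar>D' i\<bar> \<le> d" and dK: "0 < d" "d < K"
    and big: "\<And>k. 1 \<le> k \<Longrightarrow> k \<le> m \<Longrightarrow> 2 * K < \<bar>x k\<bar>"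
    and rn: "r n \<le> m" and m0: "m0 \<le> m"
    and N: "1 \<le> N" "\<bar>real (r n) - N\<bar> \<le> \<kappa> * N" "\<kappa> \<le> 1 / 2"
begin

lemma r_mono_upto: "i \<le> j \<Longrightarrow> j \<le> n \<Longrightarrow> r i \<le> r j"
proof (induction j)
  case (Suc j)
  then show ?case using step[of "Suc j"] by (cases "i = Suc j") auto
qed simp

text \<open>The factor 2 in the lower bound for the marks leaves room for the continuous part: an
  increment with a jump exceeds \<open>2 * K - d\<close>, which is above \<open>K\<close>, while one
  without a jump is at most \<open>d\<close>.\<close>

lemma exceed_iff:
  assumes i: "1 \<le> i" "i \<le> n"
  shows "K < \<bar>dZ i\<bar> \<longleftrightarrow> r i = Suc (r (i - 1))"
proof -
  have D': "\<bar>D' i\<bar> \<le> d" using small[OF i] by simp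
  show ?thesis
  proof (cases "r i = Suc (r (i - 1))")
    case True
    then have "2 * K < \<bar>x (r i)\<bar>" using big[of "r i"] r_mono_upto[of i n] i rn by auto
    moreover have "dZ i = D' i + x (r i)" using one[OF i True] by simp
    ultimately have "K < \<bar>dZ i\<bar>" using D' dK by linarith
    then show ?thesis using True by simp
  next
    case False
    then have "dZ i = D' i" using step[OF i] none[OF i] by auto
    then show ?thesis using False D' dK by linarith
  qed
qed

lemma cnt_exceed: "i \<le> n \<Longrightarrow> cnt (\<lambda>i. K < \<bar>dZ i\<bar>) i = r i"
proof (induction i)
  case (Suc i)
  then show ?case using step[of "Suc i"] exceed_iff[of "Suc i"] by (auto simp: cnt_Suc)
qed (simp add: r0)

text \<open>The three remainders are the reweighted noise, the continuous parts multiplied by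
  reciprocal marks, and the quadratic error of replacing \<open>1 / dZ\<close> by a reciprocal mark.
  The first selects intervals by exceedances of \<open>dZ\<close>, the second by increments of
  \<open>r\<close>. Under the present hypotheses both selections agree, but the former is a function
  of \<open>Z\<close>, which is independent of the noise, and the latter of the arrival counts,
  which are independent of the marks.\<close>

lemma estimator_expansion:
  shows "\<bar>sqrt N * ((if (\<Sum>i=1..n. of_bool (\<bar>dZ i\<bar> > K)) > (0::real)
      then 1 / (\<Sum>i=1..n. of_bool (\<bar>dZ i\<bar> > K)) * (\<Sum>i=1..n. dY i / dZ i * of_bool (\<bar>dZ i\<bar> > K)) else 0) - \<beta>)
    - (\<Sum>k=1..m0. z k) / sqrt N\<bar> \<le>
    2 * \<kappa> * \<bar>(\<Sum>k=1..m0. z k) / sqrt N\<bar> +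
    2 / sqrt N * (\<bar>\<Sum>k=1..m. z k * (of_bool (k \<le> r n) - of_bool (k \<le> m0) - pick (\<lambda>i. K < \<bar>dZ i\<bar>) n k (\<lambda>i. D' i / dZ i))\<bar> +
      \<bar>\<Sum>k=1..m. of_bool (2 * K < \<bar>x k\<bar>) / x k * pick (\<lambda>i. r i = Suc (r (i - 1))) n k (\<lambda>i. D i - \<beta> * D' i)\<bar> +
      2 * (1 + \<bar>\<beta>\<bar>) * d\<^sup>2 * (\<Sum>k=1..m. (of_bool (2 * K < \<bar>x k\<bar>) / x k)\<^sup>2))"
proof -
  let ?e = "\<lambda>i. K < \<bar>dZ i\<bar>"
  define P where "P = real (r n)"
  define U where "U i = D i - \<beta> * D' i" for i
  define \<psi> where "\<psi> k = of_bool (2 * K < \<bar>x k\<bar>) / x k" for k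
  have cn: "cnt ?e n = r n" by (rule cnt_exceed) simp
  have num: "(\<Sum>i=1..n. of_bool (?e i)) = P"
    unfolding P_def cn[symmetric] cnt_def of_nat_sum by simp
  \<comment> \<open>The bound \<open>\<kappa> \<le> 1 / 2\<close> forces at least
    \<open>N / 2\<close> exceedances; in particular the estimator is not in its default
    branch.\<close>
  have "N - P \<le> N / 2" using N mult_right_mono[OF N(3), of N] unfolding P_def by linarith
  then have P: "N / 2 \<le> P" "0 < P" using N by auto
  have Pm: "cnt ?e n \<le> m" using cn rn by simp
  have Ub: "\<bar>U i\<bar> \<le> (1 + \<bar>\<beta>\<bar>) * d" if "1 \<le> i" "i \<le> n" for i
  proof -
    have "\<bar>U i\<bar> \<le> \<bar>D i\<bar> + \<bar>\<beta>\<bar> * \<bar>D' i\<bar>" unfolding U_def by (metis abs_mult abs_triangle_ineq4)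
    also have "\<dots> \<le> d + \<bar>\<beta>\<bar> * d" using small[OF that] by (intro add_mono mult_left_mono) auto
    finally show ?thesis by (simp add: algebra_simps)
  qed
  have cell: "dY i / dZ i - \<beta> = z (cnt ?e i) - z (cnt ?e i) * (D' i / dZ i) + \<psi> (cnt ?e i) * U i + U i * (1 / dZ i - \<psi> (cnt ?e i))"
    "\<bar>U i * (1 / dZ i - \<psi> (cnt ?e i))\<bar> \<le> 2 * (1 + \<bar>\<beta>\<bar>) * d\<^sup>2 * (\<psi> (cnt ?e i))\<^sup>2"
    if i: "1 \<le> i" "i \<le> n" and e: "?e i" for i
  proof -
    let ?k = "r i"
    have k: "cnt ?e i = ?k" using i cnt_exceed by simp
    have r: "r i = Suc (r (i - 1))" using exceed_iff[OF i] e by simp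
    have xk: "2 * K < \<bar>x ?k\<bar>" using big[of ?k] r r_mono_upto[of i n] i rn by auto
    have eq: "dZ i = D' i + x ?k" "dY i = D i + (\<beta> + z ?k) * x ?k" using one[OF i r] by auto
    have nz: "dZ i \<noteq> 0" "x ?k \<noteq> 0" using e xk dK by auto
    have ps: "\<psi> ?k = 1 / x ?k" using xk by (simp add: \<psi>_def)
    have "dY i - \<beta> * dZ i = z ?k * dZ i - z ?k * D' i + U i"
      unfolding eq U_def by (simp add: algebra_simps)
    moreover have "dY i / dZ i - \<beta> = (dY i - \<beta> * dZ i) / dZ i"
      using nz by (simp add: diff_divide_distrib)
    ultimately have "dY i / dZ i - \<beta> = z ?k - z ?k * (D' i / dZ i) + U i / dZ i"
      using nz by (simp only:) (simp add: add_divide_distrib diff_divide_distrib)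
    then show "dY i / dZ i - \<beta> = z (cnt ?e i) - z (cnt ?e i) * (D' i / dZ i) + \<psi> (cnt ?e i) * U i + U i * (1 / dZ i - \<psi> (cnt ?e i))"
      unfolding k by (simp add: algebra_simps)
    have half: "\<bar>x ?k\<bar> / 2 \<le> \<bar>dZ i\<bar>" using eq(1) small[OF i] dK xk by linarith
    \<comment> \<open>Since \<open>dZ\<close> differs from the mark by \<open>D'\<close> only, the
      two reciprocals differ by \<open>D'\<close> over the product, and \<open>half\<close> replaces
      \<open>dZ\<close> by the mark at the price of a factor 2.\<close>
    have "1 / dZ i - \<psi> ?k = - (D' i / (dZ i * x ?k))"
      unfolding ps using nz eq(1) by (simp add: field_simps)
    then have "\<bar>1 / dZ i - \<psi> ?k\<bar> = \<bar>D' i\<bar> / (\<bar>dZ i\<bar> * \<bar>x ?k\<bar>)" by (simp add: abs_mult)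
    also have "\<dots> \<le> d / (\<bar>x ?k\<bar> / 2 * \<bar>x ?k\<bar>)"
    proof (intro frac_le mult_right_mono half)
      show "0 < \<bar>x ?k\<bar> / 2 * \<bar>x ?k\<bar>" using nz(2) by (intro mult_pos_pos) auto
    qed (use small[OF i] dK in auto)
    also have "\<dots> = 2 * d * (\<psi> ?k)\<^sup>2"
      unfolding ps using nz by (simp add: power2_eq_square)
    finally have "\<bar>U i * (1 / dZ i - \<psi> ?k)\<bar> \<le> ((1 + \<bar>\<beta>\<bar>) * d) * (2 * d * (\<psi> ?k)\<^sup>2)"
      unfolding abs_mult using Ub[OF i] dK by (intro mult_mono) auto
    then show "\<bar>U i * (1 / dZ i - \<psi> (cnt ?e i))\<bar> \<le> 2 * (1 + \<bar>\<beta>\<bar>) * d\<^sup>2 * (\<psi> (cnt ?e i))\<^sup>2"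
      unfolding k by (simp add: power2_eq_square algebra_simps)
  qed
  define S0 B C1 C2 where "S0 = (\<Sum>k=1..m0. z k)"
    and "B = (\<Sum>k=1..m. z k * (of_bool (k \<le> r n) - of_bool (k \<le> m0) - pick ?e n k (\<lambda>i. D' i / dZ i)))"
    and "C1 = (\<Sum>k=1..m. \<psi> k * pick (\<lambda>i. r i = Suc (r (i - 1))) n k U)"
    and "C2 = (\<Sum>i=1..n. of_bool (?e i) * (U i * (1 / dZ i - \<psi> (cnt ?e i))))"
  \<comment> \<open>Both the random and the deterministic partial sum are written over the common
    range \<open>{1..m}\<close>, so that their difference becomes a weight on the noise.\<close>
  have upto: "(\<Sum>k=1..m. z k * of_bool (k \<le> q)) = (\<Sum>k=1..q. z k)" if "q \<le> m" for q
    using that by (intro sum.mono_neutral_cong_right) auto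
  have Beq: "B = (\<Sum>k=1..r n. z k) - S0 - (\<Sum>i=1..n. of_bool (?e i) * (z (cnt ?e i) * (D' i / dZ i)))"
    unfolding B_def S0_def upto[OF rn, symmetric] upto[OF m0, symmetric]
    by (simp only: right_diff_distrib sum_subtractf sum_pick[OF Pm])
  have pe: "pick (\<lambda>i. r i = Suc (r (i - 1))) n k U = pick ?e n k U" for k
    by (rule pick_cong) (use exceed_iff in auto)
  have C1eq: "C1 = (\<Sum>i=1..n. of_bool (?e i) * (\<psi> (cnt ?e i) * U i))"
    unfolding C1_def pe by (rule sum_pick[OF Pm])
  have Seq: "(\<Sum>k=1..r n. z k) = (\<Sum>i=1..n. of_bool (?e i) * z (cnt ?e i))"
    using sum_over_cnt[of ?e z n] unfolding cn by simp
  have A: "(\<Sum>i=1..n. dY i / dZ i * of_bool (?e i)) - \<beta> * P = S0 + B + C1 + C2"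
  proof -
    have "(\<Sum>i=1..n. dY i / dZ i * of_bool (?e i)) - \<beta> * P = (\<Sum>i=1..n. of_bool (?e i) * (dY i / dZ i - \<beta>))"
      unfolding num[symmetric] by (simp add: right_diff_distrib sum_subtractf sum_distrib_left mult.commute)
    also have "\<dots> = (\<Sum>i=1..n. of_bool (?e i) * z (cnt ?e i) - of_bool (?e i) * (z (cnt ?e i) * (D' i / dZ i)) +
        of_bool (?e i) * (\<psi> (cnt ?e i) * U i) + of_bool (?e i) * (U i * (1 / dZ i - \<psi> (cnt ?e i))))"
      using cell(1) by (intro sum.cong) auto
    also have "\<dots> = (\<Sum>i=1..n. of_bool (?e i) * z (cnt ?e i)) - (\<Sum>i=1..n. of_bool (?e i) * (z (cnt ?e i) * (D' i / dZ i))) + C1 + C2"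
      unfolding C1eq C2_def sum.distrib sum_subtractf ..
    also have "\<dots> = S0 + B + C1 + C2" unfolding Beq Seq by simp
    finally show ?thesis .
  qed
  have C2b: "\<bar>C2\<bar> \<le> 2 * (1 + \<bar>\<beta>\<bar>) * d\<^sup>2 * (\<Sum>k=1..m. (\<psi> k)\<^sup>2)"
  proof -
    have "\<bar>C2\<bar> \<le> (\<Sum>i=1..n. \<bar>of_bool (?e i) * (U i * (1 / dZ i - \<psi> (cnt ?e i)))\<bar>)"
      unfolding C2_def by (rule sum_abs)
    also have "\<dots> \<le> (\<Sum>i=1..n. of_bool (?e i) * (2 * (1 + \<bar>\<beta>\<bar>) * d\<^sup>2 * (\<psi> (cnt ?e i))\<^sup>2))"
      using cell(2) by (intro sum_mono) (auto simp del: abs_mult)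
    also have "\<dots> = (\<Sum>k=1..r n. 2 * (1 + \<bar>\<beta>\<bar>) * d\<^sup>2 * (\<psi> k)\<^sup>2)"
      unfolding sum_over_cnt[of ?e "\<lambda>k. 2 * (1 + \<bar>\<beta>\<bar>) * d\<^sup>2 * (\<psi> k)\<^sup>2"] cn ..
    also have "\<dots> \<le> (\<Sum>k=1..m. 2 * (1 + \<bar>\<beta>\<bar>) * d\<^sup>2 * (\<psi> k)\<^sup>2)"
      using rn by (intro sum_mono2) auto
    finally show ?thesis by (simp add: sum_distrib_left)
  qed
  have sN: "0 < sqrt N" "sqrt N * sqrt N = N" using N by auto
  \<comment> \<open>An identity: \<open>sqrt N / P\<close> equals \<open>N / P\<close> divided by
    \<open>sqrt N\<close>. The ratio \<open>N / P\<close> is at most 2 and, as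
    \<open>P \<ge> N / 2\<close>, within \<open>2 * \<kappa>\<close> of 1.\<close>
  have V: "sqrt N * (1 / P * (\<Sum>i=1..n. dY i / dZ i * of_bool (?e i)) - \<beta>) - S0 / sqrt N =
      (N / P - 1) * (S0 / sqrt N) + N / P * ((B + C1 + C2) / sqrt N)"
  proof -
    have "1 / P * (\<Sum>i=1..n. dY i / dZ i * of_bool (?e i)) - \<beta> = (S0 + B + C1 + C2) / P"
      using A P by (simp add: field_simps)
    moreover have "sqrt N * ((S0 + B + C1 + C2) / P) = N / P * ((S0 + B + C1 + C2) / sqrt N)"
      using sN P by (simp add: field_simps)
    ultimately show ?thesis by (simp only:) (simp add: add_divide_distrib algebra_simps)
  qed
  have NP: "N / P \<le> 2" "0 \<le> N / P" using P N by (auto simp: field_simps)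
  have NP1: "\<bar>N / P - 1\<bar> \<le> 2 * \<kappa>"
  proof -
    have "N / P - 1 = (N - P) / P" using P by (simp add: diff_divide_distrib)
    then have "\<bar>N / P - 1\<bar> = \<bar>P - N\<bar> / P" using P by (simp add: abs_minus_commute)
    also have "\<dots> \<le> \<kappa> * N / (N / 2)" using N P unfolding P_def by (intro frac_le) auto
    also have "\<dots> = 2 * \<kappa>" using N by simp
    finally show ?thesis .
  qed
  have "\<bar>(N / P - 1) * (S0 / sqrt N) + N / P * ((B + C1 + C2) / sqrt N)\<bar> \<le>
      \<bar>N / P - 1\<bar> * \<bar>S0 / sqrt N\<bar> + N / P * \<bar>(B + C1 + C2) / sqrt N\<bar>"
    using abs_triangle_ineq[of "(N / P - 1) * (S0 / sqrt N)" "N / P * ((B + C1 + C2) / sqrt N)"]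
    unfolding abs_mult abs_of_nonneg[OF NP(2)] .
  also have "\<dots> \<le> 2 * \<kappa> * \<bar>S0 / sqrt N\<bar> + 2 * (\<bar>B + C1 + C2\<bar> / sqrt N)"
    using NP NP1 sN(1) by (intro add_mono mult_mono) auto
  also have "\<dots> \<le> 2 * \<kappa> * \<bar>S0 / sqrt N\<bar> + 2 * ((\<bar>B\<bar> + \<bar>C1\<bar> + 2 * (1 + \<bar>\<beta>\<bar>) * d\<^sup>2 * (\<Sum>k=1..m. (\<psi> k)\<^sup>2)) / sqrt N)"
    using C2b sN(1) by (intro add_left_mono mult_left_mono divide_right_mono) auto
  finally have "\<bar>sqrt N * (1 / P * (\<Sum>i=1..n. dY i / dZ i * of_bool (?e i)) - \<beta>) - S0 / sqrt N\<bar> \<le>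
      2 * \<kappa> * \<bar>S0 / sqrt N\<bar> + 2 / sqrt N * (\<bar>B\<bar> + \<bar>C1\<bar> + 2 * (1 + \<bar>\<beta>\<bar>) * d\<^sup>2 * (\<Sum>k=1..m. (\<psi> k)\<^sup>2))"
    unfolding V by simp
  then show ?thesis
    unfolding num using P(2) unfolding S0_def B_def C1_def \<psi>_def U_def by simp
qed

end

section \<open>The estimator on one grid\<close>

context jump_regression
begin

section \<open>Noise at the arrivals and the arrival counts\<close>

lemma noise_eq: "(\<lambda>k \<omega>. \<eta> (arrival R k \<omega>) \<omega>) = noise"
  by (simp add: noise_def fun_eq_iff)

text \<open>Boundedness and moments are given for \<eta> at fixed times; equality in law with
  \<open>\<eta> 0\<close> carries them over to the random arrival times.\<close>

lemma noise_facts: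
  assumes k: "1 \<le> k"
  shows "random_variable borel (noise k)" "integrable M (\<lambda>\<omega>. (noise k \<omega>)\<^sup>2)"
    "expectation (noise k) = 0" "expectation (\<lambda>\<omega>. (noise k \<omega>)\<^sup>2) = \<sigma>\<^sub>\<eta>\<^sup>2"
    "distr M borel (noise k) = distr M borel (\<eta> 0)"
proof -
  have law: "distr M borel (noise k) = distr M borel (\<eta> 0)"
    using noise_at_jumps(2)[OF k] by (simp add: noise_def[abs_def])
  have [measurable]: "random_variable borel (\<eta> 0)"
    using noise_iid measurable_F[of "\<eta> 0" 0] by (simp add: iid_noise_def adapted_def)
  have nk[measurable]: "random_variable borel (noise k)"
    using noise_at_jumps(1) k unfolding noise_eq indep_vars_def2 by auto
  obtain C where "AE \<omega> in M. \<bar>\<eta> 0 \<omega>\<bar> \<le> C" using noise_iid by (auto simp: iid_noise_def)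
  then have "AE \<omega> in M. norm ((\<eta> 0 \<omega>)\<^sup>2) \<le> C\<^sup>2"
  proof eventually_elim
    case (elim \<omega>)
    then show ?case using abs_le_square_iff[of "\<eta> 0 \<omega>" C] by auto
  qed
  then have i0: "integrable M (\<lambda>\<omega>. (\<eta> 0 \<omega>)\<^sup>2)" by (intro integrable_const_bound) auto
  have e0: "expectation (\<eta> 0) = 0" "expectation (\<lambda>\<omega>. (\<eta> 0 \<omega>)\<^sup>2) = \<sigma>\<^sub>\<eta>\<^sup>2"
    using noise_iid by (auto simp: iid_noise_def)
  have tr: "integrable M (\<lambda>\<omega>. g (noise k \<omega>)) \<longleftrightarrow> integrable M (\<lambda>\<omega>. g (\<eta> 0 \<omega>))"
    "expectation (\<lambda>\<omega>. g (noise k \<omega>)) = expectation (\<lambda>\<omega>. g (\<eta> 0 \<omega>))"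
    if [measurable]: "g \<in> borel_measurable borel" for g :: "real \<Rightarrow> real"
    using integrable_distr_eq[of "noise k" M borel g] integrable_distr_eq[of "\<eta> 0" M borel g]
      integral_distr[of "noise k" M borel g] integral_distr[of "\<eta> 0" M borel g] law by simp_all
  show "random_variable borel (noise k)" "distr M borel (noise k) = distr M borel (\<eta> 0)" by fact+
  show "integrable M (\<lambda>\<omega>. (noise k \<omega>)\<^sup>2)" "expectation (noise k) = 0" "expectation (\<lambda>\<omega>. (noise k \<omega>)\<^sup>2) = \<sigma>\<^sub>\<eta>\<^sup>2"
    using tr(1)[of "\<lambda>x. x\<^sup>2"] tr(2)[of "\<lambda>x. x\<^sup>2"] tr(2)[of "\<lambda>x. x"] i0 e0 by auto
qed

lemma noise_orthogonal:
  assumes "1 \<le> k" "1 \<le> l" "k \<noteq> l"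
  shows "expectation (\<lambda>\<omega>. noise k \<omega> * noise l \<omega>) = 0"
  using assms noise_facts[of k] noise_facts[of l]
  by (intro indep_vars_orthogonal[OF noise_at_jumps(1)[unfolded noise_eq]])
    (auto intro: square_integrable_imp_integrable)

lemma R_measurable: "0 \<le> t \<Longrightarrow> R t \<in> measurable M (count_space UNIV)"
  using poisson_R by (auto simp: inhom_poisson_def)

lemma R_path: "\<omega> \<in> space M \<Longrightarrow> R 0 \<omega> = 0" "\<omega> \<in> space M \<Longrightarrow> 0 \<le> s \<Longrightarrow> s \<le> t \<Longrightarrow> R s \<omega> \<le> R t \<omega>"
  using poisson_R by (auto simp: inhom_poisson_def mono_on_def)

lemma R_increment:
  assumes "0 \<le> s" "s \<le> t"
  shows "0 \<le> (LINT u:{s..t}|lborel. lam u)"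
    and "prob {\<omega>\<in>space M. R t \<omega> - R s \<omega> = k} = (LINT u:{s..t}|lborel. lam u) ^ k / fact k * exp (- (LINT u:{s..t}|lborel. lam u))"
    and "(\<lambda>\<omega>. R t \<omega> - R s \<omega>) \<in> measurable M (count_space UNIV)"
proof -
  have lam: "\<And>u. 0 \<le> u \<Longrightarrow> 0 \<le> lam u" using poisson_R by (auto simp: inhom_poisson_def)
  show "0 \<le> (LINT u:{s..t}|lborel. lam u)"
    unfolding set_lebesgue_integral_def using lam assms
    by (intro Bochner_Integration.integral_nonneg) (auto simp: indicator_def)
  show "prob {\<omega>\<in>space M. R t \<omega> - R s \<omega> = k} = (LINT u:{s..t}|lborel. lam u) ^ k / fact k * exp (- (LINT u:{s..t}|lborel. lam u))"
    using poisson_R assms unfolding inhom_poisson_def Let_def by blast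
  have [measurable]: "R t \<in> measurable M (count_space UNIV)" "R s \<in> measurable M (count_space UNIV)"
    using R_measurable assms by auto
  show "(\<lambda>\<omega>. R t \<omega> - R s \<omega>) \<in> measurable M (count_space UNIV)" by measurable
qed

lemma R_concentration:
  assumes T: "0 \<le> T" and x: "0 < x"
  shows "{\<omega>\<in>space M. x \<le> \<bar>real (R T \<omega>) - (LINT u:{0..T}|lborel. lam u)\<bar>} \<in> events"
    and "prob {\<omega>\<in>space M. x \<le> \<bar>real (R T \<omega>) - (LINT u:{0..T}|lborel. lam u)\<bar>} \<le> (LINT u:{0..T}|lborel. lam u) / x\<^sup>2"
proof -
  let ?\<mu> = "LINT u:{0..T}|lborel. lam u"
  note [measurable] = R_measurable[OF T]
  note inc = R_increment[OF order_refl T]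
  have eq: "{\<omega>\<in>space M. R T \<omega> = k} = {\<omega>\<in>space M. R T \<omega> - R 0 \<omega> = k}" for k using R_path(1) by auto
  have sq: "integrable M (\<lambda>\<omega>. (real (R T \<omega>) - ?\<mu>)\<^sup>2)" "expectation (\<lambda>\<omega>. (real (R T \<omega>) - ?\<mu>)\<^sup>2) = ?\<mu>"
    using poisson_centered_square[OF R_measurable[OF T] inc(1)] inc(2) unfolding eq by auto
  show "{\<omega>\<in>space M. x \<le> \<bar>real (R T \<omega>) - ?\<mu>\<bar>} \<in> events" by measurable
  have "prob {\<omega>\<in>space M. x\<^sup>2 \<le> (real (R T \<omega>) - ?\<mu>)\<^sup>2} \<le> expectation (\<lambda>\<omega>. (real (R T \<omega>) - ?\<mu>)\<^sup>2) / x\<^sup>2"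
    using x by (intro integral_Markov_inequality_measure[where A="{}"] sq) auto
  moreover have "{\<omega>\<in>space M. x\<^sup>2 \<le> (real (R T \<omega>) - ?\<mu>)\<^sup>2} = {\<omega>\<in>space M. x \<le> \<bar>real (R T \<omega>) - ?\<mu>\<bar>}"
    using x abs_le_square_iff[of x] by auto
  ultimately show "prob {\<omega>\<in>space M. x \<le> \<bar>real (R T \<omega>) - ?\<mu>\<bar>} \<le> ?\<mu> / x\<^sup>2" using sq(2) by simp
qed

text \<open>The side of the model that is independent of the marks. It contains the arrival counts,
  but \<open>Z\<close> only at time 0, since later values involve marks.\<close>

definition others :: "'a set set" where
  "others = cylinders {0} Y \<union> cylinders {0} Z \<union> cylinders {0..} W \<union> cylinders {0..} W' \<union>
     cylinders {0..} a \<union> cylinders {0..} a' \<union> cylinders {0..} \<sigma> \<union> cylinders {0..} \<sigma>' \<union>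
     cylinders {0..} (\<lambda>t \<omega>. real (R t \<omega>)) \<union> cylinders {0..} \<eta>"

text \<open>The side that is independent of the noise at the jumps. It contains all of
  \<open>Z\<close>, hence the exceedances and their number.\<close>

definition observed :: "'a set set" where
  "observed = cylinders {0} Y \<union> cylinders {0..} Z \<union> cylinders {0..} W \<union> cylinders {0..} W' \<union>
     cylinders {0..} a \<union> cylinders {0..} a' \<union> cylinders {0..} \<sigma> \<union> cylinders {0..} \<sigma>' \<union>
     cylinders {0..} (compound R \<xi>)"

lemma marks_indep_others: "indep_gen (cylinders {1..} \<xi>) others"
  using marks_indep unfolding others_def .

lemma noise_indep_observed: "indep_gen (cylinders {1..} noise) observed"
  using noise_at_jumps(3) unfolding observed_def noise_eq .

section \<open>Comparison of characteristic functions for one fixed n\<close>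

lemma beta_hat_measurable:
  assumes d: "0 < \<Delta> n"
  shows "random_variable borel (\<lambda>\<omega>. beta_hat Y Z \<Delta> K n \<omega>)"
proof -
  have YZ: "random_variable borel (Y s)" "random_variable borel (Z s)" if "0 \<le> s" for s
    using adapted_YZ that measurable_F[of "Y s" s] measurable_F[of "Z s" s] by (auto simp: adapted_def)
  have inc: "(\<lambda>\<omega>. incr Y (\<Delta> n) i \<omega>) \<in> borel_measurable M" "(\<lambda>\<omega>. incr Z (\<Delta> n) i \<omega>) \<in> borel_measurable M"
    if "i \<in> {1..n}" for i
    unfolding incr_def using d that by (auto intro!: borel_measurable_diff YZ)
  have [measurable]: "random_variable borel (\<lambda>\<omega>. num_exceed Z \<Delta> K n \<omega>)"
    unfolding num_exceed_def
  proof (rule borel_measurable_sum)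
    fix i assume "i \<in> {1..n}"
    note [measurable] = inc[OF this]
    show "random_variable borel (\<lambda>\<omega>. of_bool (K n < \<bar>incr Z (\<Delta> n) i \<omega>\<bar>) :: real)" by measurable
  qed
  have [measurable]: "random_variable borel (\<lambda>\<omega>. \<Sum>i=1..n. incr Y (\<Delta> n) i \<omega> / incr Z (\<Delta> n) i \<omega> * of_bool (K n < \<bar>incr Z (\<Delta> n) i \<omega>\<bar>))"
  proof (rule borel_measurable_sum)
    fix i assume "i \<in> {1..n}"
    note [measurable] = inc[OF this]
    show "random_variable borel (\<lambda>\<omega>. incr Y (\<Delta> n) i \<omega> / incr Z (\<Delta> n) i \<omega> * of_bool (K n < \<bar>incr Z (\<Delta> n) i \<omega>\<bar>))"
      by measurable
  qed
  show ?thesis unfolding beta_hat_def by measurable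
qed

text \<open>An inequality without limits; the level \<delta> for the continuous parts, the tolerance
  \<kappa> and the bound \<open>L\<close> on the interval means are chosen later. The probabilities
  collected first belong to two arrivals in one interval, a large continuous part of
  \<open>Y\<close> or \<open>Z\<close>, an atypical number of arrivals, and a small mark. The terms
  multiplied by \<open>\<bar>t\<bar>\<close> bound the mean of the remainder \<open>X\<close> of
  \<open>estimator_expansion\<close>.\<close>

lemma char_bound:
  fixes \<Delta> K :: "nat \<Rightarrow> real" and n :: nat and N \<kappa> \<delta> L C Cf t \<Lambda> :: real
  defines "\<Lambda> \<equiv> LINT s:{0..real n * \<Delta> n}|lborel. lam s"
  assumes d: "0 < \<Delta> n"
    and C: "0 < C" "\<And>\<omega> u. \<omega> \<in> space M \<Longrightarrow> 0 \<le> u \<Longrightarrow> \<bar>a u \<omega>\<bar> \<le> C" "\<And>\<omega> u. \<omega> \<in> space M \<Longrightarrow> 0 \<le> u \<Longrightarrow> \<bar>a' u \<omega>\<bar> \<le> C"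
      "\<And>\<omega> u. \<omega> \<in> space M \<Longrightarrow> 0 \<le> u \<Longrightarrow> \<bar>\<sigma> u \<omega>\<bar> \<le> C" "\<And>\<omega> u. \<omega> \<in> space M \<Longrightarrow> 0 \<le> u \<Longrightarrow> \<bar>\<sigma>' u \<omega>\<bar> \<le> C"
    and \<delta>: "0 < \<delta>" "\<delta> < K n" "C * \<Delta> n \<le> \<delta> / 2"
    and f: "\<And>x. f (- x) = f x" "\<And>x. \<bar>f x\<bar> \<le> Cf * x\<^sup>2"
    and N: "1 \<le> N" "\<kappa> \<le> 1 / 2" "\<bar>\<Lambda> - N\<bar> < \<kappa> * N"
    and L: "\<And>i. 1 \<le> i \<Longrightarrow> i \<le> n \<Longrightarrow> (LINT s:{(real i - 1) * \<Delta> n..real i * \<Delta> n}|lborel. lam s) \<le> L"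
  shows "norm (char (distr M borel (\<lambda>\<omega>. sqrt N * (beta_hat Y Z \<Delta> K n \<omega> - \<beta>))) t -
      char (distr M borel (\<lambda>\<omega>. (\<Sum>k=1..nat \<lfloor>N\<rfloor>. noise k \<omega>) / sqrt N)) t) \<le>
    2 * (real n * L\<^sup>2 + 2 * (real n * (2 * exp (- \<delta>\<^sup>2 / (32 * C\<^sup>2 * \<Delta> n)))) +
      \<Lambda> / (\<kappa> * N - \<bar>\<Lambda> - N\<bar>)\<^sup>2 + 2 * N * (2 * Cf * (2 * K n) ^ 3)) +
    \<bar>t\<bar> * (2 * \<kappa> * \<bar>\<sigma>\<^sub>\<eta>\<bar> + 2 / sqrt N *
      (sqrt (\<sigma>\<^sub>\<eta>\<^sup>2 * (2 * (\<kappa> * N + 1) + 2 * (2 * N * (\<delta> / K n)\<^sup>2))) +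
       sqrt ((2 * Cf + 1) * (2 * N * ((1 + \<bar>\<beta>\<bar>) * \<delta>)\<^sup>2)) +
       2 * (1 + \<bar>\<beta>\<bar>) * \<delta>\<^sup>2 * (2 * N * (2 * Cf + 1))))"
    (is "_ \<le> 2 * ?pb + \<bar>t\<bar> * ?xb")
proof -
  let ?q = "2 * (\<kappa> * N + 1) + 2 * (2 * N * (\<delta> / K n)\<^sup>2)"
  let ?u = "2 * N * ((1 + \<bar>\<beta>\<bar>) * \<delta>)\<^sup>2"
  let ?g = "2 * exp (- \<delta>\<^sup>2 / (32 * C\<^sup>2 * \<Delta> n))"
  obtain I I' where I: "ito_integral W \<sigma> I" "ito_integral W' \<sigma>' I'"
    and inc: "AE \<omega> in M. \<forall>p t. 0 \<le> p \<and> p < t \<longrightarrow>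
      (R t \<omega> = R p \<omega> \<longrightarrow> Z t \<omega> - Z p \<omega> = continuous_part a' I' p t \<omega> \<and>
        Y t \<omega> - Y p \<omega> = continuous_part a I p t \<omega>) \<and>
      (R t \<omega> = Suc (R p \<omega>) \<longrightarrow> Z t \<omega> - Z p \<omega> = continuous_part a' I' p t \<omega> + \<xi> (R t \<omega>) \<omega> \<and>
        Y t \<omega> - Y p \<omega> = continuous_part a I p t \<omega> + (\<beta> + noise (R t \<omega>) \<omega>) * \<xi> (R t \<omega>) \<omega>)"
    using model_increments .
  define tt pp where "tt i = real i * \<Delta> n" and "pp i = (real i - 1) * \<Delta> n" for i
  have pt: "0 \<le> pp i" "pp i < tt i" "tt i - pp i = \<Delta> n" "pp i = tt (i - 1)" if "1 \<le> i" for i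
    using that d by (auto simp: tt_def pp_def algebra_simps of_nat_diff)
  have tt0: "0 \<le> tt i" for i using d by (simp add: tt_def)
  define Da Db where "Da i = continuous_part a I (pp i) (tt i)" and "Db i = continuous_part a' I' (pp i) (tt i)" for i
  define dY dZ where "dY i \<omega> = incr Y (\<Delta> n) i \<omega>" and "dZ i \<omega> = incr Z (\<Delta> n) i \<omega>" for i \<omega>
  have dYZ: "dY i \<omega> = Y (tt i) \<omega> - Y (pp i) \<omega>" "dZ i \<omega> = Z (tt i) \<omega> - Z (pp i) \<omega>" for i \<omega>
    by (simp_all add: dY_def dZ_def incr_def tt_def pp_def)
  have Kn: "0 < K n" using \<delta> by linarith
  have Cf: "0 \<le> Cf" using f(2)[of 1] by auto
  have \<kappa>: "0 < \<kappa>" "0 < \<kappa> * N" using N(1) N(3) zero_less_mult_pos2[of \<kappa> N] by (auto intro: order.strict_trans1[OF abs_ge_zero])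
  \<comment> \<open>On the good event the number of arrivals is at most \<open>3 / 2 * N\<close>, so
    the range \<open>m\<close> covers it with room for rounding.\<close>
  define m m0 where "m = nat \<lfloor>2 * N\<rfloor>" and "m0 = nat \<lfloor>N\<rfloor>"
  have mN: "real m \<le> 2 * N" "m0 \<le> m" "real m0 \<le> N" "N < real m0 + 1"
    using N(1) unfolding m_def m0_def by linarith+
  have mI: "q \<le> m" if "real q \<le> 2 * N" for q using that unfolding m_def by linarith

  have pows: "others \<subseteq> Pow (space M)" "observed \<subseteq> Pow (space M)"
    using indep_gen_Pow[OF marks_indep_others] indep_gen_Pow[OF noise_indep_observed] by auto
  \<comment> \<open>The continuous parts are replaced by almost surely equal functions of a Brownian
    motion and its coefficients, which are contained in \<open>others\<close>, and for
    \<open>Z\<close> also in \<open>observed\<close>.\<close>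
  have "\<exists>D\<in>borel_measurable (sigma (space M) (cylinders {0..} W \<union> cylinders {0..} a \<union> cylinders {0..} \<sigma>)). AE \<omega> in M. D \<omega> = Da i \<omega>"
    if "i \<in> {1..n}" for i
  proof -
    have i: "1 \<le> i" using that by simp
    show ?thesis unfolding Da_def
      by (rule continuous_part_version[OF brownian_W coefficients(1,3) I(1) pt(1,2)[OF i] subset_refl])
        (intro Un_least cylinders_subset_Pow)
  qed
  then obtain v where v: "\<And>i. i \<in> {1..n} \<Longrightarrow> v i \<in> borel_measurable (sigma (space M) (cylinders {0..} W \<union> cylinders {0..} a \<union> cylinders {0..} \<sigma>))"
    "\<And>i. i \<in> {1..n} \<Longrightarrow> AE \<omega> in M. v i \<omega> = Da i \<omega>" by metis
  have "\<exists>D\<in>borel_measurable (sigma (space M) (cylinders {0..} W' \<union> cylinders {0..} a' \<union> cylinders {0..} \<sigma>')). AE \<omega> in M. D \<omega> = Db i \<omega>"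
    if "i \<in> {1..n}" for i
  proof -
    have i: "1 \<le> i" using that by simp
    show ?thesis unfolding Db_def
      by (rule continuous_part_version[OF brownian_W' coefficients(2,4) I(2) pt(1,2)[OF i] subset_refl])
        (intro Un_least cylinders_subset_Pow)
  qed
  then obtain v' where v': "\<And>i. i \<in> {1..n} \<Longrightarrow> v' i \<in> borel_measurable (sigma (space M) (cylinders {0..} W' \<union> cylinders {0..} a' \<union> cylinders {0..} \<sigma>'))"
    "\<And>i. i \<in> {1..n} \<Longrightarrow> AE \<omega> in M. v' i \<omega> = Db i \<omega>" by metis
  have vm: "v i \<in> borel_measurable (sigma (space M) others)" "v' i \<in> borel_measurable (sigma (space M) others)"
    "v' i \<in> borel_measurable (sigma (space M) observed)" if "i \<in> {1..n}" for i
    using measurable_sigma_mono[OF v(1)[OF that] _ pows(1)] measurable_sigma_mono[OF v'(1)[OF that] _ pows(1)]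
      measurable_sigma_mono[OF v'(1)[OF that] _ pows(2)]
    unfolding others_def observed_def by auto
  have vAE: "AE \<omega> in M. \<forall>i\<in>{1..n}. v i \<omega> = Da i \<omega> \<and> v' i \<omega> = Db i \<omega>"
    using v(2) v'(2) by (intro AE_finite_allI AE_conjI) auto

  define e where "e \<omega> i \<longleftrightarrow> K n < \<bar>dZ i \<omega>\<bar>" for \<omega> i
  define ee where "ee \<omega> i \<longleftrightarrow> R (tt i) \<omega> = Suc (R (tt (i - 1)) \<omega>)" for \<omega> i
  \<comment> \<open>The truncations in \<open>H\<close> and \<open>U\<close> use only quantities
    from \<open>observed\<close> and \<open>others\<close>, respectively. They do nothing on the
    good event, but make the bounds \<open>HS\<close> and \<open>US\<close> valid for every
    outcome.\<close>
  define H where "H k \<omega> = of_bool (\<bar>real (cnt (e \<omega>) n) - N\<bar> \<le> \<kappa> * N) * (of_bool (k \<le> cnt (e \<omega>) n) - of_bool (k \<le> m0)) -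
    pick (e \<omega>) n k (\<lambda>i. of_bool (\<bar>v' i \<omega>\<bar> \<le> \<delta>) * (v' i \<omega> / dZ i \<omega>))" for k \<omega>
  define U where "U k \<omega> = pick (ee \<omega>) n k (\<lambda>i. of_bool (\<bar>v i \<omega>\<bar> \<le> \<delta> \<and> \<bar>v' i \<omega>\<bar> \<le> \<delta>) * (v i \<omega> - \<beta> * v' i \<omega>))" for k \<omega>
  define \<psi> where "\<psi> k \<omega> = of_bool (2 * K n < \<bar>\<xi> k \<omega>\<bar>) / \<xi> k \<omega>" for k \<omega>
  define S where "S \<omega> = (\<Sum>k=1..m0. noise k \<omega>) / sqrt N" for \<omega>
  define X1 X2 X3 where "X1 \<omega> = (\<Sum>k=1..m. noise k \<omega> * H k \<omega>)" and "X2 \<omega> = (\<Sum>k=1..m. \<psi> k \<omega> * U k \<omega>)"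
    and "X3 \<omega> = (\<Sum>k=1..m. (\<psi> k \<omega>)\<^sup>2)" for \<omega>
  define X where "X \<omega> = 2 * \<kappa> * \<bar>S \<omega>\<bar> + 2 / sqrt N * (\<bar>X1 \<omega>\<bar> + \<bar>X2 \<omega>\<bar> + 2 * (1 + \<bar>\<beta>\<bar>) * \<delta>\<^sup>2 * X3 \<omega>)" for \<omega>

  have Zm: "Z s \<in> borel_measurable (sigma (space M) observed)" if "0 \<le> s" for s
    by (rule measurable_cylinders[of "{0..}"]) (use that pows in \<open>auto simp: observed_def\<close>)
  have Rm: "(\<lambda>\<omega>. real (R s \<omega>)) \<in> borel_measurable (sigma (space M) others)" if "0 \<le> s" for s
    by (rule measurable_cylinders[of "{0..}" "\<lambda>t \<omega>. real (R t \<omega>)"]) (use that pows in \<open>auto simp: others_def\<close>)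
  have dZm: "dZ i \<in> borel_measurable (sigma (space M) observed)" if "1 \<le> i" for i
    unfolding dYZ[abs_def] using pt[OF that] tt0 by (intro borel_measurable_diff Zm) auto
  have em: "(\<lambda>\<omega>. e \<omega> i) \<in> measurable (sigma (space M) observed) (count_space UNIV)" if "1 \<le> i" for i
  proof -
    note [measurable] = dZm[OF that]
    show ?thesis unfolding e_def by measurable
  qed
  have eem: "(\<lambda>\<omega>. ee \<omega> i) \<in> measurable (sigma (space M) others) (count_space UNIV)" for i
  proof -
    note [measurable] = Rm[OF tt0[of i]] Rm[OF tt0[of "i - 1"]]
    have "(\<lambda>\<omega>. real (R (tt i) \<omega>) = real (R (tt (i - 1)) \<omega>) + 1) \<in> measurable (sigma (space M) others) (count_space UNIV)"
      by measurable
    moreover have "ee \<omega> i \<longleftrightarrow> real (R (tt i) \<omega>) = real (R (tt (i - 1)) \<omega>) + 1" for \<omega>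
      unfolding ee_def by linarith
    ultimately show ?thesis by simp
  qed
  have Hm: "H k \<in> borel_measurable (sigma (space M) observed)" for k
  proof -
    have [measurable]: "(\<lambda>\<omega>. cnt (e \<omega>) n) \<in> measurable (sigma (space M) observed) (count_space UNIV)"
      using cnt_measurable[of n "\<lambda>i \<omega>. e \<omega> i" "sigma (space M) observed"] em by simp
    have [measurable]: "(\<lambda>\<omega>. pick (e \<omega>) n k (\<lambda>i. of_bool (\<bar>v' i \<omega>\<bar> \<le> \<delta>) * (v' i \<omega> / dZ i \<omega>))) \<in> borel_measurable (sigma (space M) observed)"
    proof (rule pick_measurable)
      fix i assume i: "1 \<le> i" "i \<le> n"
      then have [measurable]: "v' i \<in> borel_measurable (sigma (space M) observed)" "dZ i \<in> borel_measurable (sigma (space M) observed)"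
        using vm(3)[of i] dZm by auto
      show "(\<lambda>\<omega>. e \<omega> i) \<in> measurable (sigma (space M) observed) (count_space UNIV)" using em i by simp
      show "(\<lambda>\<omega>. of_bool (\<bar>v' i \<omega>\<bar> \<le> \<delta>) * (v' i \<omega> / dZ i \<omega>)) \<in> borel_measurable (sigma (space M) observed)"
        by measurable
    qed
    show ?thesis unfolding H_def by measurable
  qed
  have Um: "U k \<in> borel_measurable (sigma (space M) others)" for k
    unfolding U_def
  proof (rule pick_measurable)
    fix i assume i: "1 \<le> i" "i \<le> n"
    then have [measurable]: "v i \<in> borel_measurable (sigma (space M) others)" "v' i \<in> borel_measurable (sigma (space M) others)"
      using vm(1,2)[of i] by auto
    show "(\<lambda>\<omega>. ee \<omega> i) \<in> measurable (sigma (space M) others) (count_space UNIV)" by (rule eem)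
    show "(\<lambda>\<omega>. of_bool (\<bar>v i \<omega>\<bar> \<le> \<delta> \<and> \<bar>v' i \<omega>\<bar> \<le> \<delta>) * (v i \<omega> - \<beta> * v' i \<omega>)) \<in> borel_measurable (sigma (space M) others)"
      by measurable
  qed
  have xim: "\<xi> k \<in> borel_measurable (sigma (space M) (cylinders {1..} \<xi>))" if "1 \<le> k" for k
    by (rule measurable_cylinders[of "{1..}"]) (use that cylinders_subset_Pow in auto)
  have \<psi>m: "\<psi> k \<in> borel_measurable (sigma (space M) (cylinders {1..} \<xi>))" if "1 \<le> k" for k
  proof -
    note [measurable] = xim[OF that]
    show ?thesis unfolding \<psi>_def by measurable
  qed
  have nm: "noise k \<in> borel_measurable (sigma (space M) (cylinders {1..} noise))" if "1 \<le> k" for k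
    by (rule measurable_cylinders[of "{1..}"]) (use that cylinders_subset_Pow in auto)

  have pickb: "\<bar>pick (e \<omega>) n k (\<lambda>i. of_bool (\<bar>v' i \<omega>\<bar> \<le> \<delta>) * (v' i \<omega> / dZ i \<omega>))\<bar> \<le> \<delta> / K n" for k \<omega>
  proof (rule pick_bound)
    fix i assume "e \<omega> i"
    then have "K n < \<bar>dZ i \<omega>\<bar>" by (simp add: e_def)
    then show "\<bar>of_bool (\<bar>v' i \<omega>\<bar> \<le> \<delta>) * (v' i \<omega> / dZ i \<omega>)\<bar> \<le> \<delta> / K n"
      using \<delta> Kn by (cases "\<bar>v' i \<omega>\<bar> \<le> \<delta>") (auto simp: abs_mult intro!: frac_le)
  qed (use \<delta> Kn in auto)
  have dK1: "\<delta> / K n \<le> 1" using \<delta> Kn by simp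
  have Hb: "\<bar>H k \<omega>\<bar> \<le> 2" for k \<omega>
  proof -
    have "\<bar>of_bool (\<bar>real (cnt (e \<omega>) n) - N\<bar> \<le> \<kappa> * N) * (of_bool (k \<le> cnt (e \<omega>) n) - of_bool (k \<le> m0) :: real)\<bar> \<le> 1"
      by auto
    then show ?thesis using pickb[of \<omega> k] dK1 unfolding H_def by linarith
  qed
  \<comment> \<open>The mismatch between the number of exceedances and \<open>m0\<close> contributes
    at most \<open>\<kappa> * N + 1\<close>, the 1 being the rounding of \<open>m0\<close>; each of
    the \<open>m\<close> picked ratios contributes at most the square of
    \<open>\<delta> / K n\<close>.\<close>
  have HS: "(\<Sum>k=1..m. (H k \<omega>)\<^sup>2) \<le> ?q" for \<omega>
  proof -
    let ?P = "cnt (e \<omega>) n"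
    let ?A = "\<lambda>k. of_bool (\<bar>real ?P - N\<bar> \<le> \<kappa> * N) * (of_bool (k \<le> ?P) - of_bool (k \<le> m0)) :: real"
    have "(H k \<omega>)\<^sup>2 \<le> 2 * (?A k)\<^sup>2 + 2 * (\<delta> / K n)\<^sup>2" for k
    proof -
      have 1: "(x - y)\<^sup>2 \<le> 2 * x\<^sup>2 + 2 * y\<^sup>2" for x y :: real
      proof -
        have "0 \<le> (x + y)\<^sup>2" by simp
        then show ?thesis by (simp add: power2_eq_square algebra_simps)
      qed
      have 2: "(pick (e \<omega>) n k (\<lambda>i. of_bool (\<bar>v' i \<omega>\<bar> \<le> \<delta>) * (v' i \<omega> / dZ i \<omega>)))\<^sup>2 \<le> (\<delta> / K n)\<^sup>2"
        using power_mono[OF pickb[of \<omega> k] abs_ge_zero, of 2] by simp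
      show ?thesis unfolding H_def by (rule order_trans[OF 1]) (use 2 in linarith)
    qed
    then have "(\<Sum>k=1..m. (H k \<omega>)\<^sup>2) \<le> (\<Sum>k=1..m. 2 * (?A k)\<^sup>2 + 2 * (\<delta> / K n)\<^sup>2)" by (intro sum_mono)
    also have "\<dots> = 2 * (\<Sum>k=1..m. (?A k)\<^sup>2) + 2 * (real m * (\<delta> / K n)\<^sup>2)"
      by (simp add: sum.distrib sum_distrib_left)
    also have "(\<Sum>k=1..m. (?A k)\<^sup>2) \<le> \<kappa> * N + 1"
    proof (cases "\<bar>real ?P - N\<bar> \<le> \<kappa> * N")
      case True
      have "\<kappa> * N \<le> 1 / 2 * N" using N by (intro mult_right_mono) auto
      then have "real ?P \<le> 2 * N" using True N(1) by linarith
      then have "?P \<le> m" by (rule mI)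
      then have "(\<Sum>k=1..m. (?A k)\<^sup>2) = \<bar>real ?P - real m0\<bar>"
        using True sum_indicator_diff_square[of ?P m m0] mN(2) by simp
      then show ?thesis using True mN(3,4) by linarith
    qed (use \<kappa> in simp)
    also have "real m * (\<delta> / K n)\<^sup>2 \<le> 2 * N * (\<delta> / K n)\<^sup>2" using mN by (intro mult_right_mono) auto
    finally show ?thesis by simp
  qed
  have Ub: "\<bar>U k \<omega>\<bar> \<le> (1 + \<bar>\<beta>\<bar>) * \<delta>" for k \<omega>
    unfolding U_def
  proof (rule pick_bound)
    fix i
    show "\<bar>of_bool (\<bar>v i \<omega>\<bar> \<le> \<delta> \<and> \<bar>v' i \<omega>\<bar> \<le> \<delta>) * (v i \<omega> - \<beta> * v' i \<omega>)\<bar> \<le> (1 + \<bar>\<beta>\<bar>) * \<delta>"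
    proof (cases "\<bar>v i \<omega>\<bar> \<le> \<delta> \<and> \<bar>v' i \<omega>\<bar> \<le> \<delta>")
      case True
      have "\<bar>v i \<omega> - \<beta> * v' i \<omega>\<bar> \<le> \<bar>v i \<omega>\<bar> + \<bar>\<beta>\<bar> * \<bar>v' i \<omega>\<bar>" by (metis abs_mult abs_triangle_ineq4)
      also have "\<dots> \<le> \<delta> + \<bar>\<beta>\<bar> * \<delta>" using True by (intro add_mono mult_left_mono) auto
      finally show ?thesis using True by (simp add: algebra_simps)
    next
      case False
      then show ?thesis using \<delta>(1) by (auto simp: of_bool_def)
    qed
  qed (use \<delta> in auto)
  have US: "(\<Sum>k=1..m. (U k \<omega>)\<^sup>2) \<le> ?u" for \<omega>
  proof -
    have "(\<Sum>k=1..m. (U k \<omega>)\<^sup>2) \<le> (\<Sum>k=1..m. ((1 + \<bar>\<beta>\<bar>) * \<delta>)\<^sup>2)"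
      using power_mono[OF Ub abs_ge_zero, where n=2] by (intro sum_mono) simp
    also have "\<dots> = real m * ((1 + \<bar>\<beta>\<bar>) * \<delta>)\<^sup>2" by simp
    also have "\<dots> \<le> ?u" using mN by (intro mult_right_mono) auto
    finally show ?thesis .
  qed

  \<comment> \<open>This bound explodes as the threshold tends to 0 and serves integrability only;
    the uniform second moment is \<open>\<psi>E\<close>.\<close>
  have \<psi>b: "\<bar>\<psi> k \<omega>\<bar> \<le> 1 / (2 * K n)" for k \<omega>
    using Kn unfolding \<psi>_def by (auto simp: of_bool_def intro!: frac_le)
  have \<psi>M: "random_variable borel (\<psi> k)" "random_variable borel (\<xi> k)" if "1 \<le> k" for k
    using indep_gen_measurable(1)[OF marks_indep_others] \<psi>m[OF that] xim[OF that] by auto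
  have \<psi>2: "integrable M (\<lambda>\<omega>. (\<psi> k \<omega>)\<^sup>2)" "integrable M (\<psi> k)" if "1 \<le> k" for k
  proof -
    show "integrable M (\<psi> k)" by (rule bounded_integrable[OF \<psi>M(1)[OF that] \<psi>b])
    show "integrable M (\<lambda>\<omega>. (\<psi> k \<omega>)\<^sup>2)"
      using \<psi>M(1)[OF that] power_mono[OF \<psi>b abs_ge_zero, where n=2]
      by (intro bounded_integrable[where C="(1 / (2 * K n))\<^sup>2"]) auto
  qed
  have \<psi>E: "expectation (\<lambda>\<omega>. (\<psi> k \<omega>)\<^sup>2) \<le> 2 * Cf + 1" "expectation (\<psi> k) = 0" if "1 \<le> k" for k
    using reciprocal_mark_square[OF marks_density[OF that] density_nonneg f(2), of "2 * K n"]
      reciprocal_mark_mean[OF marks_density[OF that] density_nonneg f(2) f(1), of "2 * K n"] Kn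
    unfolding \<psi>_def by auto
  have "indep_vars (\<lambda>_. borel) (\<lambda>k \<omega>. of_bool (2 * K n < \<bar>\<xi> k \<omega>\<bar>) / \<xi> k \<omega>) {1..}"
    by (rule indep_vars_compose2[OF marks_iid, where Y="\<lambda>_ x. of_bool (2 * K n < \<bar>x\<bar>) / x"]) measurable
  then have \<psi>iv: "indep_vars (\<lambda>_. borel) \<psi> {1..}" unfolding \<psi>_def[abs_def] .
  have \<psi>o: "expectation (\<lambda>\<omega>. \<psi> k \<omega> * \<psi> l \<omega>) = 0" if "1 \<le> k" "1 \<le> l" "k \<noteq> l" for k l
    using that \<psi>2 \<psi>E by (intro indep_vars_orthogonal[OF \<psi>iv]) auto

  note HM = indep_gen_measurable(2)[OF noise_indep_observed Hm]
  note UM = indep_gen_measurable(2)[OF marks_indep_others Um]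
  have X1m: "random_variable borel X1" unfolding X1_def using noise_facts(1) HM by (intro borel_measurable_sum borel_measurable_times) auto
  have X2m: "random_variable borel X2" unfolding X2_def using \<psi>M(1) UM by (intro borel_measurable_sum borel_measurable_times) auto
  have X1b: "integrable M X1" "expectation (\<lambda>\<omega>. \<bar>X1 \<omega>\<bar>) \<le> sqrt (\<sigma>\<^sub>\<eta>\<^sup>2 * ?q)"
  proof -
    have os: "integrable M (\<lambda>\<omega>. (X1 \<omega>)\<^sup>2)" "expectation (\<lambda>\<omega>. (X1 \<omega>)\<^sup>2) \<le> \<sigma>\<^sub>\<eta>\<^sup>2 * expectation (\<lambda>\<omega>. \<Sum>k=1..m. (H k \<omega>)\<^sup>2)"
      unfolding X1_def using noise_facts noise_orthogonal Hb nm Hm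
      by - (rule indep_gen_orthogonal_sum[OF noise_indep_observed, where B=2 and c="\<sigma>\<^sub>\<eta>\<^sup>2"]; simp)+
    have "expectation (\<lambda>\<omega>. \<Sum>k=1..m. (H k \<omega>)\<^sup>2) \<le> ?q"
      by (intro integral_le_const bounded_integrable[where C="?q"])
        (use HM HS in \<open>auto intro!: borel_measurable_sum borel_measurable_power simp: sum_nonneg\<close>)
    then have "expectation (\<lambda>\<omega>. (X1 \<omega>)\<^sup>2) \<le> \<sigma>\<^sub>\<eta>\<^sup>2 * ?q"
      by (intro order_trans[OF os(2)] mult_left_mono) auto
    from expectation_abs_le_sqrt[OF X1m os(1) this] show "integrable M X1"
      "expectation (\<lambda>\<omega>. \<bar>X1 \<omega>\<bar>) \<le> sqrt (\<sigma>\<^sub>\<eta>\<^sup>2 * ?q)" by auto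
  qed
  have X2b: "integrable M X2" "expectation (\<lambda>\<omega>. \<bar>X2 \<omega>\<bar>) \<le> sqrt ((2 * Cf + 1) * ?u)"
  proof -
    have os: "integrable M (\<lambda>\<omega>. (X2 \<omega>)\<^sup>2)" "expectation (\<lambda>\<omega>. (X2 \<omega>)\<^sup>2) \<le> (2 * Cf + 1) * expectation (\<lambda>\<omega>. \<Sum>k=1..m. (U k \<omega>)\<^sup>2)"
      unfolding X2_def using \<psi>2 \<psi>E \<psi>o Ub \<psi>m Um
      by - (rule indep_gen_orthogonal_sum[OF marks_indep_others, where B="(1 + \<bar>\<beta>\<bar>) * \<delta>" and c="2 * Cf + 1"]; simp)+
    have "expectation (\<lambda>\<omega>. \<Sum>k=1..m. (U k \<omega>)\<^sup>2) \<le> ?u"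
      by (intro integral_le_const bounded_integrable[where C="?u"])
        (use UM US in \<open>auto intro!: borel_measurable_sum borel_measurable_power simp: sum_nonneg\<close>)
    then have "expectation (\<lambda>\<omega>. (X2 \<omega>)\<^sup>2) \<le> (2 * Cf + 1) * ?u"
      using Cf by (intro order_trans[OF os(2)] mult_left_mono) auto
    from expectation_abs_le_sqrt[OF X2m os(1) this] show "integrable M X2"
      "expectation (\<lambda>\<omega>. \<bar>X2 \<omega>\<bar>) \<le> sqrt ((2 * Cf + 1) * ?u)" by auto
  qed
  have X3b: "integrable M X3" "expectation X3 \<le> 2 * N * (2 * Cf + 1)"
  proof -
    show "integrable M X3" unfolding X3_def using \<psi>2 by (intro Bochner_Integration.integrable_sum) auto
    have "expectation X3 = (\<Sum>k=1..m. expectation (\<lambda>\<omega>. (\<psi> k \<omega>)\<^sup>2))"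
      unfolding X3_def using \<psi>2 by (intro Bochner_Integration.integral_sum) auto
    also have "\<dots> \<le> (\<Sum>k=1..m. 2 * Cf + 1)" using \<psi>E by (intro sum_mono) auto
    also have "\<dots> = real m * (2 * Cf + 1)" by simp
    also have "\<dots> \<le> 2 * N * (2 * Cf + 1)" using mN Cf by (intro mult_right_mono) auto
    finally show "expectation X3 \<le> 2 * N * (2 * Cf + 1)" .
  qed
  have sN: "0 < sqrt N" using N by simp
  have Smeas: "random_variable borel S"
    unfolding S_def using noise_facts(1) by (intro borel_measurable_divide borel_measurable_sum) auto
  have Sb: "integrable M S" "expectation (\<lambda>\<omega>. \<bar>S \<omega>\<bar>) \<le> \<bar>\<sigma>\<^sub>\<eta>\<bar>"
  proof -
    have os: "integrable M (\<lambda>\<omega>. (\<Sum>k=1..m0. noise k \<omega>)\<^sup>2)" "expectation (\<lambda>\<omega>. (\<Sum>k=1..m0. noise k \<omega>)\<^sup>2) \<le> \<sigma>\<^sub>\<eta>\<^sup>2 * real (card {1..m0})"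
      using noise_facts noise_orthogonal by - (rule orthogonal_sum[where c="\<sigma>\<^sub>\<eta>\<^sup>2"]; simp)+
    have S2: "(S \<omega>)\<^sup>2 = (\<Sum>k=1..m0. noise k \<omega>)\<^sup>2 / N" for \<omega> using N by (simp add: S_def power_divide)
    have "expectation (\<lambda>\<omega>. (\<Sum>k=1..m0. noise k \<omega>)\<^sup>2) \<le> \<sigma>\<^sub>\<eta>\<^sup>2 * N"
      using os(2) mult_left_mono[OF mN(3), of "\<sigma>\<^sub>\<eta>\<^sup>2"] by simp
    then have "expectation (\<lambda>\<omega>. (S \<omega>)\<^sup>2) \<le> \<sigma>\<^sub>\<eta>\<^sup>2" "integrable M (\<lambda>\<omega>. (S \<omega>)\<^sup>2)"
      unfolding S2 using os(1) N by (auto simp: pos_divide_le_eq)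
    from expectation_abs_le_sqrt[OF Smeas this(2,1)] show "integrable M S" "expectation (\<lambda>\<omega>. \<bar>S \<omega>\<bar>) \<le> \<bar>\<sigma>\<^sub>\<eta>\<bar>" by auto
  qed
  have X0: "0 \<le> X \<omega>" for \<omega>
    unfolding X_def X3_def using \<kappa> sN by (intro add_nonneg_nonneg mult_nonneg_nonneg sum_nonneg) auto
  have Xi: "integrable M X"
    unfolding X_def[abs_def] using Sb(1) X1b(1) X2b(1) X3b(1) by simp
  have XE: "expectation X \<le> ?xb"
  proof -
    have "expectation X = 2 * \<kappa> * expectation (\<lambda>\<omega>. \<bar>S \<omega>\<bar>) + 2 / sqrt N * (expectation (\<lambda>\<omega>. \<bar>X1 \<omega>\<bar>) + expectation (\<lambda>\<omega>. \<bar>X2 \<omega>\<bar>) +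
        2 * (1 + \<bar>\<beta>\<bar>) * \<delta>\<^sup>2 * expectation X3)"
      unfolding X_def[abs_def] using Sb(1) X1b(1) X2b(1) X3b(1) by simp
    also have "\<dots> \<le> ?xb"
      using \<kappa> sN by (intro add_mono mult_left_mono Sb X1b X2b X3b) auto
    finally show ?thesis .
  qed

  let ?J = "{1..n}"
  let ?x = "\<kappa> * N - \<bar>\<Lambda> - N\<bar>"
  define E1 E2 E3 where "E1 i = {\<omega>\<in>space M. 2 \<le> R (tt i) \<omega> - R (pp i) \<omega>}"
    and "E2 i = {\<omega>\<in>space M. \<delta> < \<bar>Da i \<omega>\<bar>}" and "E3 i = {\<omega>\<in>space M. \<delta> < \<bar>Db i \<omega>\<bar>}" for i
  \<comment> \<open>\<open>E4\<close> allows the fluctuation that the tolerance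
    \<open>\<kappa> * N\<close> leaves after the deterministic gap between \<Lambda> and
    \<open>N\<close>. \<open>E5\<close> is posed for all of the first \<open>m\<close> marks, so
    that its probability does not involve the random number of arrivals.\<close>
  define E4 E5 where "E4 = {\<omega>\<in>space M. ?x \<le> \<bar>real (R (tt n) \<omega>) - \<Lambda>\<bar>}"
    and "E5 k = {\<omega>\<in>space M. \<bar>\<xi> k \<omega>\<bar> \<le> 2 * K n}" for k
  define Bad where "Bad = (\<Union>i\<in>?J. E1 i) \<union> (\<Union>i\<in>?J. E2 i) \<union> (\<Union>i\<in>?J. E3 i) \<union> E4 \<union> (\<Union>k\<in>{1..m}. E5 k)"
  have E1: "E1 i \<in> events" "prob (E1 i) \<le> L\<^sup>2" if "i \<in> ?J" for i
  proof -
    have i: "1 \<le> i" "i \<le> n" using that by auto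
    note ri = R_increment[OF pt(1)[OF i(1)] less_imp_le[OF pt(2)[OF i(1)]]]
    note [measurable] = ri(3)
    show "E1 i \<in> events" unfolding E1_def by measurable
    have "prob (E1 i) \<le> (LINT u:{pp i..tt i}|lborel. lam u)\<^sup>2"
      unfolding E1_def by (rule poisson_prob_ge_2[OF ri(3,1,2)])
    also have "\<dots> \<le> L\<^sup>2" using L[OF i] ri(1) unfolding tt_def pp_def by (intro power_mono) auto
    finally show "prob (E1 i) \<le> L\<^sup>2" .
  qed
  have E23: "E2 i \<in> events" "prob (E2 i) \<le> ?g"
    "E3 i \<in> events" "prob (E3 i) \<le> ?g" if "i \<in> ?J" for i
  proof -
    have i: "1 \<le> i" using that by auto
    have Cd: "C * (tt i - pp i) \<le> \<delta> / 2" using pt(3)[OF i] \<delta>(3) by simp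
    show "E2 i \<in> events" "prob (E2 i) \<le> ?g"
      using continuous_part_tail[OF brownian_W coefficients(1,3) I(1) pt(1,2)[OF i] C(1,4,2) \<delta>(1) Cd]
      unfolding E2_def Da_def pt(3)[OF i] by auto
    show "E3 i \<in> events" "prob (E3 i) \<le> ?g"
      using continuous_part_tail[OF brownian_W' coefficients(2,4) I(2) pt(1,2)[OF i] C(1,5,3) \<delta>(1) Cd]
      unfolding E3_def Db_def pt(3)[OF i] by auto
  qed
  have x0: "0 < ?x" using N(3) by linarith
  have \<Lambda>: "(LINT u:{0..tt n}|lborel. lam u) = \<Lambda>" unfolding \<Lambda>_def tt_def ..
  have E4: "E4 \<in> events" "prob E4 \<le> \<Lambda> / ?x\<^sup>2"
    using R_concentration[OF tt0[of n] x0] unfolding E4_def \<Lambda> by blast+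
  have E5: "E5 k \<in> events" "prob (E5 k) \<le> 2 * Cf * (2 * K n) ^ 3" if "k \<in> {1..m}" for k
  proof -
    have k: "1 \<le> k" using that by simp
    note [measurable] = \<psi>M(2)[OF k]
    show "E5 k \<in> events" unfolding E5_def by measurable
    show "prob (E5 k) \<le> 2 * Cf * (2 * K n) ^ 3"
      unfolding E5_def using Kn by (intro prob_small_mark[OF marks_density[OF k] density_nonneg f(2)]) auto
  qed
  have ev: "(\<Union>i\<in>?J. E1 i) \<in> events" "(\<Union>i\<in>?J. E2 i) \<in> events" "(\<Union>i\<in>?J. E3 i) \<in> events" "(\<Union>k\<in>{1..m}. E5 k) \<in> events"
    using E1(1) E23(1,3) E5(1) by (auto intro!: sets.finite_UN)
  have BadE: "Bad \<in> events" unfolding Bad_def using ev E4(1) by blast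
  have PB: "prob Bad \<le> ?pb"
  proof -
    have "prob Bad \<le> prob (\<Union>i\<in>?J. E1 i) + prob (\<Union>i\<in>?J. E2 i) + prob (\<Union>i\<in>?J. E3 i) + prob E4 + prob (\<Union>k\<in>{1..m}. E5 k)"
      unfolding Bad_def using ev E4(1)
      by (intro order_trans[OF measure_Un_le] add_mono order_refl sets.Un)
    also have "prob (\<Union>i\<in>?J. E1 i) \<le> real n * L\<^sup>2" using prob_UN_le[of ?J E1 "L\<^sup>2"] E1 by simp
    also have "prob (\<Union>i\<in>?J. E2 i) \<le> real n * ?g"
      using prob_UN_le[of ?J E2 ?g] E23 by simp
    also have "prob (\<Union>i\<in>?J. E3 i) \<le> real n * ?g"
      using prob_UN_le[of ?J E3 ?g] E23 by simp
    also have "prob E4 \<le> \<Lambda> / ?x\<^sup>2" by (rule E4)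
    also have "prob (\<Union>k\<in>{1..m}. E5 k) \<le> real m * (2 * Cf * (2 * K n) ^ 3)"
      using prob_UN_le[of "{1..m}" E5 "2 * Cf * (2 * K n) ^ 3"] E5 by simp
    also have "\<dots> \<le> 2 * N * (2 * Cf * (2 * K n) ^ 3)" using mN Cf Kn by (intro mult_right_mono) auto
    finally show ?thesis by simp
  qed

  define V where "V \<omega> = sqrt N * (beta_hat Y Z \<Delta> K n \<omega> - \<beta>)" for \<omega>
  have Vm: "random_variable borel V"
    unfolding V_def using beta_hat_measurable[where \<Delta>=\<Delta> and n=n and K=K] d by measurable
  have bound: "AE \<omega> in M. \<omega> \<in> space M - Bad \<longrightarrow> \<bar>V \<omega> - S \<omega>\<bar> \<le> X \<omega>"
    using inc vAE
  proof eventually_elim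
    case (elim \<omega>)
    show ?case
    proof
      assume "\<omega> \<in> space M - Bad"
      then have \<omega>: "\<omega> \<in> space M" and g1: "\<And>i. i \<in> ?J \<Longrightarrow> \<not> 2 \<le> R (tt i) \<omega> - R (pp i) \<omega>"
        and g2: "\<And>i. i \<in> ?J \<Longrightarrow> \<bar>Da i \<omega>\<bar> \<le> \<delta>" "\<And>i. i \<in> ?J \<Longrightarrow> \<bar>Db i \<omega>\<bar> \<le> \<delta>"
        and g4: "\<bar>real (R (tt n) \<omega>) - \<Lambda>\<bar> < ?x" and g5: "\<And>k. k \<in> {1..m} \<Longrightarrow> 2 * K n < \<bar>\<xi> k \<omega>\<bar>"
        unfolding Bad_def E1_def E2_def E3_def E4_def E5_def by (auto simp: not_le not_less)
      define r where "r i = R (tt i) \<omega>" for i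
      have rN: "\<bar>real (r n) - N\<bar> \<le> \<kappa> * N" using g4 unfolding r_def by linarith
      have "\<kappa> * N \<le> 1 / 2 * N" using N by (intro mult_right_mono) auto
      then have rm: "r n \<le> m" using rN N(1) by (intro mI) linarith
      have r0: "r 0 = 0" using R_path(1)[OF \<omega>] by (simp add: r_def tt_def)
      have step: "r i = r (i - 1) \<or> r i = Suc (r (i - 1))" if "1 \<le> i" "i \<le> n" for i
        using g1[of i] R_path(2)[OF \<omega>, of "pp i" "tt i"] pt[OF that(1)] that unfolding r_def by auto
      have incs: "r i = r (i - 1) \<Longrightarrow> dZ i \<omega> = Db i \<omega>"
        "r i = Suc (r (i - 1)) \<Longrightarrow> dZ i \<omega> = Db i \<omega> + \<xi> (r i) \<omega> \<and> dY i \<omega> = Da i \<omega> + (\<beta> + noise (r i) \<omega>) * \<xi> (r i) \<omega>"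
        if "1 \<le> i" "i \<le> n" for i
        using elim(1)[rule_format, of "pp i" "tt i"] pt[OF that(1)] unfolding r_def dYZ Da_def Db_def by auto
      have small: "\<bar>Da i \<omega>\<bar> \<le> \<delta> \<and> \<bar>Db i \<omega>\<bar> \<le> \<delta>" if "1 \<le> i" "i \<le> n" for i
        using g2[of i] that by auto
      have big: "2 * K n < \<bar>\<xi> k \<omega>\<bar>" if "1 \<le> k" "k \<le> m" for k using g5 that by auto
      note asm = r0 step incs small \<delta>(1,2) big rm
      have cn: "cnt (e \<omega>) n = r n"
        unfolding e_def[abs_def]
        by (rule cnt_exceed[where m=m and x="\<lambda>k. \<xi> k \<omega>" and z="\<lambda>k. noise k \<omega>" and \<beta>=\<beta> and D="\<lambda>i. Da i \<omega>" and D'="\<lambda>i. Db i \<omega>" and d=\<delta> and dY="\<lambda>i. dY i \<omega>" and N=N and \<kappa>=\<kappa> and ?m0.0=m0])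
          (fact asm mN(2) N rN order_refl)+
      have Heq: "H k \<omega> = of_bool (k \<le> r n) - of_bool (k \<le> m0) - pick (\<lambda>i. K n < \<bar>dZ i \<omega>\<bar>) n k (\<lambda>i. Db i \<omega> / dZ i \<omega>)" for k
      proof -
        have "pick (e \<omega>) n k (\<lambda>i. of_bool (\<bar>v' i \<omega>\<bar> \<le> \<delta>) * (v' i \<omega> / dZ i \<omega>)) = pick (\<lambda>i. K n < \<bar>dZ i \<omega>\<bar>) n k (\<lambda>i. Db i \<omega> / dZ i \<omega>)"
          by (rule pick_cong) (use elim(2) small in \<open>auto simp: e_def\<close>)
        then show ?thesis unfolding H_def cn using rN by simp
      qed
      have Ueq: "U k \<omega> = pick (\<lambda>i. r i = Suc (r (i - 1))) n k (\<lambda>i. Da i \<omega> - \<beta> * Db i \<omega>)" for k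
        unfolding U_def by (rule pick_cong) (use elim(2) small in \<open>auto simp: ee_def r_def\<close>)
      have "\<bar>sqrt N * ((if (\<Sum>i=1..n. of_bool (\<bar>dZ i \<omega>\<bar> > K n)) > (0::real)
          then 1 / (\<Sum>i=1..n. of_bool (\<bar>dZ i \<omega>\<bar> > K n)) * (\<Sum>i=1..n. dY i \<omega> / dZ i \<omega> * of_bool (\<bar>dZ i \<omega>\<bar> > K n)) else 0) - \<beta>)
        - (\<Sum>k=1..m0. noise k \<omega>) / sqrt N\<bar> \<le>
        2 * \<kappa> * \<bar>(\<Sum>k=1..m0. noise k \<omega>) / sqrt N\<bar> +
        2 / sqrt N * (\<bar>\<Sum>k=1..m. noise k \<omega> * (of_bool (k \<le> r n) - of_bool (k \<le> m0) - pick (\<lambda>i. K n < \<bar>dZ i \<omega>\<bar>) n k (\<lambda>i. Db i \<omega> / dZ i \<omega>))\<bar> +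
          \<bar>\<Sum>k=1..m. of_bool (2 * K n < \<bar>\<xi> k \<omega>\<bar>) / \<xi> k \<omega> * pick (\<lambda>i. r i = Suc (r (i - 1))) n k (\<lambda>i. Da i \<omega> - \<beta> * Db i \<omega>)\<bar> +
          2 * (1 + \<bar>\<beta>\<bar>) * \<delta>\<^sup>2 * (\<Sum>k=1..m. (of_bool (2 * K n < \<bar>\<xi> k \<omega>\<bar>) / \<xi> k \<omega>)\<^sup>2))"
        by (rule estimator_expansion[where r=r and z="\<lambda>k. noise k \<omega>" and x="\<lambda>k. \<xi> k \<omega>" and dY="\<lambda>i. dY i \<omega>" and dZ="\<lambda>i. dZ i \<omega>"
              and D="\<lambda>i. Da i \<omega>" and D'="\<lambda>i. Db i \<omega>"])
          (fact asm mN(2) N rN)+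
      then show "\<bar>V \<omega> - S \<omega>\<bar> \<le> X \<omega>"
        unfolding X_def X1_def X2_def X3_def S_def \<psi>_def Heq Ueq V_def beta_hat_def num_exceed_def dY_def dZ_def .
    qed
  qed
  have "norm (char (distr M borel V) t - char (distr M borel S) t) \<le> 2 * prob (space M - (space M - Bad)) + \<bar>t\<bar> * expectation X"
    using bound X0 BadE by (intro char_distr_diff_le Vm Smeas Xi) auto
  also have "space M - (space M - Bad) = Bad" using sets.sets_into_space[OF BadE] by auto
  also have "2 * prob Bad + \<bar>t\<bar> * expectation X \<le> 2 * ?pb +
    \<bar>t\<bar> * ?xb"
    using PB XE by (intro add_mono mult_left_mono) auto
  finally show ?thesis unfolding V_def S_def m0_def .
qed

end

section \<open>Asymptotics\<close>

text \<open>The mesh condition bounds n by a small multiple of the power -2 of \<Delta>. The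
  exponential beats any power, and \<open>k\<close> is chosen with \<open>k * q > 2\<close> so that
  its \<open>k\<close>-th power absorbs this factor.\<close>

lemma mesh_exp_tail:
  fixes \<Delta> :: "nat \<Rightarrow> real"
  assumes pos: "\<And>n. 0 < \<Delta> n" and lim: "\<Delta> \<longlonglongrightarrow> 0" and nD: "(\<lambda>n. real n * (\<Delta> n)\<^sup>2) \<longlonglongrightarrow> 0"
    and c: "0 < c" and q: "0 < q"
  shows "(\<lambda>n. real n * exp (- (c * \<Delta> n powr (- q)))) \<longlonglongrightarrow> 0"
proof -
  obtain k :: nat where k: "2 < real k * q"
    using reals_Archimedean3[OF q] by auto
  define x where "x n = c * \<Delta> n powr (- q)" for n
  have pw: "(\<lambda>n. \<Delta> n powr p) \<longlonglongrightarrow> 0" if "0 < p" for p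
    using that pos lim by (intro tendsto_zero_powrI[OF _ tendsto_const]) (auto intro: always_eventually less_imp_le)
  have xt: "filterlim x at_top sequentially"
  proof -
    have "filterlim (\<lambda>n. inverse (\<Delta> n powr q)) at_top sequentially"
    proof (rule filterlim_inverse_at_top[OF pw[OF q]])
      show "eventually (\<lambda>n. 0 < \<Delta> n powr q) sequentially"
        using pos by (intro always_eventually allI) (metis less_irrefl powr_gt_zero)
    qed
    then show ?thesis unfolding x_def
      using c pos by (intro filterlim_tendsto_pos_mult_at_top[OF tendsto_const]) (auto simp: powr_minus)
  qed
  have "(\<lambda>n. x n ^ k / exp (x n)) \<longlonglongrightarrow> 0"
    by (rule filterlim_compose[OF tendsto_power_div_exp_0 xt])
  moreover have "(\<lambda>n. (real n * (\<Delta> n)\<^sup>2) * (\<Delta> n powr (real k * q - 2) / c ^ k)) \<longlonglongrightarrow> 0 * (0 / c ^ k)"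
    using k by (intro tendsto_mult tendsto_divide nD pw tendsto_const) (use c in auto)
  ultimately have "(\<lambda>n. (real n * (\<Delta> n)\<^sup>2) * (\<Delta> n powr (real k * q - 2) / c ^ k) * (x n ^ k / exp (x n))) \<longlonglongrightarrow> 0"
    using tendsto_mult[of _ 0 _ _ 0] by fastforce
  moreover have "(real n * (\<Delta> n)\<^sup>2) * (\<Delta> n powr (real k * q - 2) / c ^ k) * (x n ^ k / exp (x n)) = real n * exp (- x n)" for n
  proof -
    have 1: "x n ^ k = c ^ k * \<Delta> n powr (- (real k * q))"
      unfolding x_def power_mult_distrib using pos[of n] by (simp add: powr_power mult.commute)
    have 2: "(\<Delta> n)\<^sup>2 = \<Delta> n powr 2" using pos[of n] by simp
    have "(\<Delta> n)\<^sup>2 * \<Delta> n powr (real k * q - 2) * \<Delta> n powr (- (real k * q)) = 1"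
      unfolding 2 powr_add[symmetric] using pos[of n] by simp
    then show ?thesis unfolding 1 using c by (simp add: exp_minus field_simps)
  qed
  ultimately show ?thesis by (simp add: x_def)
qed

text \<open>Adding 1 to \<open>l\<close> creates the strict inequality that a limsup needs to yield
  an eventual bound.\<close>

lemma limsup_sup_bound:
  fixes \<Delta> :: "nat \<Rightarrow> real" and J :: "nat \<Rightarrow> nat \<Rightarrow> real"
  assumes pos: "\<And>n. 0 < \<Delta> n" and le: "limsup (\<lambda>n. SUP i\<in>{1..n}. ereal (1 / \<Delta> n * J n i)) \<le> ereal l"
  shows "eventually (\<lambda>n. \<forall>i\<in>{1..n}. J n i \<le> (l + 1) * \<Delta> n) sequentially"
proof -
  have "limsup (\<lambda>n. SUP i\<in>{1..n}. ereal (1 / \<Delta> n * J n i)) < ereal (l + 1)"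
    by (rule le_less_trans[OF le]) simp
  then have "eventually (\<lambda>n. (SUP i\<in>{1..n}. ereal (1 / \<Delta> n * J n i)) < ereal (l + 1)) sequentially"
    by (rule Limsup_lessD)
  then show ?thesis
  proof eventually_elim
    case (elim n)
    show ?case
    proof
      fix i assume "i \<in> {1..n}"
      then have "ereal (1 / \<Delta> n * J n i) \<le> (SUP i\<in>{1..n}. ereal (1 / \<Delta> n * J n i))" by (rule SUP_upper)
      then have "ereal (1 / \<Delta> n * J n i) < ereal (l + 1)" using elim by (rule le_less_trans)
      then show "J n i \<le> (l + 1) * \<Delta> n" using pos[of n] by (simp add: pos_divide_less_eq less_imp_le)
    qed
  qed
qed

text \<open>Given \<open>char_bound\<close>, it remains to choose its parameters as functions of the
  mesh and of \<open>N\<close> such that every term vanishes; Levy's continuity theorem then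
  transfers the limit of the normalized noise sums to the estimator.\<close>

theorem theorem3p8:
  fixes M :: "'a measure" and F :: "real \<Rightarrow> 'a measure"
    and W W' a a' \<sigma> \<sigma>' \<eta> Y Z :: "real \<Rightarrow> 'a \<Rightarrow> real"
    and R :: "real \<Rightarrow> 'a \<Rightarrow> nat" and \<xi> :: "nat \<Rightarrow> 'a \<Rightarrow> real"
    and lam f :: "real \<Rightarrow> real" and \<sigma>\<^sub>\<eta> \<beta> lam_star lam_bar \<delta> expo :: real
    and \<Delta> K N :: "nat \<Rightarrow> real"
  assumes model: "jump_regression M F W W' a a' \<sigma> \<sigma>' R lam \<xi> f \<eta> \<sigma>\<^sub>\<eta> \<beta> Y Z"
    and intensity_local: "0 < lam_star"
      "limsup (\<lambda>n. SUP i\<in>{1..n}.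
         ereal (1 / \<Delta> n * (LINT s:{(real i - 1) * \<Delta> n..real i * \<Delta> n}|lborel. lam s))) \<le> ereal lam_star"
    and intensity_mean: "0 < lam_bar"
      "((\<lambda>x. 1 / x * (LINT s:{0..x}|lborel. lam s)) \<longlongrightarrow> lam_bar) at_top"
    and density_smooth: "\<And>j x. j < 3 \<Longrightarrow> (deriv ^^ j) f differentiable (at x)"
    and density_even: "\<And>x. f (- x) = f x"
    and density_zero: "f 0 = 0"
    and marks_moment: "0 < \<delta>" "\<And>i. 1 \<le> i \<Longrightarrow> integrable M (\<lambda>\<omega>. \<bar>\<xi> i \<omega>\<bar> powr (2 + \<delta>))"
    and density_derivs: "\<And>j. j \<le> 3 \<Longrightarrow> bounded (range ((deriv ^^ j) f))"
      "\<And>j. j \<le> 3 \<Longrightarrow> integrable lborel ((deriv ^^ j) f)"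
    and mesh: "\<And>n. 0 < \<Delta> n" "\<Delta> \<longlonglongrightarrow> 0"
      "filterlim (\<lambda>n. real n * \<Delta> n) at_top sequentially"
      "(\<lambda>n. real n * (\<Delta> n)\<^sup>2) \<longlonglongrightarrow> 0"
    and exponent: "1 / 3 < expo" "expo < 1 / 2"
    and threshold: "\<And>n. K n = \<Delta> n powr expo"
    and rate: "\<And>n. N n = real n * \<Delta> n * lam_bar"
  shows "weak_conv_m
      (\<lambda>n. distr M borel (\<lambda>\<omega>. sqrt (N n) * (beta_hat Y Z \<Delta> K n \<omega> - \<beta>)))
      (normal_law 0 (\<sigma>\<^sub>\<eta>\<^sup>2))"
proof -
  obtain Cf where Cf: "0 \<le> Cf" "\<And>x. \<bar>f x\<bar> \<le> Cf * x\<^sup>2"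
  proof (rule even_density_quadratic_bound)
    show "(deriv ^^ j) f differentiable (at x)" if "j < 2" for j x using density_smooth[of j x] that by simp
    show "bounded (range ((deriv ^^ 2) f))" by (rule density_derivs(1)) simp
  qed (use density_even density_zero in auto)
  interpret jump_regression M F W W' a a' \<sigma> \<sigma>' R lam \<xi> f \<eta> \<sigma>\<^sub>\<eta> \<beta> Y Z by (rule model)
  note pos = mesh(1)
  have pw: "(\<lambda>n. \<Delta> n powr p) \<longlonglongrightarrow> 0" if "0 < p" for p
    using that pos mesh(2) by (intro tendsto_zero_powrI[OF _ tendsto_const]) (auto intro: always_eventually less_imp_le)

  have cb: "\<exists>C. \<forall>\<omega>\<in>space M. \<forall>u\<ge>0. \<bar>X u \<omega>\<bar> \<le> C" if "bounded_cadlag X" for X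
    using that by (auto simp: bounded_cadlag_def)
  obtain C1 C2 C3 C4 where C14: "\<forall>\<omega>\<in>space M. \<forall>u\<ge>0. \<bar>a u \<omega>\<bar> \<le> C1" "\<forall>\<omega>\<in>space M. \<forall>u\<ge>0. \<bar>a' u \<omega>\<bar> \<le> C2"
    "\<forall>\<omega>\<in>space M. \<forall>u\<ge>0. \<bar>\<sigma> u \<omega>\<bar> \<le> C3" "\<forall>\<omega>\<in>space M. \<forall>u\<ge>0. \<bar>\<sigma>' u \<omega>\<bar> \<le> C4"
    using cb[OF coefficients(1)] cb[OF coefficients(2)] cb[OF coefficients(3)] cb[OF coefficients(4)] by blast
  \<comment> \<open>The leading 1 keeps \<open>C\<close> positive even if all coefficients
    vanish.\<close>
  define C where "C = 1 + \<bar>C1\<bar> + \<bar>C2\<bar> + \<bar>C3\<bar> + \<bar>C4\<bar>"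
  have C0: "0 < C" "C1 \<le> C" "C2 \<le> C" "C3 \<le> C" "C4 \<le> C" unfolding C_def by linarith+
  have C: "\<bar>a u \<omega>\<bar> \<le> C" "\<bar>a' u \<omega>\<bar> \<le> C" "\<bar>\<sigma> u \<omega>\<bar> \<le> C" "\<bar>\<sigma>' u \<omega>\<bar> \<le> C" if "\<omega> \<in> space M" "0 \<le> u" for u \<omega>
    using C14 C0 that by (meson order_trans)+

  \<comment> \<open>Any exponent strictly in between would do. The lower bound \<open>expo\<close>
    gives \<open>h / K\<close> tending to 0, the upper bound \<open>1 / 2\<close> lets
    \<open>h\<close> dominate both drift and Brownian fluctuation over one interval, and
    \<open>1 / 3 < \<alpha>\<close> supplies \<open>4 * \<alpha> > 1\<close> for
    \<open>t8\<close>.\<close>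
  define \<alpha> where "\<alpha> = (expo + 1 / 2) / 2"
  have \<alpha>: "expo < \<alpha>" "\<alpha> < 1 / 2" "1 / 3 < \<alpha>" using exponent by (auto simp: \<alpha>_def)
  define h where "h n = \<Delta> n powr \<alpha>" for n
  define \<Lambda> where "\<Lambda> n = (LINT s:{0..real n * \<Delta> n}|lborel. lam s)" for n
  \<comment> \<open>The second summand leaves room for Chebyshev's inequality, see \<open>gap\<close>.\<close>
  define \<kappa> where "\<kappa> n = \<bar>\<Lambda> n / N n - 1\<bar> + N n powr (- 1 / 4)" for n
  define L where "L n = (lam_star + 1) * \<Delta> n" for n

  have Ntop: "filterlim N at_top sequentially"
    unfolding rate[abs_def]
    by (rule filterlim_at_top_mult_tendsto_pos[OF tendsto_const intensity_mean(1) mesh(3)])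
  have N1: "eventually (\<lambda>n. 1 \<le> N n) sequentially" using Ntop by (simp add: filterlim_at_top)
  have Ninv: "(\<lambda>n. N n powr (- p)) \<longlonglongrightarrow> 0" if "0 < p" for p
    using that by (intro tendsto_neg_powr Ntop) auto
  have \<Lambda>N: "(\<lambda>n. \<Lambda> n / N n) \<longlonglongrightarrow> 1"
  proof -
    have "(\<lambda>n. 1 / (real n * \<Delta> n) * \<Lambda> n) \<longlonglongrightarrow> lam_bar"
      unfolding \<Lambda>_def using filterlim_compose[OF intensity_mean(2) mesh(3)] .
    then have "(\<lambda>n. 1 / (real n * \<Delta> n) * \<Lambda> n / lam_bar) \<longlonglongrightarrow> lam_bar / lam_bar"
      using intensity_mean(1) by (intro tendsto_divide tendsto_const) auto
    then show ?thesis using intensity_mean(1) by (simp add: rate field_simps)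
  qed
  have \<kappa>0: "\<kappa> \<longlonglongrightarrow> 0"
  proof -
    have "(\<lambda>n. \<bar>\<Lambda> n / N n - 1\<bar> + N n powr (- (1 / 4))) \<longlonglongrightarrow> \<bar>1 - 1\<bar> + 0"
      by (intro tendsto_add tendsto_rabs tendsto_diff tendsto_const \<Lambda>N Ninv) simp
    then show ?thesis by (simp add: \<kappa>_def[abs_def])
  qed
  \<comment> \<open>The Poisson standard deviation is of order \<open>sqrt N\<close>, so a deviation
    of \<open>N powr (3 / 4)\<close> has vanishing probability, and it is still negligible against
    \<open>N\<close>.\<close>
  have gap: "\<kappa> n * N n - \<bar>\<Lambda> n - N n\<bar> = N n powr (3 / 4)" if "1 \<le> N n" for n
  proof -
    have "\<bar>\<Lambda> n / N n - 1\<bar> * N n = \<bar>\<Lambda> n - N n\<bar>"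
    proof -
      have "\<Lambda> n / N n - 1 = (\<Lambda> n - N n) / N n" using that by (simp add: diff_divide_distrib)
      then show ?thesis using that by (simp add: abs_divide)
    qed
    moreover have "N n powr (- 1 / 4) * N n = N n powr (3 / 4)"
      using that powr_add[of "N n" "- 1 / 4" 1] by simp
    ultimately show ?thesis unfolding \<kappa>_def distrib_right by linarith
  qed
  have nD: "(\<lambda>n. real n * (\<Delta> n)\<^sup>2 * \<Delta> n powr p) \<longlonglongrightarrow> 0" if "0 < p" for p
    using tendsto_mult[OF mesh(4) pw[OF that]] by simp

  define B where "B t n = 2 * (real n * (L n)\<^sup>2 + 2 * (real n * (2 * exp (- (h n)\<^sup>2 / (32 * C\<^sup>2 * \<Delta> n)))) +
      \<Lambda> n / (\<kappa> n * N n - \<bar>\<Lambda> n - N n\<bar>)\<^sup>2 + 2 * N n * (2 * Cf * (2 * K n) ^ 3)) +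
    \<bar>t\<bar> * (2 * \<kappa> n * \<bar>\<sigma>\<^sub>\<eta>\<bar> + 2 / sqrt (N n) *
      (sqrt (\<sigma>\<^sub>\<eta>\<^sup>2 * (2 * (\<kappa> n * N n + 1) + 2 * (2 * N n * (h n / K n)\<^sup>2))) +
       sqrt ((2 * Cf + 1) * (2 * N n * ((1 + \<bar>\<beta>\<bar>) * h n)\<^sup>2)) +
       2 * (1 + \<bar>\<beta>\<bar>) * (h n)\<^sup>2 * (2 * N n * (2 * Cf + 1))))" for t n
  let ?V = "\<lambda>n \<omega>. sqrt (N n) * (beta_hat Y Z \<Delta> K n \<omega> - \<beta>)"
  let ?S = "\<lambda>n \<omega>. (\<Sum>k=1..nat \<lfloor>N n\<rfloor>. noise k \<omega>) / sqrt (N n)"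

  have small: "eventually (\<lambda>n. C * \<Delta> n \<le> h n / 2) sequentially"
  proof -
    have "(\<lambda>n. C * \<Delta> n powr (1 - \<alpha>)) \<longlonglongrightarrow> C * 0" using \<alpha> by (intro tendsto_mult tendsto_const pw) auto
    then have "eventually (\<lambda>n. C * \<Delta> n powr (1 - \<alpha>) < 1 / 2) sequentially" by (intro order_tendstoD) auto
    then show ?thesis
    proof eventually_elim
      case (elim n)
      have "\<Delta> n = \<Delta> n powr (1 - \<alpha>) * h n" unfolding h_def powr_add[symmetric] using pos[of n] by simp
      then have "C * \<Delta> n = (C * \<Delta> n powr (1 - \<alpha>)) * h n" by simp
      also have "\<dots> \<le> 1 / 2 * h n" using elim by (intro mult_right_mono) (auto simp: h_def)
      finally show ?case by simp
    qed
  qed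
  have hK: "h n / K n = \<Delta> n powr (\<alpha> - expo)" for n
    unfolding h_def threshold by (rule powr_diff[symmetric])
  have "(\<lambda>n. h n / K n) \<longlonglongrightarrow> 0" unfolding hK using \<alpha> by (intro pw) auto
  then have hK1: "eventually (\<lambda>n. h n / K n < 1) sequentially" by (intro order_tendstoD) auto
  have \<kappa>1: "eventually (\<lambda>n. \<kappa> n < 1 / 2) sequentially" using \<kappa>0 by (intro order_tendstoD) auto
  have Lev: "eventually (\<lambda>n. \<forall>i\<in>{1..n}. (LINT s:{(real i - 1) * \<Delta> n..real i * \<Delta> n}|lborel. lam s) \<le> L n) sequentially"
    unfolding L_def by (rule limsup_sup_bound[OF pos intensity_local(2)])
  have bound: "eventually (\<lambda>n. norm (char (distr M borel (?V n)) t - char (distr M borel (?S n)) t) \<le> B t n) sequentially" for t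
    using N1 small hK1 \<kappa>1 Lev
  proof eventually_elim
    case (elim n)
    have "0 < h n" "0 < K n" using pos[of n] by (auto simp: h_def threshold)
    moreover have "h n < K n" using elim(3) \<open>0 < K n\<close> by simp
    moreover have "\<bar>\<Lambda> n - N n\<bar> < \<kappa> n * N n"
    proof -
      have "0 < N n powr (3 / 4)" using elim(1) by auto
      then show ?thesis using gap[OF elim(1)] by linarith
    qed
    ultimately show ?case
      unfolding B_def \<Lambda>_def
      by (intro char_bound pos C0 C density_even Cf(2)) (use elim in auto)
  qed

  have B0: "(\<lambda>n. B t n) \<longlonglongrightarrow> 0" for t
  proof -
    have t1: "(\<lambda>n. real n * (L n)\<^sup>2) \<longlonglongrightarrow> 0"
    proof -
      have "(\<lambda>n. (lam_star + 1)\<^sup>2 * (real n * (\<Delta> n)\<^sup>2)) \<longlonglongrightarrow> (lam_star + 1)\<^sup>2 * 0"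
        by (intro tendsto_mult tendsto_const mesh(4))
      then show ?thesis by (simp add: L_def power_mult_distrib mult_ac)
    qed
    have t2: "(\<lambda>n. real n * exp (- (h n)\<^sup>2 / (32 * C\<^sup>2 * \<Delta> n))) \<longlonglongrightarrow> 0"
    proof -
      have "(\<lambda>n. real n * exp (- (1 / (32 * C\<^sup>2) * \<Delta> n powr (- (1 - 2 * \<alpha>))))) \<longlonglongrightarrow> 0"
        using C0(1) \<alpha> by (intro mesh_exp_tail pos mesh(2,4)) auto
      moreover have "- (h n)\<^sup>2 / (32 * C\<^sup>2 * \<Delta> n) = - (1 / (32 * C\<^sup>2) * \<Delta> n powr (- (1 - 2 * \<alpha>)))" for n
      proof -
        have "(h n)\<^sup>2 / \<Delta> n = \<Delta> n powr (2 * \<alpha>) / \<Delta> n powr 1"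
          unfolding h_def using pos[of n] by (simp add: powr_power mult.commute)
        also have "\<dots> = \<Delta> n powr (- (1 - 2 * \<alpha>))" unfolding powr_diff[symmetric] by simp
        finally have e: "(h n)\<^sup>2 / \<Delta> n = \<Delta> n powr (- (1 - 2 * \<alpha>))" .
        have "- (h n)\<^sup>2 / (32 * C\<^sup>2 * \<Delta> n) = - (1 / (32 * C\<^sup>2) * ((h n)\<^sup>2 / \<Delta> n))" by simp
        then show ?thesis unfolding e .
      qed
      ultimately show ?thesis by (simp only:)
    qed
    have t3: "(\<lambda>n. \<Lambda> n / (\<kappa> n * N n - \<bar>\<Lambda> n - N n\<bar>)\<^sup>2) \<longlonglongrightarrow> 0"
    proof -
      have "(\<lambda>n. \<Lambda> n / N n * N n powr (- (1 / 2))) \<longlonglongrightarrow> 1 * 0"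
        by (intro tendsto_mult \<Lambda>N Ninv) simp
      moreover have "eventually (\<lambda>n. \<Lambda> n / N n * N n powr (- (1 / 2)) = \<Lambda> n / (\<kappa> n * N n - \<bar>\<Lambda> n - N n\<bar>)\<^sup>2) sequentially"
        using N1
      proof eventually_elim
        case (elim n)
        have "(N n powr (3 / 4))\<^sup>2 = N n powr (1 + 1 / 2)" using elim by (simp add: powr_power)
        also have "\<dots> = N n * N n powr (1 / 2)" using elim by (simp only: powr_add) simp
        finally have s: "(N n powr (3 / 4))\<^sup>2 = N n * N n powr (1 / 2)" .
        show ?case unfolding gap[OF elim] s powr_minus_divide by simp
      qed
      ultimately show ?thesis using tendsto_cong by fastforce
    qed
    have t4: "(\<lambda>n. 2 * N n * (2 * Cf * (2 * K n) ^ 3)) \<longlonglongrightarrow> 0"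
    proof -
      \<comment> \<open>The constant is the product of the two factors 2 with the cube of 2 from
        \<open>2 * K\<close>.\<close>
      have "(\<lambda>n. 32 * Cf * lam_bar * (real n * (\<Delta> n)\<^sup>2 * \<Delta> n powr (3 * expo - 1))) \<longlonglongrightarrow> 32 * Cf * lam_bar * 0"
        using exponent by (intro tendsto_mult tendsto_const nD) auto
      moreover have "32 * Cf * lam_bar * (real n * (\<Delta> n)\<^sup>2 * \<Delta> n powr (3 * expo - 1)) = 2 * N n * (2 * Cf * (2 * K n) ^ 3)" for n
      proof -
        have "K n ^ 3 = \<Delta> n powr (1 + (3 * expo - 1))" unfolding threshold using pos[of n] by (simp add: powr_power mult.commute)
        also have "\<dots> = \<Delta> n * \<Delta> n powr (3 * expo - 1)" using pos[of n] by (simp only: powr_add) simp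
        finally show ?thesis unfolding power_mult_distrib rate by (simp add: power2_eq_square)
      qed
      ultimately show ?thesis by simp
    qed
    have t6: "(\<lambda>n. 2 / sqrt (N n) * sqrt (\<sigma>\<^sub>\<eta>\<^sup>2 * (2 * (\<kappa> n * N n + 1) + 2 * (2 * N n * (h n / K n)\<^sup>2)))) \<longlonglongrightarrow> 0"
    proof -
      \<comment> \<open>Taking \<open>N\<close> out of the root cancels the normalization; the term
        \<open>N powr (- 1)\<close> is the trace of rounding \<open>N\<close> to an integer.\<close>
      have "(\<lambda>n. 2 * sqrt (\<sigma>\<^sub>\<eta>\<^sup>2 * (2 * (\<kappa> n + N n powr (- 1)) + 4 * (h n / K n)\<^sup>2))) \<longlonglongrightarrow> 2 * sqrt (\<sigma>\<^sub>\<eta>\<^sup>2 * (2 * (0 + 0) + 4 * 0\<^sup>2))"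
        by (intro tendsto_mult tendsto_real_sqrt tendsto_add tendsto_power tendsto_const \<kappa>0 Ninv) (use \<open>(\<lambda>n. h n / K n) \<longlonglongrightarrow> 0\<close> in auto)
      moreover have "eventually (\<lambda>n. 2 * sqrt (\<sigma>\<^sub>\<eta>\<^sup>2 * (2 * (\<kappa> n + N n powr (- 1)) + 4 * (h n / K n)\<^sup>2)) =
        2 / sqrt (N n) * sqrt (\<sigma>\<^sub>\<eta>\<^sup>2 * (2 * (\<kappa> n * N n + 1) + 2 * (2 * N n * (h n / K n)\<^sup>2)))) sequentially"
        using N1
      proof eventually_elim
        case (elim n)
        have "\<sigma>\<^sub>\<eta>\<^sup>2 * (2 * (\<kappa> n * N n + 1) + 2 * (2 * N n * (h n / K n)\<^sup>2)) =
            N n * (\<sigma>\<^sub>\<eta>\<^sup>2 * (2 * (\<kappa> n + N n powr (- 1)) + 4 * (h n / K n)\<^sup>2))"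
          using elim by (simp add: powr_minus algebra_simps)
        then show ?case using elim by (simp only: real_sqrt_mult) simp
      qed
      ultimately show ?thesis using tendsto_cong by fastforce
    qed
    have h0: "h \<longlonglongrightarrow> 0" unfolding h_def using \<alpha> exponent by (intro pw) auto
    have t7: "(\<lambda>n. 2 / sqrt (N n) * sqrt ((2 * Cf + 1) * (2 * N n * ((1 + \<bar>\<beta>\<bar>) * h n)\<^sup>2))) \<longlonglongrightarrow> 0"
    proof -
      have "(\<lambda>n. 2 * sqrt ((2 * Cf + 1) * (2 * ((1 + \<bar>\<beta>\<bar>) * h n)\<^sup>2))) \<longlonglongrightarrow> 2 * sqrt ((2 * Cf + 1) * (2 * ((1 + \<bar>\<beta>\<bar>) * 0)\<^sup>2))"
        by (intro tendsto_mult tendsto_real_sqrt tendsto_power tendsto_const h0)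
      moreover have "eventually (\<lambda>n. 2 * sqrt ((2 * Cf + 1) * (2 * ((1 + \<bar>\<beta>\<bar>) * h n)\<^sup>2)) =
        2 / sqrt (N n) * sqrt ((2 * Cf + 1) * (2 * N n * ((1 + \<bar>\<beta>\<bar>) * h n)\<^sup>2))) sequentially"
        using N1
      proof eventually_elim
        case (elim n)
        have "(2 * Cf + 1) * (2 * N n * ((1 + \<bar>\<beta>\<bar>) * h n)\<^sup>2) = N n * ((2 * Cf + 1) * (2 * ((1 + \<bar>\<beta>\<bar>) * h n)\<^sup>2))"
          by simp
        then show ?case using elim by (simp only: real_sqrt_mult[of "N n"]) simp
      qed
      ultimately show ?thesis using tendsto_cong by fastforce
    qed
    \<comment> \<open>Up to constants this is the square root of \<open>N\<close> times the fourth
      power of \<open>h\<close>, which is n times the square of \<Delta> times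
      \<open>\<Delta> powr (4 * \<alpha> - 1)\<close>.\<close>
    have t8: "(\<lambda>n. 2 / sqrt (N n) * (2 * (1 + \<bar>\<beta>\<bar>) * (h n)\<^sup>2 * (2 * N n * (2 * Cf + 1)))) \<longlonglongrightarrow> 0"
    proof -
      have "(\<lambda>n. 8 * (1 + \<bar>\<beta>\<bar>) * (2 * Cf + 1) * sqrt (lam_bar * (real n * (\<Delta> n)\<^sup>2 * \<Delta> n powr (4 * \<alpha> - 1)))) \<longlonglongrightarrow>
          8 * (1 + \<bar>\<beta>\<bar>) * (2 * Cf + 1) * sqrt (lam_bar * 0)"
        using \<alpha> by (intro tendsto_mult tendsto_real_sqrt tendsto_const nD) auto
      moreover have "eventually (\<lambda>n. 8 * (1 + \<bar>\<beta>\<bar>) * (2 * Cf + 1) * sqrt (lam_bar * (real n * (\<Delta> n)\<^sup>2 * \<Delta> n powr (4 * \<alpha> - 1))) =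
        2 / sqrt (N n) * (2 * (1 + \<bar>\<beta>\<bar>) * (h n)\<^sup>2 * (2 * N n * (2 * Cf + 1)))) sequentially"
        using N1
      proof eventually_elim
        case (elim n)
        have "((h n)\<^sup>2)\<^sup>2 = h n ^ 4" by (simp only: power_mult[symmetric]) simp
        also have "\<dots> = \<Delta> n powr (1 + (4 * \<alpha> - 1))"
          unfolding h_def using pos[of n] by (simp add: powr_power mult.commute)
        also have "\<dots> = \<Delta> n * \<Delta> n powr (4 * \<alpha> - 1)" using pos[of n] by (simp only: powr_add) simp
        finally have "lam_bar * (real n * (\<Delta> n)\<^sup>2 * \<Delta> n powr (4 * \<alpha> - 1)) = N n * ((h n)\<^sup>2)\<^sup>2"
          unfolding rate by (simp add: power2_eq_square)
        then have e1: "sqrt (lam_bar * (real n * (\<Delta> n)\<^sup>2 * \<Delta> n powr (4 * \<alpha> - 1))) = sqrt (N n) * (h n)\<^sup>2"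
          by (simp only: real_sqrt_mult real_sqrt_abs) simp
        have e2: "N n / sqrt (N n) = sqrt (N n)" using elim by (simp add: real_div_sqrt)
        have "2 / sqrt (N n) * (2 * (1 + \<bar>\<beta>\<bar>) * (h n)\<^sup>2 * (2 * N n * (2 * Cf + 1))) =
            8 * (1 + \<bar>\<beta>\<bar>) * (2 * Cf + 1) * ((N n / sqrt (N n)) * (h n)\<^sup>2)" by simp
        then show ?case unfolding e1 e2 by (rule sym)
      qed
      ultimately show ?thesis using tendsto_cong by fastforce
    qed
    have eq: "B t n = 2 * (real n * (L n)\<^sup>2 + 4 * (real n * exp (- (h n)\<^sup>2 / (32 * C\<^sup>2 * \<Delta> n))) +
        \<Lambda> n / (\<kappa> n * N n - \<bar>\<Lambda> n - N n\<bar>)\<^sup>2 + 2 * N n * (2 * Cf * (2 * K n) ^ 3)) +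
      \<bar>t\<bar> * (2 * \<kappa> n * \<bar>\<sigma>\<^sub>\<eta>\<bar> + (2 / sqrt (N n) * sqrt (\<sigma>\<^sub>\<eta>\<^sup>2 * (2 * (\<kappa> n * N n + 1) + 2 * (2 * N n * (h n / K n)\<^sup>2))) +
        2 / sqrt (N n) * sqrt ((2 * Cf + 1) * (2 * N n * ((1 + \<bar>\<beta>\<bar>) * h n)\<^sup>2)) +
        2 / sqrt (N n) * (2 * (1 + \<bar>\<beta>\<bar>) * (h n)\<^sup>2 * (2 * N n * (2 * Cf + 1)))))" for n
      unfolding B_def distrib_left[of "2 / sqrt (N n)"] by simp
    have "(\<lambda>n. B t n) \<longlonglongrightarrow> 2 * (0 + 4 * 0 + 0 + 0) + \<bar>t\<bar> * (2 * 0 * \<bar>\<sigma>\<^sub>\<eta>\<bar> + (0 + 0 + 0))"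
      unfolding eq by (intro tendsto_add tendsto_mult tendsto_const t1 t2 t3 t4 t6 t7 t8 \<kappa>0)
    then show ?thesis by simp
  qed

  have Vm: "random_variable borel (?V n)" for n
    using beta_hat_measurable[where \<Delta>=\<Delta> and n=n and K=K, OF pos] by measurable
  show ?thesis
  proof (rule levy_continuity)
    show "real_distribution (distr M borel (?V n))" for n
      using Vm by (simp add: real_distribution_distr)
    show "real_distribution (normal_law 0 (\<sigma>\<^sub>\<eta>\<^sup>2))" by (rule real_distribution_normal_law)
    fix t
    have "(\<lambda>n. char (distr M borel (?V n)) t - char (distr M borel (?S n)) t) \<longlonglongrightarrow> 0"
      by (rule Lim_null_comparison[OF bound B0])
    moreover have "(\<lambda>n. char (distr M borel (?S n)) t) \<longlonglongrightarrow> char (normal_law 0 (\<sigma>\<^sub>\<eta>\<^sup>2)) t"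
      by (rule char_normalized_sum[where \<mu>="distr M borel (\<eta> 0)", OF noise_at_jumps(1)[unfolded noise_eq]])
        (use noise_facts Ntop in auto)
    ultimately show "(\<lambda>n. char (distr M borel (?V n)) t) \<longlonglongrightarrow> char (normal_law 0 (\<sigma>\<^sub>\<eta>\<^sup>2)) t"
      using tendsto_add by fastforce
  qed
qed

end
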